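(* Let $\nu\ge 1$ be an integer, let $a<b$ be fixed real numbers, and let $\Omega=[a,b]^{\mathbb{Z}^\nu}$ be the set of functions $v:\mathbb{Z}^\nu\to[a,b]$ with the (compact metrizable) Tychonoff product topology. For $v\in\Omega$ let $h(v)$ be the Jacobi matrix on $\ell^2(\mathbb{Z}^\nu)$ given by $$(h(v)u)(n)=\sum_{|j|=1}u(n+j)+v(n)u(n).$$ Then there is a dense $G_\delta$ subset $\mathcal{G}\subset\Omega$ such that for every $v\in\mathcal{G}$, $h(v)$ has spectrum $[a-2\nu,\,b+2\nu]$ and the spectrum is purely singular continuous.
   Context: The sum over $|j|=1$ runs over the $2\nu$ nearest neighbors of $0$ in $\mathbb{Z}^\nu$. For a self-adjoint operator $H$, $d\mu^\psi_H$ is the spectral measure given by $(\psi,e^{isH}\psi)=\int e^{isE}\,d\mu_H^\psi(E)$. The spectrum of $H$ is purely singular continuous if for every vector $\psi$ the measure $d\mu_H^\psi$ has no pure point part and no absolutely continuous part. *)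

theory Defs
  imports "HOL-Probability.Probability"
begin

text \<open>The Hilbert space \<open>\<ell>\<^sup>2('a)\<close> of complex-valued square-summable functions.\<close>

typedef 'a ell2 = "{u :: 'a \<Rightarrow> complex. (\<lambda>n. (cmod (u n))\<^sup>2) summable_on UNIV}"
  morphisms coord Abs_ell2
  by (rule exI[of _ "\<lambda>_. 0"]) simp

lemma square_summable_add:
  fixes u w :: "'a \<Rightarrow> complex"
  assumes "(\<lambda>n. (cmod (u n))\<^sup>2) summable_on UNIV" "(\<lambda>n. (cmod (w n))\<^sup>2) summable_on UNIV"
  shows "(\<lambda>n. (cmod (u n + w n))\<^sup>2) summable_on UNIV"
proof (rule summable_on_comparison_test)
  show "(\<lambda>n. 2 * (cmod (u n))\<^sup>2 + 2 * (cmod (w n))\<^sup>2) summable_on UNIV"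
    by (intro summable_on_add summable_on_cmult_right assms)
  fix n
  have "(cmod (u n + w n))\<^sup>2 \<le> (cmod (u n) + cmod (w n))\<^sup>2"
    by (intro power_mono norm_triangle_ineq) auto
  also have "\<dots> \<le> 2 * (cmod (u n))\<^sup>2 + 2 * (cmod (w n))\<^sup>2"
    using zero_le_power2[of "cmod (u n) - cmod (w n)"] by (simp add: power2_sum power2_diff)
  finally show "(cmod (u n + w n))\<^sup>2 \<le> 2 * (cmod (u n))\<^sup>2 + 2 * (cmod (w n))\<^sup>2" .
qed simp

lemma square_summable_mult_bounded:
  fixes u c :: "'a \<Rightarrow> complex"
  assumes "(\<lambda>n. (cmod (u n))\<^sup>2) summable_on UNIV" "\<And>n. cmod (c n) \<le> B"
  shows "(\<lambda>n. (cmod (c n * u n))\<^sup>2) summable_on UNIV"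
proof (rule summable_on_comparison_test)
  show "(\<lambda>n. B\<^sup>2 * (cmod (u n))\<^sup>2) summable_on UNIV"
    by (intro summable_on_cmult_right assms)
  fix n
  show "(cmod (c n * u n))\<^sup>2 \<le> B\<^sup>2 * (cmod (u n))\<^sup>2"
    unfolding norm_mult power_mult_distrib
    by (intro mult_right_mono power_mono assms) auto
qed simp

lemma square_summable_sum:
  fixes u :: "'b \<Rightarrow> 'a \<Rightarrow> complex"
  assumes "\<And>j. j \<in> J \<Longrightarrow> (\<lambda>n. (cmod (u j n))\<^sup>2) summable_on UNIV"
  shows "(\<lambda>n. (cmod (\<Sum>j\<in>J. u j n))\<^sup>2) summable_on UNIV"
  using assms
  by (induction J rule: infinite_finite_induct) (simp_all add: square_summable_add)

lemma coord_summable: "(\<lambda>n. (cmod (coord u n))\<^sup>2) summable_on UNIV"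
  using coord[of u] by simp

lemma coord_mult_summable: "(\<lambda>n. cnj (coord u n) * coord w n) summable_on UNIV"
proof (rule abs_summable_summable, rule summable_on_comparison_test)
  show "(\<lambda>n. (cmod (coord u n))\<^sup>2 + (cmod (coord w n))\<^sup>2) summable_on UNIV"
    by (intro summable_on_add coord_summable)
  fix n
  show "norm (cnj (coord u n) * coord w n) \<le> (cmod (coord u n))\<^sup>2 + (cmod (coord w n))\<^sup>2"
    using zero_le_power2[of "cmod (coord u n) - cmod (coord w n)"]
      mult_nonneg_nonneg[OF norm_ge_zero norm_ge_zero, of "coord u n" "coord w n"]
    unfolding norm_mult complex_mod_cnj power2_diff by linarith
qed simp

definition cinner_ell2 :: "'a ell2 \<Rightarrow> 'a ell2 \<Rightarrow> complex" where
  "cinner_ell2 u w = (\<Sum>\<^sub>\<infinity>n. cnj (coord u n) * coord w n)"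

definition scaleC_ell2 :: "complex \<Rightarrow> 'a ell2 \<Rightarrow> 'a ell2" where
  "scaleC_ell2 z u = Abs_ell2 (\<lambda>n. z * coord u n)"

lemma coord_scaleC: "coord (scaleC_ell2 z u) = (\<lambda>n. z * coord u n)"
  unfolding scaleC_ell2_def
  by (rule Abs_ell2_inverse) (simp add: square_summable_mult_bounded[OF coord_summable, of "\<lambda>_. z" "cmod z"])

instantiation ell2 :: (type) real_vector
begin

definition zero_ell2 :: "'a ell2" where "zero_ell2 = Abs_ell2 (\<lambda>_. 0)"
definition plus_ell2 :: "'a ell2 \<Rightarrow> 'a ell2 \<Rightarrow> 'a ell2" where
  "plus_ell2 u w = Abs_ell2 (\<lambda>n. coord u n + coord w n)"
definition uminus_ell2 :: "'a ell2 \<Rightarrow> 'a ell2" where "uminus_ell2 u = scaleC_ell2 (- 1) u"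
definition minus_ell2 :: "'a ell2 \<Rightarrow> 'a ell2 \<Rightarrow> 'a ell2" where "minus_ell2 u w = u + (- w)"
definition scaleR_ell2 :: "real \<Rightarrow> 'a ell2 \<Rightarrow> 'a ell2" where
  "scaleR_ell2 r u = scaleC_ell2 (complex_of_real r) u"

lemma coord_zero: "coord 0 = (\<lambda>_. 0)"
  unfolding zero_ell2_def by (rule Abs_ell2_inverse) simp

lemma coord_add: "coord (u + w) = (\<lambda>n. coord u n + coord w n)"
  unfolding plus_ell2_def
  by (rule Abs_ell2_inverse) (simp add: square_summable_add coord_summable)

lemma coord_uminus: "coord (- u) = (\<lambda>n. - coord u n)"
  by (simp add: uminus_ell2_def coord_scaleC)

lemma coord_diff: "coord (u - w) = (\<lambda>n. coord u n - coord w n)"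
  by (simp add: minus_ell2_def coord_add coord_uminus)

lemma coord_scaleR: "coord (r *\<^sub>R u) = (\<lambda>n. complex_of_real r * coord u n)"
  by (simp add: scaleR_ell2_def coord_scaleC)

instance
  by standard (simp_all add: coord_inject[symmetric] coord_add coord_zero coord_uminus coord_diff
      coord_scaleR algebra_simps)

end

text \<open>The class \<open>real_inner\<close> supplies the norm topology of \<open>\<ell>\<^sup>2\<close>; its real inner product is
  the real part of \<open>cinner_ell2\<close>, so the norm is the usual one.\<close>

instantiation ell2 :: (type) real_inner
begin

definition inner_ell2 :: "'a ell2 \<Rightarrow> 'a ell2 \<Rightarrow> real" where
  "inner_ell2 u w = Re (cinner_ell2 u w)"
definition norm_ell2 :: "'a ell2 \<Rightarrow> real" where "norm_ell2 u = sqrt (inner u u)"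
definition sgn_ell2 :: "'a ell2 \<Rightarrow> 'a ell2" where "sgn_ell2 u = u /\<^sub>R norm u"
definition dist_ell2 :: "'a ell2 \<Rightarrow> 'a ell2 \<Rightarrow> real" where "dist_ell2 u w = norm (u - w)"
definition uniformity_ell2 :: "('a ell2 \<times> 'a ell2) filter" where
  "uniformity_ell2 = (INF e\<in>{0<..}. principal {(x, y). dist x y < e})"
definition open_ell2 :: "'a ell2 set \<Rightarrow> bool" where
  "open_ell2 U \<longleftrightarrow> (\<forall>x\<in>U. \<forall>\<^sub>F (x', y) in uniformity. x' = x \<longrightarrow> y \<in> U)"

lemma inner_ell2_alt: "inner u w = (\<Sum>\<^sub>\<infinity>n. Re (cnj (coord u n) * coord w n))"
  by (simp only: inner_ell2_def cinner_ell2_def infsum_Re[OF coord_mult_summable])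

lemma inner_ell2_self: "inner u u = (\<Sum>\<^sub>\<infinity>n. (cmod (coord u n))\<^sup>2)"
  unfolding inner_ell2_alt by (rule infsum_cong) (simp add: cmod_power2 flip: power2_eq_square)

instance
proof
  fix u w x :: "'a ell2" and r :: real
  show "sgn u = u /\<^sub>R norm u" by (rule sgn_ell2_def)
  show "dist u w = norm (u - w)" by (rule dist_ell2_def)
  show "(uniformity :: ('a ell2 \<times> 'a ell2) filter) = (INF e\<in>{0<..}. principal {(x, y). dist x y < e})"
    by (rule uniformity_ell2_def)
  show "open U \<longleftrightarrow> (\<forall>x\<in>U. \<forall>\<^sub>F (x', y) in uniformity. x' = x \<longrightarrow> y \<in> U)" for U :: "'a ell2 set"
    by (rule open_ell2_def)
  have re_summable: "(\<lambda>n. Re (cnj (coord y n) * coord z n)) summable_on UNIV" for y z :: "'a ell2"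
    by (rule summable_on_Re[OF coord_mult_summable])
  show "inner u w = inner w u"
    unfolding inner_ell2_alt by (rule infsum_cong) (simp add: algebra_simps)
  show "inner (u + w) x = inner u x + inner w x"
    unfolding inner_ell2_alt infsum_add[OF re_summable re_summable, symmetric]
    by (rule infsum_cong) (simp add: coord_add algebra_simps)
  show "inner (r *\<^sub>R u) w = r * inner u w"
    unfolding inner_ell2_alt infsum_cmult_right'[symmetric]
    by (rule infsum_cong) (simp add: coord_scaleR algebra_simps)
  show "0 \<le> inner u u"
    unfolding inner_ell2_self by (rule infsum_nonneg) simp
  show "inner u u = 0 \<longleftrightarrow> u = 0"
  proof
    assume "inner u u = 0"
    then have "coord u n = 0" for n
      using nonneg_infsum_le_0D[OF _ coord_summable, of u n] by (simp add: inner_ell2_self)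
    then show "u = 0" by (simp add: coord_inject[symmetric] coord_zero fun_eq_iff)
  next
    assume "u = 0"
    then show "inner u u = 0" by (simp add: inner_ell2_self coord_zero)
  qed
  show "norm u = sqrt (inner u u)" by (rule norm_ell2_def)
qed

end

text \<open>Spectrum of a bounded operator: the complement of the set of \<open>z\<close> for which \<open>H - z\<close>
  has a bounded everywhere-defined inverse.\<close>

definition resolvent_set :: "('a ell2 \<Rightarrow> 'a ell2) \<Rightarrow> complex set" where
  "resolvent_set H = {z. bij (\<lambda>u. H u - scaleC_ell2 z u) \<and>
                         bounded_linear (inv (\<lambda>u. H u - scaleC_ell2 z u))}"

definition spectrum :: "('a ell2 \<Rightarrow> 'a ell2) \<Rightarrow> complex set" where
  "spectrum H = - resolvent_set H"

text \<open>\<open>exp (i s H) \<psi>\<close> for a bounded operator \<open>H\<close>, as a power series converging in the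
  norm of \<open>\<ell>\<^sup>2\<close>.\<close>

definition exp_i :: "real \<Rightarrow> ('a ell2 \<Rightarrow> 'a ell2) \<Rightarrow> 'a ell2 \<Rightarrow> 'a ell2" where
  "exp_i s H \<psi> = (\<Sum>k. scaleC_ell2 ((\<i> * of_real s) ^ k / fact k) ((H ^^ k) \<psi>))"

definition is_spectral_measure :: "('a ell2 \<Rightarrow> 'a ell2) \<Rightarrow> 'a ell2 \<Rightarrow> real measure \<Rightarrow> bool" where
  "is_spectral_measure H \<psi> \<mu> \<longleftrightarrow>
     finite_measure \<mu> \<and> sets \<mu> = sets borel \<and>
     (\<forall>s. cinner_ell2 \<psi> (exp_i s H \<psi>) = complex_lebesgue_integral \<mu> (\<lambda>E. exp (\<i> * of_real (s * E))))"

text \<open>\<open>\<mu> = \<mu>\<^sub>p\<^sub>p + \<mu>\<^sub>a\<^sub>c + \<mu>\<^sub>s\<^sub>c\<close>, relative to Lebesgue measure.\<close>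

definition lebesgue_decomposition ::
  "real measure \<Rightarrow> real measure \<Rightarrow> real measure \<Rightarrow> real measure \<Rightarrow> bool" where
  "lebesgue_decomposition \<mu> \<mu>pp \<mu>ac \<mu>sc \<longleftrightarrow>
     sets \<mu>pp = sets borel \<and> sets \<mu>ac = sets borel \<and> sets \<mu>sc = sets borel \<and>
     (\<forall>A\<in>sets borel. emeasure \<mu> A = emeasure \<mu>pp A + emeasure \<mu>ac A + emeasure \<mu>sc A) \<and>
     (\<exists>C. countable C \<and> emeasure \<mu>pp (UNIV - C) = 0) \<and>
     absolutely_continuous lborel \<mu>ac \<and>
     (\<forall>E. emeasure \<mu>sc {E} = 0) \<and>
     (\<exists>N\<in>null_sets lborel. emeasure \<mu>sc (UNIV - N) = 0)"

definition purely_sc_measure :: "real measure \<Rightarrow> bool" where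
  "purely_sc_measure \<mu> \<longleftrightarrow>
     (\<exists>\<mu>pp \<mu>ac \<mu>sc. lebesgue_decomposition \<mu> \<mu>pp \<mu>ac \<mu>sc \<and>
        emeasure \<mu>pp UNIV = 0 \<and> emeasure \<mu>ac UNIV = 0)"

text \<open>A spectral measure is unique (\<open>is_spectral_measure_unique\<close> below), so \<open>\<exists>\<mu>\<close>
  refers to the spectral measure of \<open>\<psi>\<close>; unlike \<open>\<forall>\<mu>\<close>, it also asserts its existence.\<close>

definition purely_singular_continuous :: "('a ell2 \<Rightarrow> 'a ell2) \<Rightarrow> bool" where
  "purely_singular_continuous H \<longleftrightarrow>
     (\<forall>\<psi>. \<exists>\<mu>. is_spectral_measure H \<psi> \<mu> \<and> purely_sc_measure \<mu>)"

lemma is_spectral_measure_unique: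
  assumes "is_spectral_measure H \<psi> \<mu>" "is_spectral_measure H \<psi> \<mu>'"
  shows "\<mu> = \<mu>'"
proof -
  interpret M: finite_measure \<mu> using assms(1) by (simp add: is_spectral_measure_def)
  interpret M': finite_measure \<mu>' using assms(2) by (simp add: is_spectral_measure_def)
  have sets: "sets \<mu> = sets borel" "sets \<mu>' = sets borel"
    using assms by (simp_all add: is_spectral_measure_def)
  have space: "space \<mu> = UNIV" "space \<mu>' = UNIV"
    using sets_eq_imp_space_eq[OF sets(1)] sets_eq_imp_space_eq[OF sets(2)] by simp_all
  have eq: "char \<mu> = char \<mu>'"
    using assms by (simp add: is_spectral_measure_def char_def fun_eq_iff)
  define m where "m = measure \<mu> UNIV"
  have "char \<mu> 0 = char \<mu>' 0" by (simp add: eq)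
  then have m': "measure \<mu>' UNIV = m"
    by (simp add: m_def char_def space)
  have em: "emeasure \<mu> UNIV = ennreal m" "emeasure \<mu>' UNIV = ennreal m"
    by (simp_all add: M.emeasure_eq_measure M'.emeasure_eq_measure m' m_def[symmetric])
  show ?thesis
  proof (cases "m = 0")
    case True
    have "emeasure \<mu> A = emeasure \<mu>' A" for A
    proof -
      have "emeasure \<mu> A \<le> emeasure \<mu> UNIV" "emeasure \<mu>' A \<le> emeasure \<mu>' UNIV"
        using emeasure_space[of \<mu> A] emeasure_space[of \<mu>' A] by (simp_all add: space)
      then show ?thesis using em True by simp
    qed
    then show ?thesis by (intro measure_eqI) (simp_all add: sets)
  next
    case False
    then have m: "m > 0" by (simp add: m_def zero_less_measure_iff order.not_eq_order_implies_strict)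
    define S where "S \<nu> = scale_measure (ennreal (1 / m)) \<nu>" for \<nu> :: "real measure"
    have S: "real_distribution (S \<nu>)" "char (S \<nu>) = (\<lambda>t. of_real (1 / m) * char \<nu> t)"
      if "sets \<nu> = sets borel" "emeasure \<nu> UNIV = ennreal m" for \<nu>
    proof -
      have sp: "space \<nu> = UNIV" using sets_eq_imp_space_eq[OF that(1)] by simp
      have "emeasure (S \<nu>) (space (S \<nu>)) = 1"
        using m by (simp add: S_def sp space_scale_measure that(2) ennreal_mult[symmetric])
      then show "real_distribution (S \<nu>)"
        unfolding real_distribution_def real_distribution_axioms_def
        by (auto simp: S_def that sp space_scale_measure intro!: prob_spaceI)
      have "S \<nu> = density \<nu> (\<lambda>_. ennreal (1 / m))"
        by (intro measure_eqI) (simp_all add: S_def emeasure_density nn_integral_cmult)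
      moreover have meas: "(\<lambda>x. iexp (t * x)) \<in> borel_measurable \<nu>" for t
        by (subst measurable_cong_sets[OF that(1) refl]) measurable
      ultimately show "char (S \<nu>) = (\<lambda>t. of_real (1 / m) * char \<nu> t)"
        using m by (simp add: char_def fun_eq_iff integral_density meas scaleR_conv_of_real)
    qed
    have "S \<mu> = S \<mu>'"
      using S[OF sets(1) em(1)] S[OF sets(2) em(2)] eq by (intro Levy_uniqueness) simp_all
    then have "ennreal (1/m) * emeasure \<mu> A = ennreal (1/m) * emeasure \<mu>' A" for A
      unfolding S_def by (metis emeasure_scale_measure)
    then have "emeasure \<mu> A = emeasure \<mu>' A" for A
      using m by (simp add: ennreal_mult_cancel_left)
    then show ?thesis by (intro measure_eqI) (simp_all add: sets)
  qed
qed

text \<open>\<open>\<int>\<^sup>\<nu>\<close> is \<open>int ^ 'n\<close> with \<open>\<nu> = CARD('n)\<close>.  The nearest neighbours of \<open>0\<close> are the \<open>2\<nu>\<close> vectors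
  of Euclidean length 1; \<open>int\<close> carries no norm in the library, hence the explicit sum.\<close>

definition neighbours :: "(int ^ 'n) set" where
  "neighbours = {j. (\<Sum>i\<in>UNIV. (j $ i)\<^sup>2) = 1}"

text \<open>For bounded \<open>v\<close> the function below is square-summable (\<open>coord_jacobi\<close>); for
  unbounded \<open>v\<close> the value of \<open>Abs_ell2\<close> is meaningless.\<close>

definition jacobi :: "(int ^ 'n \<Rightarrow> real) \<Rightarrow> (int ^ 'n) ell2 \<Rightarrow> (int ^ 'n) ell2" where
  "jacobi v u = Abs_ell2 (\<lambda>n. (\<Sum>j\<in>neighbours. coord u (n + j)) + of_real (v n) * coord u n)"

lemma neighbours_eq: "neighbours = (\<Union>i. {axis i 1, axis i (- 1)})"
proof (intro equalityI subsetI)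
  fix j :: "int ^ 'n"
  assume "j \<in> neighbours"
  then have sum: "(\<Sum>i\<in>UNIV. (j $ i)\<^sup>2) = 1" by (simp add: neighbours_def)
  then obtain i where i: "j $ i \<noteq> 0" by (cases "\<forall>i. j $ i = 0") auto
  have split: "(j $ i)\<^sup>2 + (\<Sum>k\<in>UNIV - {i}. (j $ k)\<^sup>2) = 1"
    using sum by (simp add: sum.remove[of UNIV i])
  have "(j $ i)\<^sup>2 > 0" using i by simp
  moreover have ge: "(\<Sum>k\<in>UNIV - {i}. (j $ k)\<^sup>2) \<ge> 0" by (simp add: sum_nonneg)
  ultimately have one: "(j $ i)\<^sup>2 = 1" and rest: "(\<Sum>k\<in>UNIV - {i}. (j $ k)\<^sup>2) = 0"
    using split by linarith+
  have zero: "j $ k = 0" if "k \<noteq> i" for k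
    using rest that by (simp add: sum_nonneg_eq_0_iff)
  have "j $ i = 1 \<or> j $ i = - 1" using one by (simp add: power2_eq_1_iff)
  then have "j = axis i 1 \<or> j = axis i (- 1)"
    using zero by (auto simp: vec_eq_iff axis_def)
  then show "j \<in> (\<Union>i. {axis i 1, axis i (- 1)})" by blast
next
  fix j :: "int ^ 'n"
  assume "j \<in> (\<Union>i. {axis i 1, axis i (- 1)})"
  then obtain i and c :: int where j: "j = axis i c" and c: "c\<^sup>2 = 1" by auto
  have "(\<Sum>k\<in>UNIV. (j $ k)\<^sup>2) = (\<Sum>k\<in>UNIV. if k = i then c\<^sup>2 else 0)"
    by (rule sum.cong) (auto simp: j axis_def)
  then show "j \<in> neighbours" by (simp add: neighbours_def c)
qed

lemma card_neighbours: "card (neighbours :: (int ^ 'n) set) = 2 * CARD('n)"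
proof -
  have "card (\<Union>i. {axis i 1, axis i (- 1) :: int ^ 'n}) = (\<Sum>i\<in>UNIV. card {axis i 1, axis i (- 1) :: int ^ 'n})"
    by (rule card_UN_disjoint) (auto simp: axis_eq_axis)
  also have "\<dots> = (\<Sum>i\<in>(UNIV :: 'n set). 2)"
    by (intro sum.cong) (auto simp: axis_eq_axis card_insert_if)
  finally show ?thesis by (simp add: neighbours_eq)
qed

lemma coord_jacobi:
  assumes "\<And>n. \<bar>v n\<bar> \<le> B"
  shows "coord (jacobi v u) = (\<lambda>n. (\<Sum>j\<in>neighbours. coord u (n + j)) + of_real (v n) * coord u n)"
  unfolding jacobi_def
proof (rule Abs_ell2_inverse, clarsimp, intro square_summable_add square_summable_sum)
  fix j :: "int ^ 'a"
  have "bij_betw (\<lambda>n. n + j) UNIV UNIV"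
    by (rule bij_betwI[where g = "\<lambda>n. n - j"]) auto
  from summable_on_reindex_bij_betw[OF this, of "\<lambda>n. (cmod (coord u n))\<^sup>2"]
  show "(\<lambda>n. (cmod (coord u (n + j)))\<^sup>2) summable_on UNIV" by (simp add: coord_summable)
next
  show "(\<lambda>n. (cmod (of_real (v n) * coord u n))\<^sup>2) summable_on UNIV"
    using assms by (intro square_summable_mult_bounded[OF coord_summable]) auto
qed

definition config_space :: "real \<Rightarrow> real \<Rightarrow> (int ^ 'n \<Rightarrow> real) topology" where
  "config_space a b = product_topology (\<lambda>_. top_of_set {a..b}) UNIV"

end

theory Submission
  imports Defs "HOL-Real_Asymp.Real_Asymp"
begin

text \<open>
  Being residual reduces to the density of three countable families of sets of potentials. They are
  open because membership is witnessed by finitely many values of \<open>v\<close>, or by matrix elements of polynomials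
  of \<open>h v\<close>, each of which depends on finitely many values of \<open>v\<close>.

  Spectrum: generically \<open>v\<close> is almost equal to any given \<open>c \<in> [a, b]\<close> on arbitrarily large cubes, and plane
  waves cut off to such cubes are approximate eigenvectors with energies in \<open>[c - 2 \<nu>, c + 2 \<nu>]\<close>.

  No atoms: a periodic \<open>h v\<close> has no eigenvalues. By unique continuation \<open>h v - E\<close> is injective on
  the vectors supported in a box, and its range there almost exhausts a slightly larger box.
  A trace estimate therefore bounds the peak polynomials \<open>(1 - s (h v - E)\<^sup>2) ^ k\<close> on the average
  over the box, which by periodicity is their size at each site.

  No absolutely continuous part: outside a large cube let \<open>v\<close> be the sum of one-dimensional potentials of
  the coordinates, which contain long periodic barriers. For each energy some barrier has
  a transfer matrix with \<open>\<bar>trace\<bar> > 2\<close>; finitely many barriers suffice by compactness.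
  The resolvent at distance \<open>\<eta>\<close> from the real axis is then exponentially small in the barrier length \<open>p\<close>
  beyond the barriers, whereas the enclosed box has only polynomially many sites. So the spectral measure,
  smoothed at the scale of a power of \<open>1 / p\<close>, is close to that of the operator on the box, which
  is carried by as many points as the box has sites. It is thus concentrated on a set of small Lebesgue
  measure.
\<close>

section \<open>Spectral measures of bounded symmetric operators\<close>

text \<open>An atom and an absolutely continuous part are limit notions, so each of the two negative
  statements is replaced by inequalities with a margin that a polynomial witnesses. For atoms it is
  q(E)^2 \<mu>({E}) <= integral of q^2. For the absolutely continuous part it is a nonnegative
  polynomial of small integral that is at least 1 off a set of small length.

  In dimension above 1 a barrier has no transfer matrix. Separability makes up for that: the
  operator is a one-dimensional one plus a commuting transverse operator H', so its resolvent is the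
  one-dimensional Green function at energy z - t with H' put in place of t. As t sweeps an interval,
  a barrier has to block a whole window of energies, which is why several words are strung together.

  The box has about p^\<nu> sites, and their number times the smoothing scale \<eta> has to vanish;
  hence \<eta> = p^-(\<nu> + 1). All comparisons of resolvents together lose a factor \<eta>^-5,
  still a power of p, which the exponential decay in p beats.\<close>

definition opoly :: "('h \<Rightarrow> 'h) \<Rightarrow> real poly \<Rightarrow> 'h \<Rightarrow> 'h::real_vector" where
  "opoly A p x = fold_coeffs (\<lambda>a y. a *\<^sub>R x + A y) p 0"

lemma opoly_0 [simp]: "opoly A 0 x = 0"
  by (simp add: opoly_def)

lemma opoly_pCons:
  assumes "linear A"
  shows "opoly A (pCons a p) x = a *\<^sub>R x + A (opoly A p x)"
  by (cases "p = 0 \<and> a = 0") (auto simp: opoly_def linear_0[OF assms])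

lemma opoly_linear:
  assumes "linear A"
  shows "linear (opoly A p)"
proof (induction p)
  case 0
  then show ?case by (simp add: opoly_0 fun_eq_iff linear_iff)
next
  case (pCons a p)
  then show ?case
    using assms by (simp add: linear_iff opoly_pCons algebra_simps)
qed

lemma opoly_add:
  assumes "linear A"
  shows "opoly A (p + q) x = opoly A p x + opoly A q x"
proof (induction p q rule: poly_induct2)
  case (pCons a p b q)
  then show ?case
    by (simp add: opoly_pCons[OF assms] linear_add[OF assms] algebra_simps)
qed simp

lemma opoly_smult:
  assumes "linear A"
  shows "opoly A (smult c p) x = c *\<^sub>R opoly A p x"
  by (induction p) (simp_all add: opoly_pCons[OF assms] linear_scale[OF assms] algebra_simps)

lemma opoly_diff:
  assumes "linear A"
  shows "opoly A (p - q) x = opoly A p x - opoly A q x"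
  using opoly_add[OF assms, of p "smult (-1) q"] opoly_smult[OF assms, of "-1" q] by simp

lemma opoly_mult:
  assumes "linear A"
  shows "opoly A (p * q) x = opoly A p (opoly A q x)"
  by (induction p) (simp_all add: opoly_pCons[OF assms] opoly_add[OF assms] opoly_smult[OF assms])

lemma opoly_1 [simp]:
  assumes "linear A"
  shows "opoly A 1 x = x"
  unfolding one_pCons by (simp add: opoly_pCons[OF assms] linear_0[OF assms])

lemma opoly_const:
  assumes "linear A"
  shows "opoly A [:c:] x = c *\<^sub>R x"
  by (simp add: opoly_pCons[OF assms] linear_0[OF assms])

lemma opoly_linear_factor:
  assumes "linear A"
  shows "opoly A [:c, d:] x = c *\<^sub>R x + d *\<^sub>R A x"
  by (simp add: opoly_pCons[OF assms] linear_0[OF assms] linear_add[OF assms] linear_scale[OF assms])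

lemma opoly_monom:
  assumes "linear A"
  shows "opoly A (monom 1 k) x = (A ^^ k) x"
  using linear_0[OF assms]
  by (induction k) (simp_all add: monom_0 monom_Suc opoly_const[OF assms] opoly_pCons[OF assms])

lemma opoly_sum:
  assumes "linear A"
  shows "opoly A (\<Sum>i\<in>I. p i) x = (\<Sum>i\<in>I. opoly A (p i) x)"
  by (induction I rule: infinite_finite_induct) (simp_all add: opoly_add[OF assms])

lemma opoly_commute:
  assumes "linear A" "linear C" "\<And>x. A (C x) = C (A x)"
  shows "opoly A p (C x) = C (opoly A p x)"
  by (induction p)
    (simp_all add: opoly_pCons[OF assms(1)] assms(3) linear_add[OF assms(2)] linear_scale[OF assms(2)]
      linear_0[OF assms(2)])

section \<open>Bernstein polynomials and the moment problem\<close>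

text \<open>The affine map of [-B, B] onto [0, 1]: products of powers of \<open>xiB B\<close> and
  \<open>1 - xiB B\<close> are Bernstein polynomials transported to the interval that contains the
  spectrum.\<close>

definition xiB :: "real \<Rightarrow> real poly" where "xiB B = [:1/2, 1/(2*B):]"

locale symop =
  fixes A :: "'h \<Rightarrow> 'h::real_inner" and B :: real
  assumes lin: "linear A"
    and sym: "\<And>x y. inner (A x) y = inner x (A y)"
    and bound: "\<And>x. norm (A x) \<le> B * norm x"
    and B_pos: "0 < B"
begin

lemma opoly_sym: "inner (opoly A p x) y = inner x (opoly A p y)"
proof (induction p arbitrary: x y)
  case (pCons a p)
  have "inner (A (opoly A p x)) y = inner x (opoly A p (A y))"
    by (simp add: sym pCons.IH)
  also have "opoly A p (A y) = A (opoly A p y)"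
    by (rule opoly_commute[OF lin lin]) simp
  finally show ?case
    by (simp add: opoly_pCons[OF lin] inner_left_distrib inner_right_distrib)
qed simp

lemma inner_bound: "\<bar>inner x (A x)\<bar> \<le> B * (norm x)\<^sup>2"
proof -
  have "\<bar>inner x (A x)\<bar> \<le> norm x * norm (A x)" by (rule Cauchy_Schwarz_ineq2)
  also have "\<dots> \<le> norm x * (B * norm x)" by (intro mult_left_mono bound) simp
  finally show ?thesis by (simp add: power2_eq_square mult_ac)
qed

lemma inner_poly_square: "inner x (opoly A (p * q * p) x) = inner (opoly A p x) (opoly A q (opoly A p x))"
  by (simp add: opoly_mult[OF lin] opoly_sym flip: mult.assoc)

text \<open>Squares can be moved to both sides of the inner product, so only the parities of
  \<open>k\<close> and \<open>m\<close> matter. The mixed remainder is a sum of two such conjugated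
  terms: X (1 - X) = (1 - X) X (1 - X) + X (1 - X) X.\<close>

lemma bernstein_nonneg: "0 \<le> inner x (opoly A (xiB B ^ k * (1 - xiB B) ^ m) x)"
proof -
  define X where "X = xiB B"
  have pos: "0 \<le> inner y (opoly A X y)" "0 \<le> inner y (opoly A (1 - X) y)" "0 \<le> inner y (opoly A 1 y)" for y
  proof -
    have "- (B * (norm y)\<^sup>2) \<le> inner y (A y)" "inner y (A y) \<le> B * (norm y)\<^sup>2"
      using inner_bound[of y] by auto
    then show "0 \<le> inner y (opoly A X y)" "0 \<le> inner y (opoly A (1 - X) y)" "0 \<le> inner y (opoly A 1 y)"
      using B_pos
      by (simp_all add: X_def xiB_def one_pCons opoly_linear_factor[OF lin] opoly_const[OF lin] inner_add_right
          inner_diff_right dot_square_norm field_simps)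
  qed
  have pos2: "0 \<le> inner y (opoly A (X * (1 - X)) y)" for y
  proof -
    have "X * (1 - X) = (1 - X) * X * (1 - X) + X * (1 - X) * X" by algebra
    then have "inner y (opoly A (X * (1 - X)) y) =
      inner y (opoly A ((1 - X) * X * (1 - X) + X * (1 - X) * X) y)"
      by (rule arg_cong[where f = "\<lambda>p. inner y (opoly A p y)"])
    then show ?thesis using pos by (simp add: opoly_add[OF lin] inner_add_right inner_poly_square)
  qed
  define h where "h = X ^ (k div 2) * (1 - X) ^ (m div 2)"
  define r where "r = X ^ (k mod 2) * (1 - X) ^ (m mod 2)"
  have "X ^ k = X ^ (k div 2) * X ^ (k mod 2) * X ^ (k div 2)" for X :: "real poly" and k
  proof -
    have "k = k div 2 + k mod 2 + k div 2" by presburger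
    then show ?thesis by (metis power_add)
  qed
  from this[of X k] this[of "1 - X" m] have "X ^ k * (1 - X) ^ m = h * r * h"
    unfolding h_def r_def by (simp only: mult_ac)
  moreover have "r \<in> {1, X, 1 - X, X * (1 - X)}"
    unfolding r_def by (cases "even k"; cases "even m") (auto simp: odd_iff_mod_2_eq_one)
  ultimately show ?thesis
    using pos pos2 unfolding X_def[symmetric] by (auto simp: inner_poly_square)
qed

end

text \<open>The factorial moments of the binomial distribution as an algebraic identity. As it holds
  in every commutative ring, \<open>X\<close> may be a polynomial that is later evaluated at the
  operator.\<close>

lemma bernstein_choose_sum:
  fixes X :: "'a::comm_ring_1"
  assumes "j \<le> n"
  shows "(\<Sum>k\<le>n. of_nat (n choose k) * of_nat (k choose j) * (X ^ k * (1 - X) ^ (n - k))) = of_nat (n choose j) * X ^ j"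
proof -
  have "(\<Sum>k\<le>n. of_nat (n choose k) * of_nat (k choose j) * (X ^ k * (1 - X) ^ (n - k))) =
        (\<Sum>k\<in>{j..n}. of_nat (n choose k) * of_nat (k choose j) * (X ^ k * (1 - X) ^ (n - k)))"
    by (rule sum.mono_neutral_right) (auto simp: not_le binomial_eq_0)
  also have "\<dots> = (\<Sum>i\<le>n - j. of_nat (n choose (i + j)) * of_nat ((i + j) choose j) * (X ^ (i + j) * (1 - X) ^ (n - (i + j))))"
    by (rule sum.reindex_bij_witness[of _ "\<lambda>i. i + j" "\<lambda>k. k - j"]) (use assms in auto)
  also have "\<dots> = (\<Sum>i\<le>n - j. of_nat (n choose j) * X ^ j * (of_nat (n - j choose i) * X ^ i * (1 - X) ^ (n - j - i)))"
  proof (rule sum.cong[OF refl])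
    fix i assume i: "i \<in> {..n - j}"
    have "(n choose (i + j)) * ((i + j) choose j) = (n choose j) * ((n - j) choose i)"
      using choose_mult[of j "i + j" n] i assms by simp
    then have "(of_nat (n choose (i + j)) * of_nat ((i + j) choose j) :: 'a) = of_nat (n choose j) * of_nat ((n - j) choose i)"
      by (metis of_nat_mult)
    moreover have "n - (i + j) = n - j - i" by simp
    ultimately show "of_nat (n choose (i + j)) * of_nat ((i + j) choose j) * (X ^ (i + j) * (1 - X) ^ (n - (i + j))) =
      of_nat (n choose j) * X ^ j * (of_nat (n - j choose i) * X ^ i * (1 - X) ^ (n - j - i))"
      by (simp add: power_add mult_ac)
  qed
  also have "\<dots> = of_nat (n choose j) * X ^ j * (X + (1 - X)) ^ (n - j)"
    unfolding binomial_ring sum_distrib_left ..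
  finally show ?thesis by simp
qed

text \<open>Drawing \<open>j\<close> times with replacement against drawing without: both terms are
  products of \<open>j\<close> factors of modulus at most 1, and the factors with index
  \<open>i\<close> differ by at most i / (n - i).\<close>

lemma choose_ratio_approx:
  assumes "k \<le> n" "2 * j < n"
  shows "\<bar>(real k / real n) ^ j - real (k choose j) / real (n choose j)\<bar> \<le> real j * (real j / (real n - real j))"
proof -
  define w where "w i = (real k - real i) / (real n - real i)" for i
  have w1: "norm (w i) \<le> 1" if "i < j" for i
    using assms that by (auto simp: w_def abs_le_iff field_simps)
  have "real (k choose j) / real (n choose j) = (\<Prod>i<j. w i)"
    by (simp add: binomial_gbinomial gbinomial_prod_rev w_def prod_dividef atLeast0LessThan)
  moreover have "(real k / real n) ^ j = (\<Prod>i<j. real k / real n)" by simp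
  moreover have "norm ((\<Prod>i<j. real k / real n) - (\<Prod>i<j. w i)) \<le> (\<Sum>i<j. norm (real k / real n - w i))"
    by (rule norm_prod_diff) (use w1 assms in \<open>auto simp: divide_simps\<close>)
  moreover have "(\<Sum>i<j. norm (real k / real n - w i)) \<le> (\<Sum>i<j. real j / (real n - real j))"
  proof (rule sum_mono)
    fix i assume i: "i \<in> {..<j}"
    have "real k / real n - w i = real i * (real n - real k) / (real n * (real n - real i))"
      using assms i by (simp add: w_def field_simps)
    also have "norm \<dots> = (real i / (real n - real i)) * ((real n - real k) / real n)"
      using assms i by (simp add: abs_mult)
    also have "\<dots> \<le> (real i / (real n - real i)) * 1"
      using assms i by (intro mult_left_mono) auto
    also have "\<dots> \<le> real j / (real n - real j)"
      using assms i by (simp, intro frac_le) auto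
    finally show "norm (real k / real n - w i) \<le> real j / (real n - real j)" .
  qed
  ultimately show ?thesis by simp
qed

context symop
begin

abbreviation "bern n k \<equiv> smult (real (n choose k)) (xiB B ^ k * (1 - xiB B) ^ (n - k))"

lemma bern_weight_nonneg: "0 \<le> inner x (opoly A (bern n k) x)"
  by (simp add: opoly_smult[OF lin] bernstein_nonneg)

lemma bern_weight_moment:
  assumes "j \<le> n"
  shows "(\<Sum>k\<le>n. real (k choose j) * inner x (opoly A (bern n k) x)) =
         real (n choose j) * inner x (opoly A (xiB B ^ j) x)"
proof -
  have eq: "(\<Sum>k\<le>n. smult (real (k choose j)) (bern n k)) = smult (real (n choose j)) (xiB B ^ j)"
    using bernstein_choose_sum[OF assms, of "xiB B"]
    by (simp add: of_nat_poly mult_ac)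
  have "(\<Sum>k\<le>n. real (k choose j) * inner x (opoly A (bern n k) x)) =
    inner x (opoly A (\<Sum>k\<le>n. smult (real (k choose j)) (bern n k)) x)"
    unfolding opoly_sum[OF lin] opoly_smult[OF lin] inner_sum_right inner_scaleR_right ..
  also have "\<dots> = real (n choose j) * inner x (opoly A (xiB B ^ j) x)"
    unfolding eq opoly_smult[OF lin] inner_scaleR_right ..
  finally show ?thesis .
qed

lemma bern_weight_sum: "(\<Sum>k\<le>n. inner x (opoly A (bern n k) x)) = (norm x)\<^sup>2"
  using bern_weight_moment[of 0 n x] by (simp add: opoly_1[OF lin] dot_square_norm)

text \<open>The Bernstein weights of degree \<open>n\<close> form a discrete measure on the points k
  / n. Its factorial moments are exact, and \<open>choose_ratio_approx\<close> turns them into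
  ordinary moments with an error of order 1 / n.\<close>

lemma bern_moment_tendsto:
  "(\<lambda>n. \<Sum>k\<le>n. inner x (opoly A (bern n k) x) * (real k / real n) ^ j) \<longlonglongrightarrow> inner x (opoly A (xiB B ^ j) x)"
proof -
  define c where "c n k = inner x (opoly A (bern n k) x)" for n k
  have bnd: "\<bar>(\<Sum>k\<le>n. c n k * (real k / real n) ^ j) - inner x (opoly A (xiB B ^ j) x)\<bar>
    \<le> (norm x)\<^sup>2 * (real j * (real j / (real n - real j)))" if n: "2 * j < n" for n
  proof -
    have "inner x (opoly A (xiB B ^ j) x) = (\<Sum>k\<le>n. c n k * (real (k choose j) / real (n choose j)))"
      using bern_weight_moment[of j n x] n
      by (simp add: c_def sum_divide_distrib[symmetric] field_simps)
    then have "\<bar>(\<Sum>k\<le>n. c n k * (real k / real n) ^ j) - inner x (opoly A (xiB B ^ j) x)\<bar> =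
      \<bar>\<Sum>k\<le>n. c n k * ((real k / real n) ^ j - real (k choose j) / real (n choose j))\<bar>"
      by (simp add: sum_subtractf algebra_simps)
    also have "\<dots> \<le> (\<Sum>k\<le>n. \<bar>c n k * ((real k / real n) ^ j - real (k choose j) / real (n choose j))\<bar>)"
      by (rule sum_abs)
    also have "\<dots> \<le> (\<Sum>k\<le>n. c n k * (real j * (real j / (real n - real j))))"
      unfolding abs_mult
      by (intro sum_mono mult_mono choose_ratio_approx) (use n bern_weight_nonneg[of x n] in \<open>auto simp: c_def\<close>)
    also have "\<dots> = (norm x)\<^sup>2 * (real j * (real j / (real n - real j)))"
      unfolding sum_distrib_right[symmetric] c_def bern_weight_sum ..
    finally show ?thesis .
  qed
  have lim: "(\<lambda>n. (norm x)\<^sup>2 * (real j * (real j / (real n - real j)))) \<longlonglongrightarrow> 0"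
    by real_asymp
  have "(\<lambda>n. (\<Sum>k\<le>n. c n k * (real k / real n) ^ j) - inner x (opoly A (xiB B ^ j) x)) \<longlonglongrightarrow> 0"
    by (rule Lim_null_comparison[OF eventually_mono[OF eventually_gt_at_top[of "2 * j"]] lim]) (use bnd in auto)
  then show ?thesis unfolding c_def by (rule LIM_zero_cancel)
qed

text \<open>Hausdorff's solution of the moment problem: the Bernstein weights give probability
  measures on [0, 1], and a weak limit along a subsequence has the moments of the operator.\<close>

lemma unit_spectral_measure:
  assumes x: "norm x = 1"
  shows "\<exists>M. real_distribution M \<and> (AE t in M. 0 \<le> t \<and> t \<le> 1) \<and>
           (\<forall>j. (\<integral>t. t ^ j \<partial>M) = inner x (opoly A (xiB B ^ j) x))"
proof -
  define c where "c n k = inner x (opoly A (bern n k) x)" for n k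
  have c0: "0 \<le> c n k" for n k unfolding c_def by (rule bern_weight_nonneg)
  have csum: "(\<Sum>k\<le>n. c n k) = 1" for n by (simp add: c_def bern_weight_sum x)
  \<comment> \<open>\<open>Suc n\<close> keeps the denominator away from 0.\<close>
  define \<mu> where "\<mu> n = distr (point_measure {..Suc n} (\<lambda>k. ennreal (c (Suc n) k))) borel (\<lambda>k. real k / real (Suc n))" for n
  have meas: "(\<lambda>k. real k / real (Suc n)) \<in> borel_measurable (point_measure {..Suc n} (\<lambda>k. ennreal (c (Suc n) k)))" for n
    by (simp add: measurable_def sets_point_measure space_point_measure)
  have pm: "prob_space (point_measure {..Suc n} (\<lambda>k. ennreal (c (Suc n) k)))" for n
  proof (rule prob_spaceI)
    show "emeasure (point_measure {..Suc n} (\<lambda>k. ennreal (c (Suc n) k)))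
      (space (point_measure {..Suc n} (\<lambda>k. ennreal (c (Suc n) k)))) = 1"
      using csum[of "Suc n"] c0
      by (simp add: space_point_measure emeasure_point_measure_finite sum_ennreal del: sum.atMost_Suc)
  qed
  have rd: "real_distribution (\<mu> n)" for n
    unfolding real_distribution_def real_distribution_axioms_def \<mu>_def
    using prob_space.prob_space_distr[OF pm meas] by simp
  have int: "(\<integral>t. f t \<partial>\<mu> n) = (\<Sum>k\<le>Suc n. c (Suc n) k * f (real k / real (Suc n)))"
    if [measurable]: "f \<in> borel_measurable borel" for f :: "real \<Rightarrow> real" and n
    unfolding \<mu>_def by (subst integral_distr[OF meas that])
      (simp add: lebesgue_integral_point_measure_finite c0)
  have "tight \<mu>"
    unfolding tight_def
  proof (intro conjI allI impI rd, rule exI[of _ "-1"], rule exI[of _ 1], intro conjI allI)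
    fix e :: real and n assume "0 < e"
    interpret real_distribution "\<mu> n" by (rule rd)
    have "measure (\<mu> n) {-1<..1} = (\<integral>t. indicator {-1<..1} t \<partial>\<mu> n)" by simp
    also have "\<dots> = (\<Sum>k\<le>Suc n. c (Suc n) k * 1)"
      by (subst int, simp) (intro sum.cong arg_cong2[where f="(*)"] refl, auto simp: field_simps indicator_def)
    also have "\<dots> = 1" using csum[of "Suc n"] by simp
    finally show "1 - e < measure (\<mu> n) {-1<..1}" using \<open>0 < e\<close> by simp
  qed simp
  then obtain r M where r: "strict_mono r" and M: "real_distribution M" and wc: "weak_conv_m (\<mu> \<circ> id \<circ> r) M"
    using tight_imp_convergent_subsubsequence[of \<mu> id] by (auto simp: strict_mono_id)
  interpret M: real_distribution M by (rule M)
  have conv: "(\<lambda>n. \<integral>t. f t \<partial>\<mu> (r n)) \<longlonglongrightarrow> (\<integral>t. f t \<partial>M)"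
    if "\<And>t. isCont f t" "\<And>t. norm (f t) \<le> C" for f :: "real \<Rightarrow> real" and C :: real
  proof -
    have "real_distribution ((\<mu> \<circ> id \<circ> r) n)" for n using rd by simp
    from weak_conv_imp_integral_bdd_continuous_conv[OF this M wc that] show ?thesis by simp
  qed
  \<comment> \<open>Clamping to [0, 1] makes the powers bounded and continuous on the whole line, as
    weak convergence requires, without changing them at the points k / n.\<close>
  define cl where "cl t = max 0 (min 1 t)" for t :: real
  have clc: "isCont cl t" for t unfolding cl_def by (intro continuous_intros)
  have clb: "0 \<le> cl t" "cl t \<le> 1" for t by (auto simp: cl_def)
  have [measurable]: "cl \<in> borel_measurable borel" unfolding cl_def by measurable
  have clk: "cl (real k / real (Suc n)) = real k / real (Suc n)" if "k \<le> Suc n" for k n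
    using that by (simp add: cl_def min_def)
  \<comment> \<open>This bounded continuous function vanishes exactly on [0, 1], so its zero
    integral confines the limit measure to [0, 1].\<close>
  have "AE t in M. min 1 \<bar>t - cl t\<bar> = 0"
  proof -
    have "(\<lambda>n. \<integral>t. min 1 \<bar>t - cl t\<bar> \<partial>\<mu> (r n)) \<longlonglongrightarrow> (\<integral>t. min 1 \<bar>t - cl t\<bar> \<partial>M)"
      by (rule conv[of "\<lambda>t. min 1 \<bar>t - cl t\<bar>" 1]) (auto intro!: continuous_intros clc)
    moreover have "(\<integral>t. min 1 \<bar>t - cl t\<bar> \<partial>\<mu> n) = 0" for n
      by (subst int, simp) (intro sum.neutral ballI, simp add: clk del: of_nat_Suc)
    ultimately have "(\<integral>t. min 1 \<bar>t - cl t\<bar> \<partial>M) = 0"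
      by (simp add: LIMSEQ_const_iff)
    moreover have "integrable M (\<lambda>t. min 1 \<bar>t - cl t\<bar>)"
      by (rule M.integrable_const_bound[where B = 1]) auto
    ultimately show ?thesis
      by (subst (asm) integral_nonneg_eq_0_iff_AE) auto
  qed
  then have supp: "AE t in M. 0 \<le> t \<and> t \<le> 1"
    by eventually_elim (auto simp: cl_def min_def max_def split: if_splits)
  have "(\<integral>t. t ^ j \<partial>M) = inner x (opoly A (xiB B ^ j) x)" for j
  proof -
    have "(\<lambda>n. \<integral>t. cl t ^ j \<partial>\<mu> (r n)) \<longlonglongrightarrow> (\<integral>t. cl t ^ j \<partial>M)"
      by (rule conv[of "\<lambda>t. cl t ^ j" 1])
        (auto intro!: continuous_intros clc power_le_one clb simp: power_abs abs_of_nonneg clb)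
    moreover have "(\<integral>t. cl t ^ j \<partial>\<mu> n) = (\<Sum>k\<le>Suc n. c (Suc n) k * (real k / real (Suc n)) ^ j)" for n
      by (subst int, simp) (intro sum.cong refl, simp add: clk del: of_nat_Suc)
    moreover have "(\<lambda>n. \<Sum>k\<le>Suc (r n). c (Suc (r n)) k * (real k / real (Suc (r n))) ^ j) \<longlonglongrightarrow> inner x (opoly A (xiB B ^ j) x)"
      using LIMSEQ_subseq_LIMSEQ[OF bern_moment_tendsto[of x j, folded c_def], of "Suc \<circ> r"] r
      by (simp add: strict_mono_def o_def)
    ultimately have "(\<integral>t. cl t ^ j \<partial>M) = inner x (opoly A (xiB B ^ j) x)"
      by (simp add: LIMSEQ_unique)
    moreover have "AE t in M. cl t ^ j = t ^ j"
      using supp by eventually_elim (simp add: cl_def)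
    then have "(\<integral>t. cl t ^ j \<partial>M) = (\<integral>t. t ^ j \<partial>M)"
      by (intro integral_cong_AE) auto
    ultimately show ?thesis by simp
  qed
  then show ?thesis using M supp by blast
qed

text \<open>On a bounded interval the polynomial moments determine a finite measure. The Fourier
  characterisation follows from them through the exponential series.\<close>

definition smeas :: "'h \<Rightarrow> real measure \<Rightarrow> bool" where
  "smeas x \<mu> \<longleftrightarrow> finite_measure \<mu> \<and> sets \<mu> = sets borel \<and> (AE t in \<mu>. \<bar>t\<bar> \<le> B) \<and>
     (\<forall>p. (\<integral>t. poly p t \<partial>\<mu>) = inner x (opoly A p x))"

text \<open>The measure of the normalised vector is carried from [0, 1] back to [-B, B] by t -> 2 B
  t - B and rescaled by the squared norm.\<close>

lemma smeas_exists: "\<exists>\<mu>. smeas x \<mu>"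
proof -
  \<comment> \<open>For x = 0 any probability measure on [-B, B] will do, because the density that
    follows is then 0.\<close>
  obtain M where M: "prob_space M" and setsM: "sets M = sets borel" and bM: "AE t in M. \<bar>t\<bar> \<le> B"
    and mom: "x \<noteq> 0 \<Longrightarrow> \<forall>p. (norm x)\<^sup>2 * (\<integral>t. poly p t \<partial>M) = inner x (opoly A p x)"
  proof (cases "x = 0")
    case True
    show ?thesis
      by (rule that[of "return borel 0"]) (use True B_pos in \<open>auto simp: AE_return intro!: prob_space_return\<close>)
  next
    case False
    define u where "u = x /\<^sub>R norm x"
    have u: "norm u = 1" "x = norm x *\<^sub>R u" using False by (auto simp: u_def)
    obtain M0 where M0: "real_distribution M0" and b0: "AE t in M0. 0 \<le> t \<and> t \<le> 1"
      and mom0: "\<And>j. (\<integral>t. t ^ j \<partial>M0) = inner u (opoly A (xiB B ^ j) u)"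
      using unit_spectral_measure[OF u(1)] by blast
    interpret M0: real_distribution M0 by (rule M0)
    have cont: "continuous_on UNIV (\<lambda>t. t ^ j * poly q t)" for j and q :: "real poly"
      by (intro continuous_intros)
    have int0: "integrable M0 (\<lambda>t. t ^ j * poly q t)" for j q
    proof -
      have "\<exists>C. \<forall>t\<in>{0..1}. norm (t ^ j * poly q t) \<le> C"
        using compact_imp_bounded[OF compact_continuous_image[OF continuous_on_subset[OF cont subset_UNIV], of "{0..1}" j q]]
        by (auto simp: bounded_iff)
      then obtain C where C: "\<And>t. t \<in> {0..1} \<Longrightarrow> norm (t ^ j * poly q t) \<le> C" by blast
      have "AE t in M0. norm (t ^ j * poly q t) \<le> C"
        using b0 by eventually_elim (use C in auto)
      then show ?thesis
        by (rule M0.integrable_const_bound) (use borel_measurable_continuous_onI[OF cont[of j q]] in auto)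
    qed
    \<comment> \<open>The extra factor \<open>t ^ j\<close> is the generalisation that lets the
      induction absorb the variable split off by \<open>pCons\<close>.\<close>
    have mom1: "(\<integral>t. t ^ j * poly q t \<partial>M0) = inner u (opoly A (xiB B ^ j * pcompose q (xiB B)) u)" for j q
    proof (induction q arbitrary: j)
      case (pCons a q)
      have "(\<integral>t. t ^ j * poly (pCons a q) t \<partial>M0) = (\<integral>t. a * (t ^ j * poly 1 t) + t ^ Suc j * poly q t \<partial>M0)"
        by (rule Bochner_Integration.integral_cong) (simp_all add: algebra_simps)
      also have "\<dots> = a * (\<integral>t. t ^ j \<partial>M0) + (\<integral>t. t ^ Suc j * poly q t \<partial>M0)"
        using int0[of j 1] int0[of "Suc j" q] by (subst Bochner_Integration.integral_add) auto
      also have "\<dots> = inner u (opoly A (smult a (xiB B ^ j) + xiB B ^ Suc j * pcompose q (xiB B)) u)"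
        unfolding mom0 pCons.IH by (simp add: opoly_add[OF lin] opoly_smult[OF lin] inner_add_right)
      also have "smult a (xiB B ^ j) + xiB B ^ Suc j * pcompose q (xiB B) = xiB B ^ j * pcompose (pCons a q) (xiB B)"
        by (simp add: pcompose_pCons algebra_simps)
      finally show ?case .
    qed simp
    let ?f = "\<lambda>t. 2 * B * t - B"
    show ?thesis
    proof (rule that[of "distr M0 borel ?f"])
      show "prob_space (distr M0 borel ?f)" by (rule M0.prob_space_distr) simp
      show "AE t in distr M0 borel ?f. \<bar>t\<bar> \<le> B"
        by (subst AE_distr_iff) (use b0 B_pos in \<open>auto elim!: eventually_mono simp: abs_le_iff\<close>)
      show "\<forall>p. (norm x)\<^sup>2 * (\<integral>t. poly p t \<partial>distr M0 borel ?f) = inner x (opoly A p x)"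
      proof
        fix p :: "real poly"
        have "(\<integral>t. poly p t \<partial>distr M0 borel ?f) = (\<integral>t. poly p (2 * B * t - B) \<partial>M0)"
          by (rule integral_distr) (auto intro!: borel_measurable_continuous_onI continuous_intros)
        also have "\<dots> = (\<integral>t. t ^ 0 * poly (pcompose p [:-B, 2 * B:]) t \<partial>M0)"
          by (simp add: poly_pcompose algebra_simps)
        also have "\<dots> = inner u (opoly A (pcompose (pcompose p [:-B, 2 * B:]) (xiB B)) u)"
          unfolding mom1 by simp
        also have "pcompose (pcompose p [:-B, 2 * B:]) (xiB B) = p"
        proof (rule poly_ext)
          fix t show "poly (pcompose (pcompose p [:-B, 2 * B:]) (xiB B)) t = poly p t"
            using B_pos by (simp add: poly_pcompose xiB_def field_simps)
        qed
        finally have "(\<integral>t. poly p t \<partial>distr M0 borel ?f) = inner u (opoly A p u)" .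
        then show "(norm x)\<^sup>2 * (\<integral>t. poly p t \<partial>distr M0 borel ?f) = inner x (opoly A p x)"
          by (subst (2 3) u(2)) (simp add: linear_scale[OF opoly_linear[OF lin]] power2_eq_square)
      qed
    qed simp
  qed
  interpret M: prob_space M by (rule M)
  have mp: "poly p \<in> borel_measurable M" for p :: "real poly"
    unfolding measurable_cong_sets[OF setsM refl]
    by (intro borel_measurable_continuous_onI continuous_intros)
  have "smeas x (density M (\<lambda>_. ennreal ((norm x)\<^sup>2)))"
    unfolding smeas_def
  proof (intro conjI allI)
    show "finite_measure (density M (\<lambda>_. ennreal ((norm x)\<^sup>2)))"
      by (rule finite_measureI) (simp add: emeasure_density nn_integral_cmult M.emeasure_space_1 ennreal_mult_eq_top_iff)
    show "AE t in density M (\<lambda>_. ennreal ((norm x)\<^sup>2)). \<bar>t\<bar> \<le> B"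
      by (subst AE_density) (use bM in auto)
    show "(\<integral>t. poly p t \<partial>density M (\<lambda>_. ennreal ((norm x)\<^sup>2))) = inner x (opoly A p x)" for p
      by (cases "x = 0"; subst integral_density) (use mp mom in auto)
  qed (simp add: setsM)
  then show ?thesis by blast
qed

end

section \<open>Functional calculus estimates and null sets of spectral measures\<close>

lemma poly_approx:
  fixes f :: "real \<Rightarrow> real"
  assumes "continuous_on {a..b} f" "0 < e"
  obtains p where "\<And>t. t \<in> {a..b} \<Longrightarrow> \<bar>f t - poly p t\<bar> < e"
proof -
  obtain g where g: "real_polynomial_function g" "\<And>t. t \<in> {a..b} \<Longrightarrow> \<bar>f t - g t\<bar> < e"
    using Stone_Weierstrass_real_polynomial_function[OF compact_Icc assms] by blast
  obtain c n where "g = (\<lambda>x. \<Sum>i\<le>n. c i * x ^ i)"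
    using g(1) real_polynomial_function_iff_sum by blast
  then have "g t = poly (\<Sum>i\<le>n. monom (c i) i) t" for t
    by (simp add: poly_sum poly_monom)
  with g(2) show ?thesis by (intro that) auto
qed

context symop
begin

definition SM :: "'h \<Rightarrow> real measure" where "SM x = (SOME \<mu>. smeas x \<mu>)"

lemma SM: "smeas x (SM x)"
  unfolding SM_def by (rule someI_ex[OF smeas_exists])

lemma SM_finite: "finite_measure (SM x)"
  and sets_SM [measurable_cong]: "sets (SM x) = sets borel"
  and SM_bound: "AE t in SM x. \<bar>t\<bar> \<le> B"
  and SM_poly: "(\<integral>t. poly p t \<partial>SM x) = inner x (opoly A p x)"
  using SM[of x] by (auto simp: smeas_def)

sublocale SM: finite_measure "SM x" for x
  by (rule SM_finite)

lemma space_SM [simp]: "space (SM x) = UNIV"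
  using sets_eq_imp_space_eq[OF sets_SM[of x]] by simp

lemma poly_measurable [measurable]: "poly p \<in> borel_measurable (SM x)"
  by (subst measurable_cong_sets[OF sets_SM refl])
    (intro borel_measurable_continuous_onI continuous_intros)

lemma integrable_bounded:
  fixes f :: "real \<Rightarrow> real"
  assumes [measurable]: "f \<in> borel_measurable borel" and "\<And>t. t \<in> {-B..B} \<Longrightarrow> \<bar>f t\<bar> \<le> C"
  shows "integrable (SM x) f"
proof (rule SM.integrable_const_bound)
  show "AE t in SM x. norm (f t) \<le> C"
    using SM_bound[of x] by eventually_elim (simp, rule assms(2), auto)
qed measurable

lemma poly_bounded: "\<exists>C. \<forall>t\<in>{-B..B}. \<bar>poly p t\<bar> \<le> C"
proof -
  have "continuous_on {-B..B} (poly p)" by (intro continuous_intros)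
  from compact_imp_bounded[OF compact_continuous_image[OF this compact_Icc]] show ?thesis
    by (auto simp: bounded_iff)
qed

lemma integrable_poly [simp]: "integrable (SM x) (poly p)"
proof -
  have [measurable]: "poly p \<in> borel_measurable borel"
    by (intro borel_measurable_continuous_onI continuous_intros)
  obtain C where "\<forall>t\<in>{-B..B}. \<bar>poly p t\<bar> \<le> C" using poly_bounded by blast
  then show ?thesis by (intro integrable_bounded[of _ C]) auto
qed

lemma SM_mass: "measure (SM x) UNIV = (norm x)\<^sup>2"
  using SM_poly[of x 1] by (simp add: opoly_1[OF lin] dot_square_norm)

lemma norm_opoly: "(norm (opoly A p x))\<^sup>2 = (\<integral>t. (poly p t)\<^sup>2 \<partial>SM x)"
proof -
  have "(norm (opoly A p x))\<^sup>2 = inner x (opoly A (p\<^sup>2) x)"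
    by (simp add: power2_norm_eq_inner power2_eq_square[of p] opoly_mult[OF lin] opoly_sym)
  then show ?thesis by (simp add: SM_poly[symmetric])
qed

lemma integral_le_bound:
  fixes f :: "real \<Rightarrow> real"
  assumes [measurable]: "f \<in> borel_measurable borel" and f: "\<And>t. t \<in> {-B..B} \<Longrightarrow> \<bar>f t\<bar> \<le> C"
  shows "\<bar>\<integral>t. f t \<partial>SM x\<bar> \<le> C * (norm x)\<^sup>2"
proof -
  have "\<bar>\<integral>t. f t \<partial>SM x\<bar> \<le> (\<integral>t. \<bar>f t\<bar> \<partial>SM x)" by (rule integral_abs_bound)
  also have "\<dots> \<le> (\<integral>t. C \<partial>SM x)"
  proof (rule integral_mono_AE)
    show "integrable (SM x) (\<lambda>t. \<bar>f t\<bar>)"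
      using integrable_bounded[OF assms] by simp
    show "AE t in SM x. \<bar>f t\<bar> \<le> C"
      using SM_bound[of x] by eventually_elim (rule f, auto)
  qed simp
  also have "\<dots> = C * (norm x)\<^sup>2" by (simp add: SM_mass)
  finally show ?thesis .
qed

lemma opoly_norm_le:
  assumes "\<And>t. t \<in> {-B..B} \<Longrightarrow> \<bar>poly p t\<bar> \<le> C"
  shows "norm (opoly A p x) \<le> C * norm x"
proof -
  have C: "0 \<le> C" using assms[of 0] B_pos by auto
  have "\<bar>(poly p t)\<^sup>2\<bar> \<le> C\<^sup>2" if "t \<in> {-B..B}" for t
    using power_mono[OF assms[OF that], of 2] by simp
  moreover have "(\<lambda>t. (poly p t)\<^sup>2) \<in> borel_measurable borel"
    by (intro borel_measurable_continuous_onI continuous_intros)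
  ultimately have "(norm (opoly A p x))\<^sup>2 \<le> C\<^sup>2 * (norm x)\<^sup>2"
    unfolding norm_opoly using integral_le_bound[of "\<lambda>t. (poly p t)\<^sup>2" "C\<^sup>2" x] by auto
  then show ?thesis
    using C by (rule_tac power2_le_imp_le) (simp_all add: power_mult_distrib)
qed

text \<open>A substitute for the spectral projection onto \<open>K\<close>: the polynomials are
  uniformly close on [-B, B] to the functions \<open>f k\<close>, which converge pointwise to the
  indicator of \<open>K\<close>, and dominated convergence yields the squared norm that the
  projection of \<open>x\<close> would have. The uniform bound 2 makes the limit pass to
  closures.\<close>

lemma compact_indicator_approx:
  assumes "compact K" "K \<noteq> {}"
  obtains p where "\<And>k x. norm (opoly A (p k) x) \<le> 2 * norm x"
    and "\<And>x. (\<lambda>k. (norm (opoly A (p k) x))\<^sup>2) \<longlonglongrightarrow> measure (SM x) K"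
proof -
  define f where "f k t = max 0 (1 - real k * infdist t K)" for k and t :: real
  have cf: "continuous_on S (f k)" for k S unfolding f_def by (intro continuous_intros)
  have "\<exists>p. \<forall>t\<in>{-B..B}. \<bar>f k t - poly p t\<bar> < 1 / real (Suc k)" for k
    using poly_approx[OF cf[of "{-B..B}" k], of "1 / real (Suc k)"] by (metis of_nat_0_less_iff zero_less_Suc zero_less_divide_1_iff)
  then obtain p where p: "\<And>k t. t \<in> {-B..B} \<Longrightarrow> \<bar>f k t - poly (p k) t\<bar> < 1 / real (Suc k)" by metis
  have f01: "0 \<le> f k t" "f k t \<le> 1" for k t by (auto simp: f_def infdist_nonneg)
  have p2: "\<bar>poly (p k) t\<bar> \<le> 2" if "t \<in> {-B..B}" for k t
  proof -
    have "1 / real (Suc k) \<le> 1" by simp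
    then show ?thesis using p[OF that, of k] f01[of k t] by linarith
  qed
  have f_lim: "(\<lambda>k. f k t) \<longlonglongrightarrow> indicator K t" for t
  proof (cases "t \<in> K")
    case True
    then show ?thesis by (simp add: f_def)
  next
    case False
    then have "infdist t K > 0"
      using assms in_closed_iff_infdist_zero[of K t] compact_imp_closed infdist_nonneg[of t K]
      by (metis less_eq_real_def)
    then have "eventually (\<lambda>k. f k t = 0) sequentially"
      using reals_Archimedean3[of "infdist t K"]
    proof -
      obtain m where m: "real m * infdist t K > 1" using reals_Archimedean3[OF \<open>infdist t K > 0\<close>] by blast
      show ?thesis
      proof (rule eventually_mono[OF eventually_ge_at_top[of m]])
        fix k assume "m \<le> k"
        then have "real m * infdist t K \<le> real k * infdist t K"
          by (intro mult_right_mono) (auto simp: infdist_nonneg)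
        then show "f k t = 0" using m by (simp add: f_def)
      qed
    qed
    then show ?thesis using False by (simp add: tendsto_eventually)
  qed
  have p_lim: "(\<lambda>k. (poly (p k) t)\<^sup>2) \<longlonglongrightarrow> indicator K t" if t: "t \<in> {-B..B}" for t
  proof -
    have "(\<lambda>k. poly (p k) t - f k t) \<longlonglongrightarrow> 0"
    proof (rule Lim_null_comparison)
      show "\<forall>\<^sub>F k in sequentially. norm (poly (p k) t - f k t) \<le> inverse (real (Suc k))"
        using p[OF t] by (intro always_eventually allI) (simp add: abs_minus_commute inverse_eq_divide less_imp_le)
    qed (rule LIMSEQ_inverse_real_of_nat)
    from tendsto_add[OF this f_lim[of t]] have "(\<lambda>k. poly (p k) t) \<longlonglongrightarrow> indicator K t" by simp
    from tendsto_power[OF this, of 2] show ?thesis by (cases "t \<in> K") auto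
  qed
  show ?thesis
  proof (rule that)
    show "norm (opoly A (p k) x) \<le> 2 * norm x" for k x by (rule opoly_norm_le) (rule p2)
    fix x
    have K: "K \<in> sets (SM x)" using assms by (simp add: sets_SM borel_compact)
    have "(\<lambda>k. \<integral>t. (poly (p k) t)\<^sup>2 \<partial>SM x) \<longlonglongrightarrow> (\<integral>t. indicator K t \<partial>SM x)"
    proof (rule integral_dominated_convergence[where w = "\<lambda>_. 4"])
      show "AE t in SM x. (\<lambda>k. (poly (p k) t)\<^sup>2) \<longlonglongrightarrow> indicator K t"
        using SM_bound[of x] by eventually_elim (rule p_lim, auto)
      show "AE t in SM x. norm ((poly (p k) t)\<^sup>2) \<le> 4" for k
        using SM_bound[of x]
      proof eventually_elim
        fix t assume "\<bar>t\<bar> \<le> B"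
        then have "\<bar>poly (p k) t\<bar> \<le> 2" by (intro p2) auto
        then show "norm ((poly (p k) t)\<^sup>2) \<le> 4" using power_mono[of "\<bar>poly (p k) t\<bar>" 2 2] by simp
      qed
    qed (use K in \<open>auto\<close>)
    then show "(\<lambda>k. (norm (opoly A (p k) x))\<^sup>2) \<longlonglongrightarrow> measure (SM x) K"
      using K by (simp add: norm_opoly)
  qed
qed

text \<open>The vectors whose spectral measure vanishes on \<open>K\<close> are those with p_k(A) x
  -> 0. The operators p_k(A) are linear and uniformly bounded, so these vectors form a closed
  subspace.\<close>

lemma SM_null_compact:
  assumes "compact K" "\<And>x. x \<in> X \<Longrightarrow> measure (SM x) K = 0" "y \<in> closure (span X)"
  shows "measure (SM y) K = 0"
proof (cases "K = {}")
  case False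
  obtain p where p: "\<And>k x. norm (opoly A (p k) x) \<le> 2 * norm x"
    and lim: "\<And>x. (\<lambda>k. (norm (opoly A (p k) x))\<^sup>2) \<longlonglongrightarrow> measure (SM x) K"
    using compact_indicator_approx[OF assms(1) False] by metis
  let ?N = "{x. (\<lambda>k. opoly A (p k) x) \<longlonglongrightarrow> 0}"
  have iff: "x \<in> ?N \<longleftrightarrow> measure (SM x) K = 0" for x
  proof
    assume "x \<in> ?N"
    then have "(\<lambda>k. (norm (opoly A (p k) x))\<^sup>2) \<longlonglongrightarrow> 0"
      using tendsto_power[OF tendsto_norm_zero, of "\<lambda>k. opoly A (p k) x" sequentially 2] by simp
    then show "measure (SM x) K = 0" using LIMSEQ_unique[OF lim[of x]] by blast
  next
    assume "measure (SM x) K = 0"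
    then have "(\<lambda>k. sqrt ((norm (opoly A (p k) x))\<^sup>2)) \<longlonglongrightarrow> sqrt 0"
      using lim[of x] by (intro tendsto_real_sqrt) simp
    then show "x \<in> ?N" by (simp add: tendsto_norm_zero_iff)
  qed
  have "subspace ?N"
  proof (rule subspaceI)
    note l = opoly_linear[OF lin]
    show "0 \<in> ?N" by (simp add: linear_0[OF l])
    show "u + w \<in> ?N" if "u \<in> ?N" "w \<in> ?N" for u w
      using tendsto_add[of "\<lambda>k. opoly A (p k) u" 0 sequentially "\<lambda>k. opoly A (p k) w" 0] that
      by (simp add: linear_add[OF l])
    show "c *\<^sub>R u \<in> ?N" if "u \<in> ?N" for c u
      using tendsto_scaleR[OF tendsto_const[of c], of "\<lambda>k. opoly A (p k) u" 0 sequentially] that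
      by (simp add: linear_scale[OF l])
  qed
  then have sub: "span X \<subseteq> ?N" using iff assms(2) by (intro span_minimal) auto
  have "y \<in> ?N"
  proof (simp, rule LIMSEQ_I)
    fix e :: real assume e: "0 < e"
    then obtain x where x: "x \<in> span X" "dist x y < e / 4"
      using assms(3) unfolding closure_approachable by (metis zero_less_divide_iff zero_less_numeral)
    from x sub have "(\<lambda>k. opoly A (p k) x) \<longlonglongrightarrow> 0" by auto
    from LIMSEQ_D[OF this, of "e/2"] e obtain n where n: "\<And>k. k \<ge> n \<Longrightarrow> norm (opoly A (p k) x) < e / 2" by auto
    have "norm (opoly A (p k) y) < e" if "k \<ge> n" for k
    proof -
      have "opoly A (p k) y = opoly A (p k) x + opoly A (p k) (y - x)"
        by (simp add: linear_diff[OF opoly_linear[OF lin]])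
      also have "norm \<dots> \<le> norm (opoly A (p k) x) + 2 * norm (y - x)"
        using norm_triangle_ineq p[of k "y - x"] by (meson add_left_mono order_trans)
      also have "\<dots> < e" using n[OF that] x(2) by (simp add: dist_norm norm_minus_commute)
      finally show ?thesis .
    qed
    then show "\<exists>no. \<forall>n\<ge>no. norm (opoly A (p n) y - 0) < e" by auto
  qed
  then show ?thesis using iff by blast
qed simp

text \<open>Inner regularity of finite Borel measures reduces \<open>S\<close> to its compact
  subsets, for which the polynomial approximation is available.\<close>

lemma SM_null_closure:
  assumes "S \<in> sets borel" "\<And>x. x \<in> X \<Longrightarrow> emeasure (SM x) S = 0" "y \<in> closure (span X)"
  shows "emeasure (SM y) S = 0"
proof -
  have "emeasure (SM y) K = 0" if K: "K \<subseteq> S" "compact K" for K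
  proof -
    have "emeasure (SM x) K = 0" if "x \<in> X" for x
      using emeasure_mono[OF K(1), of "SM x"] assms(1) assms(2)[OF that] by (simp add: sets_SM)
    then have "measure (SM y) K = 0"
      by (intro SM_null_compact[OF K(2) _ assms(3)]) (simp add: measure_def)
    then show ?thesis by (simp add: SM.emeasure_eq_measure)
  qed
  moreover have "emeasure (SM y) S = (SUP K \<in> {K. K \<subseteq> S \<and> compact K}. emeasure (SM y) K)"
    by (rule inner_regular) (use assms(1) SM.emeasure_finite in \<open>auto simp: sets_SM\<close>)
  ultimately show ?thesis by (auto intro!: antisym SUP_least)
qed

text \<open>The function 1 / q is a uniform limit of polynomials \<open>p\<close> on [-B, B], and
  p(A) x = p(A) q(A) y is then close to \<open>y\<close>. The case in view is q(t) = (t - E)^2 +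
  \<eta>^2, the inverse of a Poisson kernel up to a factor.\<close>

lemma SM_resolvent:
  assumes y: "opoly A q y = x" and q: "\<And>t. t \<in> {-B..B} \<Longrightarrow> poly q t > 0"
  shows "inner x y = (\<integral>t. 1 / poly q t \<partial>SM x)"
proof -
  obtain C where C: "\<And>t. t \<in> {-B..B} \<Longrightarrow> \<bar>poly q t\<bar> \<le> C" using poly_bounded[of q] by blast
  have C0: "0 \<le> C" using C[of 0] B_pos by auto
  have cont: "continuous_on {-B..B} (\<lambda>t. 1 / poly q t)"
    by (intro continuous_intros) (use q in force)
  have m: "(\<lambda>t. 1 / poly q t) \<in> borel_measurable borel"
    by (intro borel_measurable_divide borel_measurable_const borel_measurable_continuous_onI continuous_intros)
  have "\<exists>D. \<forall>t\<in>{-B..B}. \<bar>1 / poly q t\<bar> \<le> D"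
    using compact_imp_bounded[OF compact_continuous_image[OF cont compact_Icc]] by (auto simp: bounded_iff)
  then obtain D where D: "\<And>t. t \<in> {-B..B} \<Longrightarrow> \<bar>1 / poly q t\<bar> \<le> D" by blast
  have "\<bar>inner x y - (\<integral>t. 1 / poly q t \<partial>SM x)\<bar> \<le> 0 + e" if "e > 0" for e
  proof -
    define W where "W = (norm x)\<^sup>2 + C * norm x * norm y + 1"
    have W: "W > 0" unfolding W_def using C0 by (intro add_nonneg_pos) auto
    define d where "d = e / W"
    have d: "d > 0" using that W by (simp add: d_def)
    obtain p where p: "\<And>t. t \<in> {-B..B} \<Longrightarrow> \<bar>1 / poly q t - poly p t\<bar> < d"
      using poly_approx[OF cont d] by blast
    have "opoly A p x = y + opoly A (p * q - 1) y"
      by (simp add: y[symmetric] opoly_mult[OF lin] opoly_diff[OF lin] opoly_1[OF lin])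
    then have e1: "inner x y = inner x (opoly A p x) - inner x (opoly A (p * q - 1) y)"
      by (simp add: inner_add_right)
    have "norm (opoly A (p * q - 1) y) \<le> (d * C) * norm y"
    proof (rule opoly_norm_le)
      fix t assume t: "t \<in> {-B..B}"
      have "poly (p * q - 1) t = (poly p t - 1 / poly q t) * poly q t"
        using q[OF t] by (simp add: field_simps)
      also have "\<bar>\<dots>\<bar> \<le> d * C"
        unfolding abs_mult using p[OF t] C[OF t] d by (intro mult_mono) auto
      finally show "\<bar>poly (p * q - 1) t\<bar> \<le> d * C" .
    qed
    then have "norm x * norm (opoly A (p * q - 1) y) \<le> norm x * ((d * C) * norm y)"
      by (intro mult_left_mono) auto
    then have e2: "\<bar>inner x (opoly A (p * q - 1) y)\<bar> \<le> d * (C * norm x * norm y)"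
      using Cauchy_Schwarz_ineq2[of x "opoly A (p * q - 1) y"] by (simp add: mult_ac)
    have "(\<integral>t. poly p t \<partial>SM x) - (\<integral>t. 1 / poly q t \<partial>SM x) = (\<integral>t. poly p t - 1 / poly q t \<partial>SM x)"
      by (rule Bochner_Integration.integral_diff[symmetric])
        (use integrable_bounded[OF m D] in auto)
    also have "\<bar>\<dots>\<bar> \<le> d * (norm x)\<^sup>2"
    proof (rule integral_le_bound)
      show "(\<lambda>t. poly p t - 1 / poly q t) \<in> borel_measurable borel"
        using m by (intro borel_measurable_diff) (auto intro!: borel_measurable_continuous_onI continuous_intros)
      show "\<bar>poly p t - 1 / poly q t\<bar> \<le> d" if "t \<in> {-B..B}" for t
        using p[OF that] by (simp add: abs_minus_commute)
    qed
    finally have "\<bar>inner x y - (\<integral>t. 1 / poly q t \<partial>SM x)\<bar> \<le> d * (norm x)\<^sup>2 + d * (C * norm x * norm y)"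
      using e1 e2 SM_poly[of x p] by linarith
    also have "\<dots> \<le> d * W" using d by (simp add: W_def algebra_simps)
    also have "\<dots> = e" using W by (simp add: d_def)
    finally show ?thesis by simp
  qed
  then have "\<bar>inner x y - (\<integral>t. 1 / poly q t \<partial>SM x)\<bar> \<le> 0" by (rule field_le_epsilon)
  then show ?thesis by simp
qed

end

section \<open>The Hilbert space of square-summable functions\<close>

lemma norm_ell2_sq: "(norm u)\<^sup>2 = (\<Sum>\<^sub>\<infinity>n. (cmod (coord u n))\<^sup>2)"
  by (simp add: power2_norm_eq_inner inner_ell2_self)

lemma finite_sum_le_norm_sq: "finite F \<Longrightarrow> (\<Sum>n\<in>F. (cmod (coord u n))\<^sup>2) \<le> (norm u)\<^sup>2"
  unfolding norm_ell2_sq by (rule finite_sum_le_infsum) (auto simp: coord_summable)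

lemma norm_sq_le_finite_sums:
  assumes "\<And>F. finite F \<Longrightarrow> (\<Sum>n\<in>F. (cmod (coord u n))\<^sup>2) \<le> C"
  shows "(norm u)\<^sup>2 \<le> C"
  unfolding norm_ell2_sq by (rule infsum_le_finite_sums) (auto simp: coord_summable assms)

lemma coord_le_norm: "cmod (coord u n) \<le> norm u"
  using finite_sum_le_norm_sq[of "{n}" u] by (simp add: power2_le_iff_abs_le)

lemma norm_sq_finite_support:
  assumes "finite F" "\<And>n. n \<notin> F \<Longrightarrow> coord u n = 0"
  shows "(norm u)\<^sup>2 = (\<Sum>n\<in>F. (cmod (coord u n))\<^sup>2)"
proof -
  have "(norm u)\<^sup>2 = (\<Sum>\<^sub>\<infinity>n\<in>F. (cmod (coord u n))\<^sup>2)"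
    unfolding norm_ell2_sq by (rule infsum_cong_neutral) (auto simp: assms)
  then show ?thesis using assms(1) by simp
qed

lemma ell2_complete:
  fixes X :: "nat \<Rightarrow> 'a ell2"
  assumes "Cauchy X"
  shows "convergent X"
proof -
  have "Cauchy (\<lambda>m. coord (X m) n)" for n
  proof (rule CauchyI)
    fix e :: real assume "0 < e"
    from CauchyD[OF assms this] obtain M where M: "\<And>m k. m \<ge> M \<Longrightarrow> k \<ge> M \<Longrightarrow> norm (X m - X k) < e" by blast
    have "norm (coord (X m) n - coord (X k) n) < e" if "m \<ge> M" "k \<ge> M" for m k
      using coord_le_norm[of "X m - X k" n] M[OF that] by (simp add: coord_diff)
    then show "\<exists>M. \<forall>m\<ge>M. \<forall>k\<ge>M. norm (coord (X m) n - coord (X k) n) < e" by blast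
  qed
  then have "\<exists>l. (\<lambda>m. coord (X m) n) \<longlonglongrightarrow> l" for n
    unfolding convergent_def[symmetric] by (rule Cauchy_convergent)
  then obtain c where c: "\<And>n. (\<lambda>m. coord (X m) n) \<longlonglongrightarrow> c n"
    by metis
  have bnd: "\<exists>M. \<forall>m\<ge>M. \<forall>F. finite F \<longrightarrow> (\<Sum>n\<in>F. (cmod (coord (X m) n - c n))\<^sup>2) \<le> e\<^sup>2" if "0 < e" for e
  proof -
    from CauchyD[OF assms that] obtain M where M: "\<And>m k. m \<ge> M \<Longrightarrow> k \<ge> M \<Longrightarrow> norm (X m - X k) < e" by blast
    have "(\<Sum>n\<in>F. (cmod (coord (X m) n - c n))\<^sup>2) \<le> e\<^sup>2" if "m \<ge> M" "finite F" for m F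
    proof (rule LIMSEQ_le_const2)
      show "(\<lambda>k. \<Sum>n\<in>F. (cmod (coord (X m) n - coord (X k) n))\<^sup>2) \<longlonglongrightarrow> (\<Sum>n\<in>F. (cmod (coord (X m) n - c n))\<^sup>2)"
        by (intro tendsto_intros c)
      have "(\<Sum>n\<in>F. (cmod (coord (X m) n - coord (X k) n))\<^sup>2) \<le> e\<^sup>2" if "k \<ge> M" for k
      proof -
        have "(\<Sum>n\<in>F. (cmod (coord (X m) n - coord (X k) n))\<^sup>2) \<le> (norm (X m - X k))\<^sup>2"
          using finite_sum_le_norm_sq[OF \<open>finite F\<close>, of "X m - X k"] by (simp add: coord_diff)
        also have "\<dots> \<le> e\<^sup>2" using M[OF \<open>m \<ge> M\<close> that] by (intro power_mono) auto
        finally show ?thesis .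
      qed
      then show "\<exists>N. \<forall>k\<ge>N. (\<Sum>n\<in>F. (cmod (coord (X m) n - coord (X k) n))\<^sup>2) \<le> e\<^sup>2" by blast
    qed
    then show ?thesis by blast
  qed
  obtain M where M: "\<And>F. finite F \<Longrightarrow> (\<Sum>n\<in>F. (cmod (coord (X M) n - c n))\<^sup>2) \<le> 1\<^sup>2"
    using bnd[of 1] by auto
  have "(\<lambda>n. (cmod (coord (X M) n - c n))\<^sup>2) summable_on UNIV"
    by (rule nonneg_bdd_above_summable_on) (use M in \<open>auto simp: bdd_above_def\<close>)
  from square_summable_add[OF coord_summable[of "X M"], of "\<lambda>n. c n - coord (X M) n"] this
  have cs: "(\<lambda>n. (cmod (c n))\<^sup>2) summable_on UNIV"
    by (simp add: norm_minus_commute)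
  define L where "L = Abs_ell2 c"
  have L: "coord L = c" unfolding L_def by (rule Abs_ell2_inverse) (simp add: cs)
  have "X \<longlonglongrightarrow> L"
  proof (rule LIMSEQ_I)
    fix e :: real assume "0 < e"
    then obtain M where M: "\<And>m F. m \<ge> M \<Longrightarrow> finite F \<Longrightarrow> (\<Sum>n\<in>F. (cmod (coord (X m) n - c n))\<^sup>2) \<le> (e/2)\<^sup>2"
      using bnd[of "e/2"] by auto
    have "norm (X m - L) < e" if "m \<ge> M" for m
    proof -
      have "(norm (X m - L))\<^sup>2 \<le> (e/2)\<^sup>2"
        by (rule norm_sq_le_finite_sums) (use M[OF that] in \<open>auto simp: coord_diff L\<close>)
      then show ?thesis using \<open>0 < e\<close> 
        by (smt (verit, ccfv_SIG) field_sum_of_halves norm_ge_zero power2_le_imp_le)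
    qed
    then show "\<exists>M. \<forall>m\<ge>M. norm (X m - L) < e" by blast
  qed
  then show ?thesis by (auto simp: convergent_def)
qed

instance ell2 :: (type) banach
  by standard (rule ell2_complete)

text \<open>Lax-Milgram by the contraction principle: x -> x - s (T x - y) contracts for s = c /
  K^2, with constant sqrt (1 - c^2 / K^2).\<close>

lemma coercive_bij:
  fixes T :: "'h::{real_inner, complete_space} \<Rightarrow> 'h"
  assumes lin: "linear T" and c: "0 < c" "\<And>x. c * (norm x)\<^sup>2 \<le> inner x (T x)"
    and bnd: "\<And>x. norm (T x) \<le> M * norm x"
  shows "bij T"
proof -
  have inj: "inj T"
  proof (rule injI)
    fix x y assume "T x = T y"
    then have "c * (norm (x - y))\<^sup>2 \<le> 0" using c(2)[of "x - y"] by (simp add: linear_diff[OF lin])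
    then show "x = y" using c(1) by (simp add: mult_le_0_iff)
  qed
  \<comment> \<open>Raising the bound above \<open>c\<close> keeps c^2 / K^2 strictly below
    1.\<close>
  define K where "K = max M (c + 1)"
  have K: "0 < K" "c < K" and bndK: "norm (T x) \<le> K * norm x" for x
    using c(1) order_trans[OF bnd mult_right_mono, of K x] by (auto simp: K_def)
  define s where "s = c / K\<^sup>2"
  define k where "k = sqrt (1 - c\<^sup>2 / K\<^sup>2)"
  have cK: "c\<^sup>2 / K\<^sup>2 < 1" using K c(1) power_strict_mono[of c K 2] by simp
  have contr: "norm (x - s *\<^sub>R T x) \<le> k * norm x" for x
  proof (rule power2_le_imp_le)
    have "(norm (x - s *\<^sub>R T x))\<^sup>2 = (norm x)\<^sup>2 - 2 * s * inner x (T x) + s\<^sup>2 * (norm (T x))\<^sup>2"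
      unfolding power2_norm_eq_inner inner_diff_left inner_diff_right inner_scaleR_left inner_scaleR_right
        inner_commute[of "T x" x]
      by (simp add: power2_eq_square algebra_simps)
    also have "\<dots> \<le> (norm x)\<^sup>2 - 2 * s * (c * (norm x)\<^sup>2) + s\<^sup>2 * (K * norm x)\<^sup>2"
    proof -
      have "2 * s * (c * (norm x)\<^sup>2) \<le> 2 * s * inner x (T x)"
        using c K by (intro mult_left_mono c(2)) (auto simp: s_def)
      moreover have "s\<^sup>2 * (norm (T x))\<^sup>2 \<le> s\<^sup>2 * (K * norm x)\<^sup>2"
        by (intro mult_left_mono power_mono bndK) auto
      ultimately show ?thesis by linarith
    qed
    also have "\<dots> = (k * norm x)\<^sup>2"
      using K cK by (simp add: k_def s_def power_mult_distrib field_simps power2_eq_square)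
    finally show "(norm (x - s *\<^sub>R T x))\<^sup>2 \<le> (k * norm x)\<^sup>2" .
  qed (use cK in \<open>simp add: k_def\<close>)
  have "surj T"
    unfolding surj_def
  proof
    fix y
    have "\<exists>!x. x - s *\<^sub>R (T x - y) = x"
    proof (rule banach_fix_type)
      show "k < 1" "0 \<le> k" using cK c K by (auto simp: k_def)
      show "\<forall>u w. dist (u - s *\<^sub>R (T u - y)) (w - s *\<^sub>R (T w - y)) \<le> k * dist u w"
      proof (intro allI)
        fix u w
        have eq: "(u - s *\<^sub>R (T u - y)) - (w - s *\<^sub>R (T w - y)) = (u - w) - s *\<^sub>R T (u - w)"
          by (simp add: linear_diff[OF lin] algebra_simps)
        show "dist (u - s *\<^sub>R (T u - y)) (w - s *\<^sub>R (T w - y)) \<le> k * dist u w"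
          unfolding dist_norm eq by (rule contr)
      qed
    qed
    then obtain x where "x - s *\<^sub>R (T x - y) = x" by auto
    then have "y = T x" using c K by (simp add: s_def)
    then show "\<exists>x. y = T x" ..
  qed
  with inj show ?thesis by (simp add: bij_def)
qed

definition ket :: "'a \<Rightarrow> 'a ell2" where "ket m = Abs_ell2 (\<lambda>n. of_bool (n = m))"

lemma coord_ket: "coord (ket m) = (\<lambda>n. of_bool (n = m))"
  unfolding ket_def
proof (rule Abs_ell2_inverse, simp)
  show "(\<lambda>n. (cmod (of_bool (n = m)))\<^sup>2) summable_on UNIV"
    by (rule finite_nonzero_values_imp_summable_on) (auto simp: of_bool_def)
qed

lemma coord_scaleC_apply [simp]: "coord (scaleC_ell2 z u) n = z * coord u n"
  by (simp add: coord_scaleC)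

lemma coord_simps [simp]:
  "coord (u + w) n = coord u n + coord w n" "coord (u - w) n = coord u n - coord w n"
  "coord (- u) n = - coord u n" "coord (r *\<^sub>R u) n = of_real r * coord u n" "coord 0 n = 0"
  "coord (ket m) n = of_bool (n = m)"
  by (simp_all add: coord_add coord_diff coord_uminus coord_scaleR coord_zero coord_ket)

lemma coord_sum [simp]: "coord (\<Sum>i\<in>I. f i) n = (\<Sum>i\<in>I. coord (f i) n)"
  by (induction I rule: infinite_finite_induct) auto

lemma ell2_eqI: "(\<And>n. coord u n = coord w n) \<Longrightarrow> u = w"
  by (simp add: coord_inject[symmetric] fun_eq_iff)

lemma scaleC_add: "scaleC_ell2 z (u + w) = scaleC_ell2 z u + scaleC_ell2 z w"
  and scaleC_diff: "scaleC_ell2 z (u - w) = scaleC_ell2 z u - scaleC_ell2 z w"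
  and scaleC_scaleC [simp]: "scaleC_ell2 z (scaleC_ell2 y u) = scaleC_ell2 (z * y) u"
  and scaleC_scaleR: "scaleC_ell2 z (r *\<^sub>R u) = r *\<^sub>R scaleC_ell2 z u"
  and scaleC_one [simp]: "scaleC_ell2 1 u = u"
  and scaleC_of_real: "scaleC_ell2 (of_real r) u = r *\<^sub>R u"
  by (rule ell2_eqI; simp add: algebra_simps)+

lemma linear_scaleC: "linear (scaleC_ell2 z)"
  by (simp add: linear_iff scaleC_add scaleC_scaleR)

lemma norm_scaleC [simp]: "norm (scaleC_ell2 z u) = cmod z * norm u"
proof -
  have "(norm (scaleC_ell2 z u))\<^sup>2 = (cmod z * norm u)\<^sup>2"
    unfolding norm_ell2_sq power_mult_distrib by (simp add: norm_mult power_mult_distrib infsum_cmult_right')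
  then show ?thesis by (simp add: power2_eq_iff_nonneg)
qed

lemma inner_scaleC: "inner (scaleC_ell2 z u) w = inner u (scaleC_ell2 (cnj z) w)"
  unfolding inner_ell2_alt by (rule infsum_cong) (simp add: algebra_simps)

lemma cinner_eq: "cinner_ell2 u w = Complex (inner u w) (inner (scaleC_ell2 \<i> u) w)"
proof -
  have "Im (cinner_ell2 u w) = (\<Sum>\<^sub>\<infinity>n. Im (cnj (coord u n) * coord w n))"
    unfolding cinner_ell2_def by (simp only: infsum_Im[OF coord_mult_summable])
  also have "\<dots> = inner (scaleC_ell2 \<i> u) w"
    unfolding inner_ell2_alt by (rule infsum_cong) (simp add: algebra_simps)
  finally show ?thesis by (simp add: complex_eq_iff inner_ell2_def)
qed

lemma cinner_ket: "cinner_ell2 (ket m) u = coord u m"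
proof -
  have "cinner_ell2 (ket m) u = (\<Sum>\<^sub>\<infinity>n\<in>{m}. coord u n)"
    unfolding cinner_ell2_def by (rule infsum_cong_neutral) auto
  then show ?thesis by simp
qed

lemma inner_ket: "inner (ket m) u = Re (coord u m)"
  by (simp add: inner_ell2_def cinner_ket)

lemma norm_ket [simp]: "norm (ket m) = 1"
  by (simp add: norm_eq_sqrt_inner inner_ket)

text \<open>\<open>span\<close> is the real span, so the basis vectors multiplied by i have to be
  added.\<close>

lemma ket_span_dense: "closure (span (range ket \<union> scaleC_ell2 \<i> ` range ket)) = UNIV"
proof -
  have "u \<in> closure (span (range ket \<union> scaleC_ell2 \<i> ` range ket))" for u :: "'a ell2"
    unfolding closure_approachable
  proof (intro allI impI)
    fix e :: real assume e: "0 < e"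
    have "((\<lambda>n. (cmod (coord u n))\<^sup>2) has_sum (norm u)\<^sup>2) UNIV"
      unfolding norm_ell2_sq by (rule has_sum_infsum) (rule coord_summable)
    then have "\<forall>\<^sub>F F in finite_subsets_at_top UNIV. dist (\<Sum>n\<in>F. (cmod (coord u n))\<^sup>2) ((norm u)\<^sup>2) < e\<^sup>2"
      unfolding has_sum_def using e by (intro tendstoD) auto
    then obtain F where F: "finite F" "dist (\<Sum>n\<in>F. (cmod (coord u n))\<^sup>2) ((norm u)\<^sup>2) < e\<^sup>2"
      unfolding eventually_finite_subsets_at_top by blast
    define w where "w = (\<Sum>n\<in>F. scaleC_ell2 (coord u n) (ket n))"
    have cw: "coord w k = (if k \<in> F then coord u k else 0)" for k
      using F(1) by (simp add: w_def of_bool_def if_distrib cong: if_cong)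
    have "(norm (w - u))\<^sup>2 \<le> (norm u)\<^sup>2 - (\<Sum>n\<in>F. (cmod (coord u n))\<^sup>2)"
    proof (rule norm_sq_le_finite_sums)
      fix G :: "'a set" assume G: "finite G"
      have "(\<Sum>n\<in>G. (cmod (coord (w - u) n))\<^sup>2) = (\<Sum>n\<in>G - F. (cmod (coord u n))\<^sup>2)"
        by (rule sum.mono_neutral_cong_right) (auto simp: cw G)
      also have "\<dots> = (\<Sum>n\<in>G \<union> F. (cmod (coord u n))\<^sup>2) - (\<Sum>n\<in>F. (cmod (coord u n))\<^sup>2)"
        using sum_diff[of "G \<union> F" F "\<lambda>n. (cmod (coord u n))\<^sup>2"] G F by (simp add: Un_Diff)
      also have "\<dots> \<le> (norm u)\<^sup>2 - (\<Sum>n\<in>F. (cmod (coord u n))\<^sup>2)"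
        using finite_sum_le_norm_sq[of "G \<union> F" u] G F by simp
      finally show "(\<Sum>n\<in>G. (cmod (coord (w - u) n))\<^sup>2) \<le> (norm u)\<^sup>2 - (\<Sum>n\<in>F. (cmod (coord u n))\<^sup>2)" .
    qed
    also have "\<dots> < e\<^sup>2" using F(2) by (simp add: dist_real_def abs_if split: if_splits)
    finally have "norm (w - u) < e" using e by (auto simp: power_less_imp_less_base)
    moreover have "w \<in> span (range ket \<union> scaleC_ell2 \<i> ` range ket)"
      unfolding w_def
    proof (rule span_sum)
      fix n
      have "scaleC_ell2 (coord u n) (ket n) = Re (coord u n) *\<^sub>R ket n + Im (coord u n) *\<^sub>R scaleC_ell2 \<i> (ket n)"
        by (rule ell2_eqI) (auto simp: complex_eq_iff)
      then show "scaleC_ell2 (coord u n) (ket n) \<in> span (range ket \<union> scaleC_ell2 \<i> ` range ket)"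
        by (auto intro!: span_add span_scale intro: span_base)
    qed
    ultimately show "\<exists>y\<in>span (range ket \<union> scaleC_ell2 \<i> ` range ket). dist y u < e"
      by (auto simp: dist_norm)
  qed
  then show ?thesis by blast
qed

section \<open>Translations, multiplication operators and hopping operators\<close>

definition translate :: "'a::ab_group_add \<Rightarrow> 'a ell2 \<Rightarrow> 'a ell2" where
  "translate j u = Abs_ell2 (\<lambda>n. coord u (n + j))"

lemma bij_add_right: "bij_betw (\<lambda>n. n + j) UNIV (UNIV :: 'a::ab_group_add set)"
  by (rule bij_betwI[where g = "\<lambda>n. n - j"]) auto

lemma coord_translate [simp]: "coord (translate j u) n = coord u (n + j)"
proof -
  have "coord (translate j u) = (\<lambda>n. coord u (n + j))"
    unfolding translate_def
  proof (rule Abs_ell2_inverse, simp)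
    show "(\<lambda>n. (cmod (coord u (n + j)))\<^sup>2) summable_on UNIV"
      using summable_on_reindex_bij_betw[OF bij_add_right, of "\<lambda>n. (cmod (coord u n))\<^sup>2" j]
      by (simp add: coord_summable)
  qed
  then show ?thesis by simp
qed

lemma norm_translate [simp]: "norm (translate j u) = norm u"
proof -
  have "(norm (translate j u))\<^sup>2 = (norm u)\<^sup>2"
    unfolding norm_ell2_sq using infsum_reindex_bij_betw[OF bij_add_right, of "\<lambda>n. (cmod (coord u n))\<^sup>2" j] by simp
  then show ?thesis by (simp add: power2_eq_iff_nonneg)
qed

lemma inner_translate: "inner (translate j u) w = inner u (translate (- j) w)"
  unfolding inner_ell2_alt
  using infsum_reindex_bij_betw[OF bij_add_right, of "\<lambda>n. Re (cnj (coord u n) * coord (translate (- j) w) n)" j] by simp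

definition multop :: "('a \<Rightarrow> real) \<Rightarrow> 'a ell2 \<Rightarrow> 'a ell2" where
  "multop v u = Abs_ell2 (\<lambda>n. of_real (v n) * coord u n)"

lemma coord_multop:
  assumes "\<And>n. \<bar>v n\<bar> \<le> C"
  shows "coord (multop v u) n = of_real (v n) * coord u n"
proof -
  have "coord (multop v u) = (\<lambda>n. of_real (v n) * coord u n)"
    unfolding multop_def
    by (rule Abs_ell2_inverse) (use assms in \<open>auto intro!: square_summable_mult_bounded[OF coord_summable]\<close>)
  then show ?thesis by simp
qed

lemma norm_multop_le:
  assumes "\<And>n. \<bar>v n\<bar> \<le> C"
  shows "norm (multop v u) \<le> C * norm u"
proof -
  have C: "0 \<le> C" using assms[of undefined] by linarith
  have "(norm (multop v u))\<^sup>2 \<le> (C * norm u)\<^sup>2"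
  proof (rule norm_sq_le_finite_sums)
    fix F :: "'a set" assume F: "finite F"
    have "(\<Sum>n\<in>F. (cmod (coord (multop v u) n))\<^sup>2) \<le> (\<Sum>n\<in>F. C\<^sup>2 * (cmod (coord u n))\<^sup>2)"
    proof (rule sum_mono)
      fix n
      show "(cmod (coord (multop v u) n))\<^sup>2 \<le> C\<^sup>2 * (cmod (coord u n))\<^sup>2"
        unfolding coord_multop[OF assms] norm_mult power_mult_distrib
        using power_mono[OF assms[of n], of 2] by (intro mult_right_mono) auto
    qed
    also have "\<dots> \<le> (C * norm u)\<^sup>2"
      unfolding sum_distrib_left[symmetric] power_mult_distrib
      by (intro mult_left_mono finite_sum_le_norm_sq F) auto
    finally show "(\<Sum>n\<in>F. (cmod (coord (multop v u) n))\<^sup>2) \<le> (C * norm u)\<^sup>2" .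
  qed
  then show ?thesis by (rule power2_le_imp_le) (simp add: C)
qed

lemma inner_multop_sym:
  assumes "\<And>n. \<bar>v n\<bar> \<le> C"
  shows "inner (multop v u) w = inner u (multop v w)"
  unfolding inner_ell2_alt by (rule infsum_cong) (simp add: coord_multop[OF assms] algebra_simps)

lemma inner_multop_bounds:
  assumes "\<And>n. a \<le> v n" "\<And>n. v n \<le> b"
  shows "a * (norm u)\<^sup>2 \<le> inner u (multop v u)" "inner u (multop v u) \<le> b * (norm u)\<^sup>2"
proof -
  have bnd: "\<bar>v n\<bar> \<le> max \<bar>a\<bar> \<bar>b\<bar>" for n using assms[of n] by auto
  have q: "Re (cnj (coord u n) * coord (multop v u) n) = v n * (cmod (coord u n))\<^sup>2" for n
    by (simp add: coord_multop[OF bnd] cmod_power2) (simp add: power2_eq_square algebra_simps)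
  have eq: "inner u (multop v u) = (\<Sum>\<^sub>\<infinity>n. v n * (cmod (coord u n))\<^sup>2)"
    unfolding inner_ell2_alt by (rule infsum_cong) (rule q)
  have s: "(\<lambda>n. v n * (cmod (coord u n))\<^sup>2) summable_on UNIV"
    using summable_on_Re[OF coord_mult_summable[of u "multop v u"]] unfolding q .
  have s': "(\<lambda>n. c * (cmod (coord u n))\<^sup>2) summable_on UNIV" for c
    by (intro summable_on_cmult_right coord_summable)
  have n: "c * (norm u)\<^sup>2 = (\<Sum>\<^sub>\<infinity>n. c * (cmod (coord u n))\<^sup>2)" for c
    by (simp add: norm_ell2_sq infsum_cmult_right')
  show "a * (norm u)\<^sup>2 \<le> inner u (multop v u)" "inner u (multop v u) \<le> b * (norm u)\<^sup>2"
    unfolding eq n by (intro infsum_mono s s' mult_right_mono assms; simp)+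
qed

text \<open>The set \<open>J\<close> of hops is left general because the same estimates serve the
  full Jacobi operator and its part transverse to one coordinate direction.\<close>

definition hop :: "'a::ab_group_add set \<Rightarrow> ('a \<Rightarrow> real) \<Rightarrow> 'a ell2 \<Rightarrow> 'a ell2" where
  "hop J v u = (\<Sum>j\<in>J. translate j u) + multop v u"

lemma coord_hop:
  assumes "\<And>n. \<bar>v n\<bar> \<le> C"
  shows "coord (hop J v u) n = (\<Sum>j\<in>J. coord u (n + j)) + of_real (v n) * coord u n"
  by (simp add: hop_def coord_multop[OF assms])

lemma linear_hop:
  assumes "\<And>n. \<bar>v n\<bar> \<le> C"
  shows "linear (hop J v)"
  by (rule linearI; rule ell2_eqI)
    (simp_all add: coord_hop[OF assms] sum.distrib sum_distrib_left algebra_simps)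

lemma hop_scaleC:
  assumes "\<And>n. \<bar>v n\<bar> \<le> C"
  shows "hop J v (scaleC_ell2 z u) = scaleC_ell2 z (hop J v u)"
  by (rule ell2_eqI) (simp add: coord_hop[OF assms] sum_distrib_left algebra_simps)

lemma norm_hop_le:
  assumes "\<And>n. \<bar>v n\<bar> \<le> C"
  shows "norm (hop J v u) \<le> (real (card J) + C) * norm u"
proof -
  have "norm (hop J v u) \<le> norm (\<Sum>j\<in>J. translate j u) + norm (multop v u)"
    unfolding hop_def by (rule norm_triangle_ineq)
  also have "\<dots> \<le> (\<Sum>j\<in>J. norm (translate j u)) + C * norm u"
    by (intro add_mono norm_sum norm_multop_le assms)
  finally show ?thesis by (simp add: algebra_simps)
qed

lemma hop_symop:
  assumes "\<And>n. \<bar>v n\<bar> \<le> C" "uminus ` J = J"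
  shows "symop (hop J v) (real (card J) + C + 1)"
proof (rule symop.intro)
  show "linear (hop J v)" by (rule linear_hop[of v C, OF assms(1)])
  show "inner (hop J v x) y = inner x (hop J v y)" for x y
  proof -
    have "(\<Sum>j\<in>J. inner x (translate (- j) y)) = (\<Sum>j\<in>uminus ` J. inner x (translate j y))"
      by (subst sum.reindex) (auto simp: inj_on_def)
    then show ?thesis
      unfolding hop_def inner_add_left inner_add_right inner_multop_sym[of v C, OF assms(1)]
      by (simp add: inner_sum_left inner_sum_right inner_translate assms(2))
  qed
  show "norm (hop J v x) \<le> (real (card J) + C + 1) * norm x" for x
    using norm_hop_le[of v C J x, OF assms(1)] by (simp add: distrib_right add_increasing2)
  show "0 < real (card J) + C + 1" using assms(1)[of undefined] by linarith
qed

lemma inner_hop_bounds: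
  assumes "\<And>n. a \<le> v n" "\<And>n. v n \<le> b"
  shows "(a - real (card J)) * (norm u)\<^sup>2 \<le> inner u (hop J v u)"
    and "inner u (hop J v u) \<le> (b + real (card J)) * (norm u)\<^sup>2"
proof -
  have "\<bar>inner u (\<Sum>j\<in>J. translate j u)\<bar> \<le> norm u * norm (\<Sum>j\<in>J. translate j u)"
    by (rule Cauchy_Schwarz_ineq2)
  also have "\<dots> \<le> norm u * (\<Sum>j\<in>J. norm (translate j u))"
    by (intro mult_left_mono norm_sum) auto
  finally have "\<bar>inner u (\<Sum>j\<in>J. translate j u)\<bar> \<le> real (card J) * (norm u)\<^sup>2"
    by (simp add: power2_eq_square mult_ac)
  then show "(a - real (card J)) * (norm u)\<^sup>2 \<le> inner u (hop J v u)"
    and "inner u (hop J v u) \<le> (b + real (card J)) * (norm u)\<^sup>2"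
    using inner_multop_bounds[of a v b u, OF assms]
    unfolding hop_def inner_add_right left_diff_distrib distrib_right by linarith+
qed

lemma finite_neighbours [simp]: "finite (neighbours :: (int ^ 'n) set)"
  by (simp add: neighbours_eq)

lemma uminus_neighbours [simp]: "uminus ` neighbours = (neighbours :: (int ^ 'n) set)"
proof -
  have "uminus ` neighbours \<subseteq> (neighbours :: (int ^ 'n) set)" by (auto simp: neighbours_def)
  then show ?thesis by (metis (no_types, lifting) image_subset_iff minus_minus rev_image_eqI subsetI subset_antisym)
qed

lemma jacobi_eq_hop:
  assumes "\<And>n. \<bar>v n\<bar> \<le> C"
  shows "jacobi v = hop neighbours v"
  by (intro ext ell2_eqI) (simp add: coord_hop[OF assms] coord_jacobi[OF assms])

section \<open>The spectrum of a bounded symmetric operator\<close>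

locale csymop = symop A B for A :: "'a ell2 \<Rightarrow> 'a ell2" and B +
  assumes A_scaleC: "A (scaleC_ell2 z u) = scaleC_ell2 z (A u)"
begin

lemma inner_scaleC_i: "inner (scaleC_ell2 \<i> u) w = - inner u (scaleC_ell2 \<i> w)"
proof -
  have "scaleC_ell2 (cnj \<i>) w = - scaleC_ell2 \<i> w" by (rule ell2_eqI) simp
  then show ?thesis unfolding inner_scaleC by simp
qed

lemma opoly_scaleC: "opoly A p (scaleC_ell2 z u) = scaleC_ell2 z (opoly A p u)"
  by (rule opoly_commute[OF lin linear_scaleC]) (rule A_scaleC)

text \<open>Real polynomials of \<open>A\<close> are symmetric and commute with multiplication by i,
  which is antisymmetric for the real inner product. In complex terms, <u, p(A) u> is real.\<close>

lemma inner_i_opoly: "inner (scaleC_ell2 \<i> u) (opoly A p u) = 0"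
proof -
  have "inner (scaleC_ell2 \<i> u) (opoly A p u) = inner (scaleC_ell2 \<i> (opoly A p u)) u"
    by (simp add: opoly_sym[symmetric] opoly_scaleC)
  also have "\<dots> = - inner (scaleC_ell2 \<i> u) (opoly A p u)"
    unfolding inner_scaleC_i[of "opoly A p u"] by (simp add: inner_commute)
  finally show ?thesis by simp
qed

lemma norm_resolvent_sq:
  "(norm (A u - scaleC_ell2 z u))\<^sup>2 = (norm (A u - Re z *\<^sub>R u))\<^sup>2 + (Im z)\<^sup>2 * (norm u)\<^sup>2"
proof -
  define w where "w = A u - Re z *\<^sub>R u"
  define y where "y = scaleC_ell2 (\<i> * of_real (Im z)) u"
  have eq: "A u - scaleC_ell2 z u = w - y"
    unfolding w_def y_def by (rule ell2_eqI) (simp add: complex_eq_iff algebra_simps)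
  have "y = Im z *\<^sub>R scaleC_ell2 \<i> u" unfolding y_def by (rule ell2_eqI) simp
  moreover have "w = opoly A [:- Re z, 1:] u" by (simp add: w_def opoly_linear_factor[OF lin])
  ultimately have "inner y w = 0" using inner_i_opoly by simp
  then have "(norm (w - y))\<^sup>2 = (norm w)\<^sup>2 + (norm y)\<^sup>2"
    unfolding power2_norm_eq_inner inner_diff_left inner_diff_right by (simp add: inner_commute[of w y])
  then show ?thesis unfolding eq by (simp add: w_def y_def norm_mult power_mult_distrib)
qed

lemma norm_resolvent_ge: "\<bar>Im z\<bar> * norm u \<le> norm (A u - scaleC_ell2 z u)"
  by (rule power2_le_imp_le) (simp_all add: norm_resolvent_sq power_mult_distrib)

text \<open>The real polynomial whose value at \<open>A\<close> is (A - z)(A - cnj z) for z = x + i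
  y. It brings the complex resolvent into the calculus of real polynomials.\<close>

definition Tq :: "real \<Rightarrow> real \<Rightarrow> real poly" where
  "Tq x y = [:-x, 1:] * [:-x, 1:] + [:y\<^sup>2:]"

lemma poly_Tq: "poly (Tq x y) t = (t - x)\<^sup>2 + y\<^sup>2"
  by (simp add: Tq_def power2_eq_square algebra_simps)

lemma opoly_Tq_scaleC:
  "opoly A (Tq (Re z) (Im z)) u =
     A (A u - scaleC_ell2 (cnj z) u) - scaleC_ell2 z (A u - scaleC_ell2 (cnj z) u)"
proof -
  have "opoly A (Tq (Re z) (Im z)) u =
    A (A u) - (2 * Re z) *\<^sub>R A u + ((Re z)\<^sup>2 + (Im z)\<^sup>2) *\<^sub>R u"
    unfolding Tq_def opoly_add[OF lin] opoly_mult[OF lin] opoly_linear_factor[OF lin] opoly_const[OF lin]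
    by (simp add: linear_diff[OF lin] linear_add[OF lin] linear_scale[OF lin] algebra_simps power2_eq_square)
      (simp flip: scaleR_left_distrib)
  also have "\<dots> = A (A u - scaleC_ell2 (cnj z) u) - scaleC_ell2 z (A u - scaleC_ell2 (cnj z) u)"
    unfolding linear_diff[OF lin] A_scaleC
    by (rule ell2_eqI) (simp add: complex_eq_iff power2_eq_square algebra_simps)
  finally show ?thesis .
qed

lemma bij_Tq:
  assumes "y \<noteq> 0"
  shows "bij (opoly A (Tq x y))"
proof -
  obtain C where C: "\<forall>t\<in>{-B..B}. \<bar>poly (Tq x y) t\<bar> \<le> C" using poly_bounded by blast
  show ?thesis
  proof (rule coercive_bij[where c = "y\<^sup>2" and M = C])
  show "linear (opoly A (Tq x y))" by (rule opoly_linear[OF lin])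
  show "0 < y\<^sup>2" using assms by simp
  show "y\<^sup>2 * (norm u)\<^sup>2 \<le> inner u (opoly A (Tq x y) u)" for u
  proof -
    have "inner u (opoly A (Tq x y) u) = inner (opoly A [:-x, 1:] u) (opoly A [:-x, 1:] u) + y\<^sup>2 * inner u u"
      by (simp only: Tq_def opoly_add[OF lin] opoly_mult[OF lin] opoly_sym opoly_const[OF lin] inner_add_right inner_scaleR_right)
    then show ?thesis by (simp add: power2_norm_eq_inner)
  qed
  show "norm (opoly A (Tq x y) u) \<le> C * norm u" for u using C by (intro opoly_norm_le) auto
  qed
qed

text \<open>Injectivity comes from the lower bound |Im z|, surjectivity from the factorisation of
  \<open>Tq\<close>, which is bijective by coercivity.\<close>

lemma bij_resolvent:
  assumes "Im z \<noteq> 0"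
  shows "bij (\<lambda>u. A u - scaleC_ell2 z u)"
proof (rule bijI)
  show "inj (\<lambda>u. A u - scaleC_ell2 z u)"
  proof (rule injI)
    fix u w assume "A u - scaleC_ell2 z u = A w - scaleC_ell2 z w"
    then have "A (u - w) - scaleC_ell2 z (u - w) = 0"
      by (simp add: linear_diff[OF lin] scaleC_diff algebra_simps)
    then show "u = w" using norm_resolvent_ge[of z "u - w"] assms
      by (simp add: mult_le_0_iff)
  qed
  show "surj (\<lambda>u. A u - scaleC_ell2 z u)"
    unfolding surj_def
  proof
    fix y
    obtain u where "y = opoly A (Tq (Re z) (Im z)) u"
      using bij_is_surj[OF bij_Tq[OF assms, of "Re z"]] unfolding surj_def by blast
    then show "\<exists>x. y = A x - scaleC_ell2 z x" unfolding opoly_Tq_scaleC by blast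
  qed
qed

lemma linear_resolvent: "linear (\<lambda>u. A u - scaleC_ell2 z u)"
  by (intro linear_compose_sub lin linear_scaleC)

lemma resolvent_setI:
  assumes "bij (\<lambda>u. A u - scaleC_ell2 z u)" "0 < c" "\<And>u. c * norm u \<le> norm (A u - scaleC_ell2 z u)"
  shows "z \<in> resolvent_set A"
proof -
  let ?f = "\<lambda>u. A u - scaleC_ell2 z u"
  have fi: "?f (inv ?f w) = w" for w by (rule surj_f_inv_f[OF bij_is_surj[OF assms(1)]])
  have inj: "inj ?f" using assms(1) by (rule bij_is_inj)
  note l = linear_resolvent[of z]
  have "bounded_linear (inv ?f)"
  proof (rule bounded_linear_intro[where K = "1 / c"])
    show "inv ?f (x + y) = inv ?f x + inv ?f y" for x y
      by (rule inv_f_eq[OF inj]) (simp only: linear_add[OF l] fi)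
    show "inv ?f (r *\<^sub>R x) = r *\<^sub>R inv ?f x" for r x
      by (rule inv_f_eq[OF inj]) (simp only: linear_scale[OF l] fi)
    show "norm (inv ?f x) \<le> norm x * (1 / c)" for x
      using assms(3)[of "inv ?f x"] assms(2) unfolding fi by (simp add: field_simps)
  qed
  then show ?thesis unfolding resolvent_set_def using assms(1) by simp
qed

text \<open>Off the real axis the resolvent always exists. At a real point \<open>x\<close> below
  \<open>lo\<close> or above \<open>hi\<close>, the operator A - x is coercive up to the sign
  \<open>s\<close>.\<close>

lemma spectrum_subset:
  assumes "\<And>u. lo * (norm u)\<^sup>2 \<le> inner u (A u)" "\<And>u. inner u (A u) \<le> hi * (norm u)\<^sup>2"
  shows "spectrum A \<subseteq> complex_of_real ` {lo..hi}"
proof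
  fix z assume z: "z \<in> spectrum A"
  have "Im z = 0"
  proof (rule ccontr)
    assume "Im z \<noteq> 0"
    then have "z \<in> resolvent_set A"
      by (intro resolvent_setI[where c = "\<bar>Im z\<bar>"] bij_resolvent norm_resolvent_ge) auto
    then show False using z by (simp add: spectrum_def)
  qed
  then obtain x where x: "z = of_real x" by (metis complex_is_Real_iff Reals_cases)
  have rs: "z \<in> resolvent_set A" if c: "0 < c" and s: "s = 1 \<or> s = -1"
    and pos: "\<And>u. c * (norm u)\<^sup>2 \<le> s * inner u (A u - x *\<^sub>R u)" for c s :: real
  proof -
    define T where "T u = s *\<^sub>R (A u - x *\<^sub>R u)" for u
    have T: "linear T" unfolding T_def by (intro linear_compose_scale_right linear_compose_sub lin linear_scale_self)
    have bnd: "norm (T u) \<le> (B + \<bar>x\<bar>) * norm u" for u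
      using norm_triangle_ineq4[of "A u" "x *\<^sub>R u"] bound[of u] s
      by (auto simp: T_def algebra_simps norm_minus_commute[of "x *\<^sub>R u"])
    have "bij T"
      by (rule coercive_bij[OF T c _ bnd]) (simp only: T_def inner_scaleR_right pos)
    moreover have "(\<lambda>u. A u - scaleC_ell2 z u) = (\<lambda>w. s *\<^sub>R w) \<circ> T"
      using s by (auto simp: T_def x scaleC_of_real)
    moreover have "bij (\<lambda>w. s *\<^sub>R (w::'a ell2))"
      by (rule bij_betwI[of _ _ _ "\<lambda>w. s *\<^sub>R w"]) (use s in auto)
    ultimately have b: "bij (\<lambda>u. A u - scaleC_ell2 z u)" using bij_comp by metis
    have "c * norm u \<le> norm (A u - scaleC_ell2 z u)" for u
    proof (cases "u = 0")
      case False
      have "c * (norm u)\<^sup>2 \<le> norm u * norm (A u - x *\<^sub>R u)"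
        using pos[of u] Cauchy_Schwarz_ineq2[of u "A u - x *\<^sub>R u"] s by auto
      then show ?thesis using False by (simp add: x scaleC_of_real power2_eq_square)
    qed (simp add: linear_0[OF lin])
    then show ?thesis using b c by (intro resolvent_setI)
  qed
  have "lo \<le> x"
  proof (rule ccontr)
    assume "\<not> lo \<le> x"
    then have "z \<in> resolvent_set A"
      using assms(1) by (intro rs[of "lo - x" 1]) (auto simp: inner_diff_right power2_norm_eq_inner algebra_simps)
    then show False using z by (simp add: spectrum_def)
  qed
  moreover have "x \<le> hi"
  proof (rule ccontr)
    assume "\<not> x \<le> hi"
    then have "z \<in> resolvent_set A"
      using assms(2) by (intro rs[of "x - hi" "-1"]) (auto simp: inner_diff_right power2_norm_eq_inner algebra_simps)
    then show False using z by (simp add: spectrum_def)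
  qed
  ultimately show "z \<in> complex_of_real ` {lo..hi}" using x by auto
qed

lemma spectrum_memI:
  assumes "\<And>e. e > 0 \<Longrightarrow> \<exists>u. u \<noteq> 0 \<and> norm (A u - x *\<^sub>R u) \<le> e * norm u"
  shows "complex_of_real x \<in> spectrum A"
proof (rule ccontr)
  assume "\<not> ?thesis"
  then have "bij (\<lambda>u. A u - x *\<^sub>R u)" "bounded_linear (inv (\<lambda>u. A u - x *\<^sub>R u))"
    by (auto simp: spectrum_def resolvent_set_def scaleC_of_real)
  moreover from bounded_linear.pos_bounded[OF this(2)]
  obtain K where K: "0 < K" "\<And>w. norm (inv (\<lambda>u. A u - x *\<^sub>R u) w) \<le> norm w * K" by blast
  ultimately have le: "norm u \<le> norm (A u - x *\<^sub>R u) * K" for u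
    using K(2)[of "A u - x *\<^sub>R u"] by (simp add: bij_is_inj inv_f_f[of "\<lambda>u. A u - x *\<^sub>R u"])
  obtain u where u: "u \<noteq> 0" "norm (A u - x *\<^sub>R u) \<le> 1 / (2 * K) * norm u"
    using assms[of "1 / (2 * K)"] K(1) by auto
  have "norm (A u - x *\<^sub>R u) * K \<le> (1 / (2 * K) * norm u) * K"
    using K(1) by (intro mult_right_mono u(2)) simp
  also have "\<dots> = norm u / 2" using K(1) by simp
  finally have "norm u \<le> norm u / 2" using le[of u] by linarith
  then show False using u(1) by simp
qed

lemma cinner_funpow: "cinner_ell2 u ((A ^^ k) u) = of_real (\<integral>t. t ^ k \<partial>SM u)"
proof -
  have "(\<integral>t. t ^ k \<partial>SM u) = inner u ((A ^^ k) u)"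
    using SM_poly[of u "monom 1 k"] by (simp add: poly_monom opoly_monom[OF lin])
  then show ?thesis
    using inner_i_opoly[of u "monom 1 k"] by (simp add: cinner_eq opoly_monom[OF lin] complex_eq_iff)
qed

lemma cinner_scaleC_right: "cinner_ell2 u (scaleC_ell2 z w) = z * cinner_ell2 u w"
  unfolding cinner_ell2_def by (simp add: infsum_cmult_right'[symmetric] mult_ac)

lemma bounded_linear_cinner: "bounded_linear (cinner_ell2 u)"
proof -
  have "cinner_ell2 u = (\<lambda>w. of_real (inner u w) + \<i> * of_real (inner (scaleC_ell2 \<i> u) w))"
    by (simp add: cinner_eq fun_eq_iff complex_eq_iff)
  moreover have "bounded_linear (\<lambda>w. of_real (inner u w) + \<i> * of_real (inner (scaleC_ell2 \<i> u) w))"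
    by (intro bounded_linear_add bounded_linear_mult_right[THEN bounded_linear_compose]
        bounded_linear_of_real[THEN bounded_linear_compose] bounded_linear_inner_right)
  ultimately show ?thesis by simp
qed

lemma norm_funpow_le: "norm ((A ^^ k) u) \<le> B ^ k * norm u"
proof (induction k)
  case (Suc k)
  have "norm (A ((A ^^ k) u)) \<le> B * (B ^ k * norm u)"
    using bound[of "(A ^^ k) u"] mult_left_mono[OF Suc, of B] B_pos by linarith
  then show ?case by (simp add: mult_ac)
qed simp

text \<open>The exponential series is integrated term by term: the terms produce the moments of
  \<open>SM u\<close>, and exp (|s| B) dominates the partial sums on the support.\<close>

lemma is_spectral_measure_SM: "is_spectral_measure A u (SM u)"
  unfolding is_spectral_measure_def
proof (intro conjI allI)
  show "finite_measure (SM u)" by (rule SM_finite)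
  show "sets (SM u) = sets borel" by (rule sets_SM)
  fix s :: real
  define c where "c k = (\<i> * of_real s) ^ k / fact k" for k
  have nc: "cmod (c k) = \<bar>s\<bar> ^ k / fact k" for k by (simp add: c_def norm_divide norm_power norm_mult)
  have se: "summable (\<lambda>k. (\<bar>s\<bar> * B) ^ k / fact k)"
    using summable_exp_generic[of "\<bar>s\<bar> * B"] by (simp add: field_simps inverse_eq_divide)
  have "summable (\<lambda>k. scaleC_ell2 (c k) ((A ^^ k) u))"
  proof (rule summable_comparison_test)
    show "\<exists>N. \<forall>n\<ge>N. norm (scaleC_ell2 (c n) ((A ^^ n) u)) \<le> (\<bar>s\<bar> * B) ^ n / fact n * norm u"
    proof (intro exI allI impI)
      fix n
      have "norm (scaleC_ell2 (c n) ((A ^^ n) u)) \<le> \<bar>s\<bar> ^ n / fact n * (B ^ n * norm u)"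
        unfolding norm_scaleC nc by (intro mult_left_mono norm_funpow_le) auto
      then show "norm (scaleC_ell2 (c n) ((A ^^ n) u)) \<le> (\<bar>s\<bar> * B) ^ n / fact n * norm u"
        by (simp add: power_mult_distrib mult_ac)
    qed
  qed (rule summable_mult2[OF se])
  then have "(\<lambda>k. cinner_ell2 u (scaleC_ell2 (c k) ((A ^^ k) u))) sums cinner_ell2 u (exp_i s A u)"
    unfolding exp_i_def c_def[symmetric]
    by (intro bounded_linear.sums[OF bounded_linear_cinner] summable_sums)
  then have lim1: "(\<lambda>n. \<Sum>k<n. c k * of_real (\<integral>t. t ^ k \<partial>SM u)) \<longlonglongrightarrow> cinner_ell2 u (exp_i s A u)"
    by (simp add: cinner_scaleC_right cinner_funpow sums_def)
  have termeq: "(\<i> * of_real (s * t)) ^ k / fact k = c k * of_real (t ^ k)" for t k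
    by (simp add: c_def power_mult_distrib)
  have mm: "(\<lambda>t. c k * of_real (t ^ k)) \<in> borel_measurable borel" for k
    by measurable
  have intk: "integrable (SM u) (\<lambda>t. t ^ k)" for k
    using integrable_poly[of u "monom 1 k"] by (simp add: poly_monom[abs_def])
  have "(\<lambda>n. \<integral>t. (\<Sum>k<n. c k * of_real (t ^ k)) \<partial>SM u) \<longlonglongrightarrow> (\<integral>t. exp (\<i> * of_real (s * t)) \<partial>SM u)"
  proof (rule integral_dominated_convergence[where w = "\<lambda>_. exp (\<bar>s\<bar> * B)"])
    show "(\<lambda>t. exp (\<i> * of_real (s * t))) \<in> borel_measurable (SM u)"
      by (subst measurable_cong_sets[OF sets_SM refl]) measurable
    show "(\<lambda>t. \<Sum>k<n. c k * of_real (t ^ k)) \<in> borel_measurable (SM u)" for n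
      by (subst measurable_cong_sets[OF sets_SM refl]) measurable
    show "AE t in SM u. (\<lambda>n. \<Sum>k<n. c k * of_real (t ^ k)) \<longlonglongrightarrow> exp (\<i> * of_real (s * t))"
    proof (rule AE_I2)
      fix t
      have "(\<lambda>k. (\<i> * of_real (s * t)) ^ k /\<^sub>R fact k) sums exp (\<i> * of_real (s * t))" by (rule exp_converges)
      moreover have "(\<i> * of_real (s * t)) ^ k /\<^sub>R fact k = c k * of_real (t ^ k)" for k
        unfolding termeq[symmetric] by (simp add: scaleR_conv_of_real field_simps)
      ultimately show "(\<lambda>n. \<Sum>k<n. c k * of_real (t ^ k)) \<longlonglongrightarrow> exp (\<i> * of_real (s * t))"
        by (simp add: sums_def)
    qed
    show "AE t in SM u. norm (\<Sum>k<n. c k * of_real (t ^ k)) \<le> exp (\<bar>s\<bar> * B)" for n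
      using SM_bound[of u]
    proof eventually_elim
      fix t assume t: "\<bar>t\<bar> \<le> B"
      have "norm (\<Sum>k<n. c k * of_real (t ^ k)) \<le> (\<Sum>k<n. norm (c k * of_real (t ^ k)))" by (rule norm_sum)
      also have "\<dots> \<le> (\<Sum>k<n. (\<bar>s\<bar> * B) ^ k / fact k)"
      proof (rule sum_mono)
        fix k
        have "\<bar>s\<bar> ^ k * \<bar>t\<bar> ^ k \<le> \<bar>s\<bar> ^ k * B ^ k" using t by (intro mult_left_mono power_mono) auto
        then show "norm (c k * of_real (t ^ k)) \<le> (\<bar>s\<bar> * B) ^ k / fact k"
          by (simp add: norm_mult nc norm_power power_abs power_mult_distrib divide_right_mono)
      qed
      also have "\<dots> \<le> (\<Sum>k. (\<bar>s\<bar> * B) ^ k / fact k)"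
        using B_pos by (intro sum_le_suminf se) auto
      also have "\<dots> = exp (\<bar>s\<bar> * B)" by (simp add: exp_def divide_inverse mult.commute)
      finally show "norm (\<Sum>k<n. c k * of_real (t ^ k)) \<le> exp (\<bar>s\<bar> * B)" .
    qed
  qed simp
  moreover have "(\<integral>t. (\<Sum>k<n. c k * of_real (t ^ k)) \<partial>SM u) = (\<Sum>k<n. c k * of_real (\<integral>t. t ^ k \<partial>SM u))" for n
  proof -
    have ic: "integrable (SM u) (\<lambda>t. c k * of_real (t ^ k))" for k
      using intk[of k] by (intro integrable_mult_right) (auto intro!: integrable_of_real simp del: of_real_power)
    have eq: "(\<integral>t. c k * of_real (t ^ k) \<partial>SM u) = c k * of_real (\<integral>t. t ^ k \<partial>SM u)" for k
      by (simp only: integral_mult_right_zero integral_complex_of_real)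
    show ?thesis by (subst Bochner_Integration.integral_sum) (rule ic, simp only: eq)
  qed
  ultimately show "cinner_ell2 u (exp_i s A u) = (\<integral>t. exp (\<i> * of_real (s * t)) \<partial>SM u)"
    using LIMSEQ_unique[OF lim1] by simp
qed

lemma purely_sc_SM:
  assumes "\<And>E. emeasure (SM u) {E} = 0" "N \<in> null_sets lborel" "emeasure (SM u) (UNIV - N) = 0"
  shows "purely_sc_measure (SM u)"
  unfolding purely_sc_measure_def lebesgue_decomposition_def
proof (intro exI conjI)
  show "sets (null_measure borel) = sets (borel :: real measure)" by simp
  show "sets (null_measure borel) = sets (borel :: real measure)" by simp
  show "sets (SM u) = sets borel" by (rule sets_SM)
  show "absolutely_continuous lborel (null_measure borel :: real measure)"
    by (auto simp: absolutely_continuous_def null_sets_def)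
  show "countable ({} :: real set)" by simp
  show "\<forall>E. emeasure (SM u) {E} = 0" using assms(1) by simp
  show "\<exists>N\<in>null_sets lborel. emeasure (SM u) (UNIV - N) = 0" using assms by blast
qed auto

text \<open>Only the basis vectors need testing, since a Borel set that is null for all of them is
  null for every vector by \<open>SM_null_closure\<close>. Countability lets a single Lebesgue null
  set serve all basis vectors.\<close>

lemma purely_singular_continuousI:
  assumes at: "\<And>m E. emeasure (SM (ket m)) {E} = 0"
    and N: "\<And>m. N m \<in> null_sets lborel" "\<And>m. emeasure (SM (ket m)) (UNIV - N m) = 0"
    and count: "countable (UNIV :: 'a set)"
  shows "purely_singular_continuous A"
proof -
  define N0 where "N0 = (\<Union>m. N m)"
  have N0: "N0 \<in> null_sets lborel" unfolding N0_def using N(1) count by (intro null_sets_UN') auto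
  have N0b: "UNIV - N0 \<in> sets borel" using N0 by (auto simp: null_sets_def)
  \<comment> \<open>Both vectors define the same predicate \<open>smeas\<close>, so the choice made
    in \<open>SM\<close> returns the same measure.\<close>
  have smC: "SM (scaleC_ell2 \<i> x) = SM x" for x
  proof -
    have "smeas (scaleC_ell2 \<i> x) = smeas x"
      unfolding smeas_def fun_eq_iff opoly_scaleC inner_scaleC by simp
    then show ?thesis by (simp add: SM_def)
  qed
  have ext: "emeasure (SM u) S = 0" if S: "S \<in> sets borel" "\<And>m. emeasure (SM (ket m)) S = 0" for u S
    by (rule SM_null_closure[OF S(1), of "range ket \<union> scaleC_ell2 \<i> ` range ket"])
      (auto simp: smC S(2) ket_span_dense)
  have "emeasure (SM (ket m)) (UNIV - N0) = 0" for m
  proof -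
    have "emeasure (SM (ket m)) (UNIV - N0) \<le> emeasure (SM (ket m)) (UNIV - N m)"
      using N(1)[of m] by (intro emeasure_mono) (auto simp: N0_def sets_SM null_sets_def)
    then show ?thesis using N(2)[of m] by simp
  qed
  then have "purely_sc_measure (SM u)" for u
    by (rule_tac purely_sc_SM[OF ext[OF _ at] N0 ext[OF N0b]]) auto
  then show ?thesis
    unfolding purely_singular_continuous_def using is_spectral_measure_SM by blast
qed

end

section \<open>The space of potentials\<close>

definition configs :: "real \<Rightarrow> real \<Rightarrow> ('a \<Rightarrow> real) set" where
  "configs a b = {v. \<forall>n. a \<le> v n \<and> v n \<le> b}"

lemma topspace_config: "topspace (config_space a b) = configs a b"
  by (auto simp: config_space_def configs_def PiE_def Pi_def)

lemma configs_bound: "v \<in> configs a b \<Longrightarrow> \<bar>v n\<bar> \<le> \<bar>a\<bar> + \<bar>b\<bar>"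
  by (auto simp: configs_def abs_le_iff dest!: spec[of _ n])

lemma continuous_map_config_eval:
  "continuous_map (config_space a b) euclideanreal (\<lambda>v. v n)"
proof -
  have "continuous_map (config_space a b) (top_of_set {a..b}) (\<lambda>v. v n)"
    unfolding config_space_def by (rule continuous_map_product_projection) simp
  then show ?thesis by (simp add: continuous_map_in_subtopology)
qed

text \<open>A basic open set of the product topology constrains finitely many sites, so it is enough
  to match \<open>v0\<close> exactly on each finite set.\<close>

lemma dense_configI:
  assumes "\<And>v0 S. v0 \<in> configs a b \<Longrightarrow> finite S \<Longrightarrow> \<exists>v\<in>U. v \<in> configs a b \<and> (\<forall>n\<in>S. v n = v0 n)"
  shows "config_space a b closure_of U = topspace (config_space a b)"
proof -
  have "U \<inter> T \<noteq> {}" if T: "openin (config_space a b) T" "T \<noteq> {}" for T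
  proof -
    obtain v0 where v0: "v0 \<in> T" using T(2) by blast
    then have v0c: "v0 \<in> configs a b" using openin_subset[OF T(1)] by (auto simp: topspace_config)
    obtain V where V: "finite {i. V i \<noteq> {a..b}}" "v0 \<in> Pi\<^sub>E UNIV V" "Pi\<^sub>E UNIV V \<subseteq> T"
      using T(1) v0 unfolding config_space_def openin_product_topology_alt by force
    obtain v where v: "v \<in> U" "v \<in> configs a b" "\<And>n. n \<in> {i. V i \<noteq> {a..b}} \<Longrightarrow> v n = v0 n"
      using assms[OF v0c V(1)] by blast
    have "v n \<in> V n" for n
      using v(2) v(3)[of n] V(2) by (cases "V n = {a..b}") (auto simp: configs_def)
    then have "v \<in> T" using V(3) by (auto simp: PiE_def)
    with v(1) show ?thesis by blast
  qed
  then show ?thesis unfolding dense_intersects_open by blast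
qed

lemma config_Baire:
  assumes "countable \<G>" "\<G> \<noteq> {}" "\<And>U. U \<in> \<G> \<Longrightarrow> openin (config_space a b) U"
    "\<And>U. U \<in> \<G> \<Longrightarrow> config_space a b closure_of U = topspace (config_space a b)"
  shows "gdelta_in (config_space a b) (\<Inter>\<G>)"
    "config_space a b closure_of (\<Inter>\<G>) = topspace (config_space a b)"
proof -
  show "gdelta_in (config_space a b) (\<Inter>\<G>)"
    using assms by (intro gdelta_in_Inter open_imp_gdelta_in)
  have c: "compact_space (config_space a b)"
    unfolding config_space_def by (simp add: compact_space_product_topology compact_space_subtopology)
  have h: "Hausdorff_space (config_space a b)"
    unfolding config_space_def by (simp add: Hausdorff_space_product_topology Hausdorff_space_subtopology)
  show "config_space a b closure_of (\<Inter>\<G>) = topspace (config_space a b)"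
    using c h assms by (intro Baire_category)
      (auto intro: compact_imp_locally_compact_space compact_Hausdorff_imp_regular_space)
qed

text \<open>Horner's recursion: one application of the operator takes a finite sum over neighbours
  and one product with \<open>v n\<close>, both continuous. The coordinate formula for
  \<open>hop\<close> needs a bounded potential, hence the transfer by
  \<open>continuous_map_eq\<close> on the topspace.\<close>

lemma continuous_map_opoly:
  fixes m n :: "int ^ 'n"
  shows "continuous_map (config_space a b) euclidean (\<lambda>v. coord (opoly (hop neighbours v) p (ket m)) n)"
proof (induction p arbitrary: n)
  case (pCons c p)
  have "continuous_map (config_space a b) euclidean
     (\<lambda>v. of_real c * of_bool (n = m) + ((\<Sum>j\<in>neighbours. coord (opoly (hop neighbours v) p (ket m)) (n + j))
        + of_real (v n) * coord (opoly (hop neighbours v) p (ket m)) n))"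
    using pCons.IH continuous_map_config_eval[of a b n]
    unfolding continuous_map_atin limitin_canonical_iff
    by (auto intro!: tendsto_intros)
  then show ?case
  proof (rule continuous_map_eq)
    fix v :: "int ^ 'n \<Rightarrow> real" assume "v \<in> topspace (config_space a b)"
    then have b: "\<And>n. \<bar>v n\<bar> \<le> \<bar>a\<bar> + \<bar>b\<bar>" by (auto simp: topspace_config intro: configs_bound)
    show "of_real c * of_bool (n = m) + ((\<Sum>j\<in>neighbours. coord (opoly (hop neighbours v) p (ket m)) (n + j))
        + of_real (v n) * coord (opoly (hop neighbours v) p (ket m)) n) =
      coord (opoly (hop neighbours v) (pCons c p) (ket m)) n"
      by (simp add: opoly_pCons[OF linear_hop[OF b]] coord_hop[OF b])
  qed
qed simp

lemma continuous_map_inner_opoly: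
  fixes m :: "int ^ 'n"
  shows "continuous_map (config_space a b) euclideanreal (\<lambda>v. inner (ket m) (opoly (hop neighbours v) p (ket m)))"
  using continuous_map_opoly[of a b p m m]
  unfolding continuous_map_atin limitin_canonical_iff inner_ket by (auto intro!: tendsto_intros)

lemma openin_config_less:
  assumes "continuous_map (config_space a b) euclideanreal f"
  shows "openin (config_space a b) {v \<in> configs a b. f v < c}"
  using openin_continuous_map_preimage[OF assms, of "{..<c}"] by (simp add: topspace_config)

section \<open>Cubes and truncated plane waves\<close>

definition cube :: "int ^ 'n \<Rightarrow> nat \<Rightarrow> (int ^ 'n) set" where
  "cube x M = {n. \<forall>i. \<bar>n $ i - x $ i\<bar> \<le> int M}"

lemma card_vec_Pi:
  assumes "\<And>i. finite (S i)"
  shows "finite {n :: 'b ^ 'n. \<forall>i. n $ i \<in> S i}" "card {n :: 'b ^ 'n. \<forall>i. n $ i \<in> S i} = (\<Prod>i\<in>UNIV. card (S i))"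
proof -
  have bij: "bij_betw vec_nth {n :: 'b ^ 'n. \<forall>i. n $ i \<in> S i} (Pi\<^sub>E UNIV S)"
    by (rule bij_betwI[where g = vec_lambda]) (auto simp: PiE_def)
  show "card {n :: 'b ^ 'n. \<forall>i. n $ i \<in> S i} = (\<Prod>i\<in>UNIV. card (S i))"
    using bij_betw_same_card[OF bij] by (simp add: card_PiE)
  show "finite {n :: 'b ^ 'n. \<forall>i. n $ i \<in> S i}"
    using bij_betw_finite[OF bij] assms by (simp add: finite_PiE)
qed

lemma cube_eq: "cube x M = {n :: int ^ 'n. \<forall>i. n $ i \<in> {x $ i - int M..x $ i + int M}}"
  by (auto simp: cube_def abs_le_iff) (metis diff_le_eq le_diff_eq add.commute minus_diff_eq neg_le_iff_le minus_le_iff diff_add_eq)+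

lemma finite_cube [simp]: "finite (cube x M :: (int ^ 'n) set)"
  unfolding cube_eq by (rule card_vec_Pi) simp

lemma card_cube: "card (cube x M :: (int ^ 'n) set) = (2 * M + 1) ^ CARD('n)"
proof -
  have "nat (1 + 2 * int M) = 2 * M + 1" by simp
  then show ?thesis unfolding cube_eq by (subst card_vec_Pi) (simp_all add: algebra_simps)
qed

lemma neighbour_nth:
  assumes "j \<in> neighbours"
  shows "\<bar>j $ i\<bar> \<le> 1"
  using assms by (auto simp: neighbours_eq axis_def split: if_splits)

lemma cube_neighbour:
  assumes "n \<in> cube x M" "j \<in> neighbours"
  shows "n + j \<in> cube x (Suc M)"
  unfolding cube_def
proof safe
  fix i
  show "\<bar>(n + j) $ i - x $ i\<bar> \<le> int (Suc M)"
    using assms(1) neighbour_nth[OF assms(2), of i] by (auto simp: cube_def dest!: spec[of _ i])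
qed

lemma cube_mono: "M \<le> M' \<Longrightarrow> cube x M \<subseteq> cube x M'"
  by (auto simp: cube_def intro: order_trans)

lemma power_diff_le:
  fixes x y :: real
  assumes "0 \<le> y" "y \<le> x"
  shows "x ^ k - y ^ k \<le> real k * (x - y) * x ^ (k - 1)"
proof (induction k)
  case (Suc k)
  have "x ^ Suc k - y ^ Suc k = x * (x ^ k - y ^ k) + (x - y) * y ^ k" by (simp add: algebra_simps)
  also have "\<dots> \<le> x * (real k * (x - y) * x ^ (k - 1)) + (x - y) * x ^ k"
    using assms Suc by (intro add_mono mult_left_mono power_mono) auto
  also have "\<dots> = real (Suc k) * (x - y) * x ^ (Suc k - 1)"
    by (cases k) (simp_all add: algebra_simps)
  finally show ?case .
qed simp

lemma sum_neighbours:
  fixes f :: "int ^ 'n \<Rightarrow> 'b::comm_monoid_add"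
  shows "(\<Sum>j\<in>neighbours. f j) = (\<Sum>i\<in>UNIV. f (axis i 1) + f (axis i (- 1)))"
proof -
  have "(\<Sum>j\<in>neighbours. f j) = (\<Sum>i\<in>UNIV. \<Sum>j\<in>{axis i 1, axis i (- 1)}. f j)"
    unfolding neighbours_eq by (rule sum.UNION_disjoint) (auto simp: axis_eq_axis)
  also have "\<dots> = (\<Sum>i\<in>UNIV. f (axis i 1) + f (axis i (- 1)))"
    by (intro sum.cong) (auto simp: axis_eq_axis)
  finally show ?thesis .
qed

text \<open>The wave whose momentum has all components equal to \<open>k\<close> has energy c + 2
  \<nu> cos k for the constant potential \<open>c\<close>. Cut off to a cube, it violates the
  eigenvalue equation by more than \<open>e\<close> only near the boundary, on a fraction of order 1
  / M of the sites.\<close>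

lemma plane_wave:
  fixes x :: "int ^ 'n" and v :: "int ^ 'n \<Rightarrow> real"
  assumes v: "\<And>n. \<bar>v n\<bar> \<le> C" and near: "\<And>n. n \<in> cube x M \<Longrightarrow> \<bar>v n - c\<bar> \<le> e" and M: "0 < M"
  defines "\<nu> \<equiv> real CARD('n)"
  obtains u where "u \<noteq> 0"
    "(norm (hop neighbours v u - (c + 2 * \<nu> * cos k) *\<^sub>R u))\<^sup>2 \<le>
      (e\<^sup>2 + (2 * \<nu> + C + \<bar>c + 2 * \<nu> * cos k\<bar>)\<^sup>2 * (4 * \<nu> * 3 ^ CARD('n) / (2 * real M + 1))) * (norm u)\<^sup>2"
proof -
  define E where "E = c + 2 * \<nu> * cos k"
  define w where "w n = cis (k * of_int (\<Sum>i\<in>UNIV. n $ i))" for n :: "int ^ 'n"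
  define u where "u = (\<Sum>n\<in>cube x M. scaleC_ell2 (w n) (ket n))"
  have cu: "coord u n = (if n \<in> cube x M then w n else 0)" for n
    by (simp add: u_def of_bool_def if_distrib cong: if_cong)
  have w1: "cmod (w n) = 1" for n by (simp add: w_def)
  have w_add: "w (n + j) = w n * w j" for n j
    by (simp add: w_def cis_mult sum.distrib algebra_simps)
  have w_axis: "w (axis i z) = cis (k * of_int z)" for i z
    by (simp add: w_def axis_def)
  have w_sum: "(\<Sum>j\<in>neighbours. w j) = of_real (2 * \<nu> * cos k)"
    by (simp add: sum_neighbours w_axis \<nu>_def complex_eq_iff)
  have nu: "(norm u)\<^sup>2 = real (card (cube x M))"
    by (subst norm_sq_finite_support[of "cube x M"]) (auto simp: cu w1)
  define D where "D = hop neighbours v u - E *\<^sub>R u"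
  have cD: "coord D n = (\<Sum>j\<in>neighbours. coord u (n + j)) + of_real (v n - E) * coord u n" for n
    by (simp add: D_def coord_hop[OF v] algebra_simps)
  have C0: "0 \<le> C" using v[of x] by linarith
  define K where "K = 2 * \<nu> + C + \<bar>E\<bar>"
  have cDK: "cmod (coord D n) \<le> K" for n
  proof -
    have u1: "cmod (coord u n) \<le> 1" for n by (simp add: cu w1)
    have "cmod (coord D n) \<le> (\<Sum>j\<in>neighbours. cmod (coord u (n + j))) + cmod (of_real (v n - E) * coord u n)"
      unfolding cD by (intro norm_triangle_mono norm_sum) simp
    also have "\<dots> \<le> (\<Sum>j\<in>(neighbours :: (int ^ 'n) set). 1) + (C + \<bar>E\<bar>) * 1"
    proof (rule add_mono)
      show "(\<Sum>j\<in>neighbours. cmod (coord u (n + j))) \<le> (\<Sum>j\<in>(neighbours :: (int ^ 'n) set). 1)"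
        by (rule sum_mono) (rule u1)
      show "cmod (of_real (v n - E) * coord u n) \<le> (C + \<bar>E\<bar>) * 1"
        unfolding norm_mult using v[of n] u1 C0 by (intro mult_mono) (auto simp del: of_real_diff)
    qed
    also have "\<dots> = K" by (simp add: K_def \<nu>_def card_neighbours)
    finally show ?thesis .
  qed
  have inner: "cmod (coord D n) \<le> e" if n: "n \<in> cube x (M - 1)" for n
  proof -
    have nb: "n + j \<in> cube x M" if "j \<in> neighbours" for j
      using cube_neighbour[OF n that] M by simp
    have nM: "n \<in> cube x M" using n cube_mono[of "M - 1" M x] by auto
    have "coord D n = (\<Sum>j\<in>neighbours. w n * w j) + of_real (v n - E) * w n"
      unfolding cD using nb nM by (simp add: cu w_add)
    also have "\<dots> = w n * of_real (v n - c)"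
      unfolding sum_distrib_left[symmetric] w_sum by (simp add: E_def algebra_simps)
    finally show ?thesis using near[OF nM] by (simp add: norm_mult w1 del: of_real_diff)
  qed
  have outer: "coord D n = 0" if n: "n \<notin> cube x (M + 1)" for n
  proof -
    have "n \<notin> cube x M" using n cube_mono[of M "M + 1" x] by auto
    moreover have "n + j \<notin> cube x M" if "j \<in> neighbours" for j
    proof
      assume a: "n + j \<in> cube x M"
      have "- j \<in> neighbours" using that by (simp add: neighbours_def)
      from cube_neighbour[OF a this] n show False by simp
    qed
    ultimately show ?thesis by (simp add: cD cu)
  qed
  \<comment> \<open>Sites within radius M - 1 have all their neighbours in the cube, and sites
    beyond radius M + 1 have none there. Only the shell in between needs the crude bound
    \<open>K\<close>.\<close>
  have sub: "cube x (M - 1) \<subseteq> cube x (M + 1)" by (rule cube_mono) simp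
  have "(norm D)\<^sup>2 = (\<Sum>n\<in>cube x (M + 1). (cmod (coord D n))\<^sup>2)"
    by (rule norm_sq_finite_support) (use outer in auto)
  also have "\<dots> = (\<Sum>n\<in>cube x (M + 1) - cube x (M - 1). (cmod (coord D n))\<^sup>2) + (\<Sum>n\<in>cube x (M - 1). (cmod (coord D n))\<^sup>2)"
    using sum.subset_diff[OF sub] by simp
  also have "\<dots> \<le> (\<Sum>n\<in>cube x (M + 1) - cube x (M - 1). K\<^sup>2) + (\<Sum>n\<in>cube x (M - 1). e\<^sup>2)"
    by (intro add_mono sum_mono power_mono cDK inner) auto
  also have "\<dots> = K\<^sup>2 * (real (card (cube x (M + 1))) - real (card (cube x (M - 1)))) + e\<^sup>2 * real (card (cube x (M - 1)))"
    using sub by (simp add: card_Diff_subset card_mono of_nat_diff)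
  also have "\<dots> \<le> K\<^sup>2 * (4 * \<nu> * 3 ^ CARD('n) / (2 * real M + 1) * (norm u)\<^sup>2) + e\<^sup>2 * (norm u)\<^sup>2"
  proof (intro add_mono mult_left_mono)
    have "real (card (cube x (M + 1))) - real (card (cube x (M - 1))) = (2 * real M + 3) ^ CARD('n) - (2 * real M - 1) ^ CARD('n)"
      using M by (simp add: card_cube of_nat_diff algebra_simps)
    also have "\<dots> \<le> real CARD('n) * ((2 * real M + 3) - (2 * real M - 1)) * (2 * real M + 3) ^ (CARD('n) - 1)"
      using M by (intro power_diff_le) auto
    also have "\<dots> = 4 * \<nu> * (2 * real M + 3) ^ (CARD('n) - 1)" by (simp add: \<nu>_def)
    \<comment> \<open>The estimate 2 M + 3 <= 3 (2 M + 1) is the origin of the factor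
      \<open>3 ^ CARD('n)\<close>.\<close>
    also have "\<dots> \<le> 4 * \<nu> * (3 * (2 * real M + 1)) ^ (CARD('n) - 1)"
      by (intro mult_left_mono power_mono) (auto simp: \<nu>_def)
    also have "\<dots> \<le> 4 * \<nu> * (3 ^ CARD('n) * (2 * real M + 1) ^ (CARD('n) - 1))"
      unfolding power_mult_distrib
      by (intro mult_left_mono mult_right_mono power_increasing) (auto simp: \<nu>_def)
    also have "\<dots> = 4 * \<nu> * 3 ^ CARD('n) / (2 * real M + 1) * (2 * real M + 1) ^ CARD('n)"
      using power_Suc[of "2 * real M + 1" "CARD('n) - 1"] by (simp add: field_simps)
    also have "(2 * real M + 1) ^ CARD('n) = (norm u)\<^sup>2" by (simp add: nu card_cube add.commute)
    finally show "real (card (cube x (M + 1))) - real (card (cube x (M - 1))) \<le>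
      4 * \<nu> * 3 ^ CARD('n) / (2 * real M + 1) * (norm u)\<^sup>2" .
    show "real (card (cube x (M - 1))) \<le> (norm u)\<^sup>2"
      unfolding nu by (simp add: card_mono cube_mono)
  qed auto
  finally have "(norm D)\<^sup>2 \<le> (e\<^sup>2 + K\<^sup>2 * (4 * \<nu> * 3 ^ CARD('n) / (2 * real M + 1))) * (norm u)\<^sup>2"
    by (simp add: algebra_simps)
  moreover have "u \<noteq> 0" using nu by (auto simp: card_cube)
  ultimately show ?thesis using that[of u] unfolding D_def E_def K_def by simp
qed

section \<open>Periodic potentials\<close>

lemma orthonormal_basis_exists:
  fixes S :: "'a::real_inner set"
  assumes "finite S"
  obtains Q where "finite Q" "span Q = span S" "pairwise orthogonal Q" "\<And>x. x \<in> Q \<Longrightarrow> norm x = 1"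
proof -
  obtain C where C: "finite C" "span C = span S" "pairwise orthogonal C"
    using basis_orthogonal[OF assms] by blast
  define Q where "Q = (\<lambda>x. x /\<^sub>R norm x) ` (C - {0})"
  show ?thesis
  proof (rule that)
    show "finite Q" using C by (simp add: Q_def)
    show "norm x = 1" if "x \<in> Q" for x
    proof -
      obtain y where "y \<noteq> 0" "x = y /\<^sub>R norm y" using \<open>x \<in> Q\<close> unfolding Q_def by blast
      then show ?thesis by simp
    qed
    show "pairwise orthogonal Q"
      using C(3) unfolding Q_def pairwise_def orthogonal_def by auto
    have "Q \<subseteq> span C" by (auto simp: Q_def intro!: span_scale intro: span_base)
    moreover have "C \<subseteq> span Q"
    proof
      fix x assume x: "x \<in> C"
      show "x \<in> span Q"
      proof (cases "x = 0")
        case False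
        then have "x /\<^sub>R norm x \<in> span Q" using x by (intro span_base) (auto simp: Q_def)
        from span_scale[OF this, of "norm x"] False show ?thesis by simp
      qed (simp add: span_zero)
    qed
    ultimately show "span Q = span S" unfolding C(2)[symmetric] by (simp add: span_eq)
  qed
qed

lemma orthonormal_independent:
  fixes Q :: "'a::real_inner set"
  assumes "pairwise orthogonal Q" "\<And>x. x \<in> Q \<Longrightarrow> norm x = 1"
  shows "independent Q"
  using assms by (intro pairwise_orthogonal_independent) force+

text \<open>The Hilbert-Schmidt norm of \<open>P\<close> on a finite-dimensional space: expanding
  each vector of one basis in the other and exchanging the sums shows that it does not depend on the
  basis.\<close>

lemma trace_basis_independent:
  fixes P :: "'a::real_inner \<Rightarrow> 'b::real_inner"
  assumes K: "finite K" "pairwise orthogonal K" "\<And>x. x \<in> K \<Longrightarrow> norm x = 1"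
    and Q: "finite Q" "pairwise orthogonal Q" "\<And>x. x \<in> Q \<Longrightarrow> norm x = 1"
    and span: "span K = span Q" and P: "linear P"
  shows "(\<Sum>x\<in>K. (norm (P x))\<^sup>2) = (\<Sum>f\<in>Q. (norm (P f))\<^sup>2)"
proof -
  have x: "x = (\<Sum>f\<in>Q. inner x f *\<^sub>R f)" if "x \<in> K" for x
    using orthonormal_basis_expand[OF Q(2,3) _ Q(1), of x] that span span_base[of x K] by auto
  have f: "f = (\<Sum>x\<in>K. inner f x *\<^sub>R x)" if "f \<in> Q" for f
    using orthonormal_basis_expand[OF K(2,3) _ K(1), of f] that span span_base[of f Q] by auto
  have "(\<Sum>x\<in>K. (norm (P x))\<^sup>2) = (\<Sum>x\<in>K. \<Sum>f\<in>Q. inner x f * inner (P f) (P x))"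
  proof (rule sum.cong[OF refl])
    fix y assume "y \<in> K"
    then have "P y = (\<Sum>f\<in>Q. inner y f *\<^sub>R P f)"
      using x[of y] by (metis (no_types, lifting) P linear_scale linear_sum sum.cong)
    then show "(norm (P y))\<^sup>2 = (\<Sum>f\<in>Q. inner y f * inner (P f) (P y))"
      unfolding power2_norm_eq_inner by (subst (1) \<open>P y = _\<close>) (simp add: inner_sum_left)
  qed
  also have "\<dots> = (\<Sum>f\<in>Q. \<Sum>x\<in>K. inner x f * inner (P f) (P x))" by (rule sum.swap)
  also have "\<dots> = (\<Sum>f\<in>Q. (norm (P f))\<^sup>2)"
  proof (rule sum.cong[OF refl])
    fix g assume "g \<in> Q"
    then have "P g = (\<Sum>x\<in>K. inner g x *\<^sub>R P x)"
      using f[of g] by (metis (no_types, lifting) P linear_scale linear_sum sum.cong)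
    then show "(\<Sum>x\<in>K. inner x g * inner (P g) (P x)) = (norm (P g))\<^sup>2"
      unfolding power2_norm_eq_inner
      by (subst (3) \<open>P g = _\<close>) (simp add: inner_sum_right inner_commute[of g])
  qed
  finally show ?thesis .
qed

text \<open>In an orthonormal basis adapted to \<open>span W\<close>, each of the card K - card W
  complementary directions contributes at most 1. The set \<open>Q\<close> is obtained before
  \<open>P\<close>, so that \<open>P\<close> may be chosen in dependence on
  \<open>Q\<close>.\<close>

lemma trace_le_codim:
  fixes K W :: "'a::real_inner set"
  assumes K: "finite K" "pairwise orthogonal K" "\<And>x. x \<in> K \<Longrightarrow> norm x = 1"
    and W: "finite W" "independent W" "W \<subseteq> span K"
  obtains Q where "finite Q" "Q \<subseteq> span W"
    "\<And>P :: 'a \<Rightarrow> 'b::real_inner. linear P \<Longrightarrow> (\<And>x. norm (P x) \<le> norm x) \<Longrightarrow>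
      (\<Sum>x\<in>K. (norm (P x))\<^sup>2) \<le> real (card K) - real (card W) + (\<Sum>f\<in>Q. (norm (P f))\<^sup>2)"
proof -
  obtain Q where Q: "finite Q" "span Q = span W" "pairwise orthogonal Q" "\<And>x. x \<in> Q \<Longrightarrow> norm x = 1"
    using orthonormal_basis_exists[OF W(1)] by blast
  \<comment> \<open>The residual of orthogonal projection onto \<open>span W\<close>. An orthonormal
    basis \<open>R\<close> of the span of the residuals completes \<open>Q\<close>.\<close>
  define r where "r x = x - (\<Sum>f\<in>Q. inner x f *\<^sub>R f)" for x
  obtain R where R: "finite R" "span R = span (r ` K)" "pairwise orthogonal R" "\<And>x. x \<in> R \<Longrightarrow> norm x = 1"
    using orthonormal_basis_exists[of "r ` K"] K(1) by blast
  have rQ: "orthogonal f (r x)" if "f \<in> Q" for f x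
  proof -
    have "(\<Sum>g\<in>Q. inner x g * inner f g) = (\<Sum>g\<in>Q. if g = f then inner x f else 0)"
    proof (rule sum.cong[OF refl])
      fix g assume "g \<in> Q"
      then show "inner x g * inner f g = (if g = f then inner x f else 0)"
        using Q(3,4) that by (cases "g = f") (auto simp: pairwise_def orthogonal_def norm_eq_1)
    qed
    then have "inner f (\<Sum>g\<in>Q. inner x g *\<^sub>R g) = inner x f"
      using that Q(1) by (simp add: inner_sum_right)
    then show ?thesis by (simp add: r_def orthogonal_def inner_diff_right inner_commute)
  qed
  have QR: "orthogonal f g" if "f \<in> Q" "g \<in> R" for f g
  proof -
    have "g \<in> span (r ` K)" using R(2) that(2) span_base by blast
    then show ?thesis by (rule orthogonal_to_span) (use rQ that in auto)
  qed
  have disj: "Q \<inter> R = {}"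
    using QR Q(4) by (force simp: orthogonal_def norm_eq_1)
  have orth: "pairwise orthogonal (Q \<union> R)"
  proof -
    have "orthogonal g f" if "f \<in> Q" "g \<in> R" for f g
      using QR[OF that] by (simp add: orthogonal_commute)
    then show ?thesis using Q(3) R(3) QR unfolding pairwise_def by blast
  qed
  have n1: "norm x = 1" if "x \<in> Q \<union> R" for x using that Q(4) R(4) by auto
  have Qs: "Q \<subseteq> span K" using Q(2) W(3) by (metis span_minimal span_superset subspace_span subset_trans)
  have "r x \<in> span K" if "x \<in> K" for x
    unfolding r_def using that Qs by (intro span_diff span_sum span_scale) (auto intro: span_base)
  then have Rs: "R \<subseteq> span K" using R(2) by (metis image_subsetI span_minimal span_superset subspace_span subset_trans)
  have "K \<subseteq> span (Q \<union> R)"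
  proof
    fix x assume x: "x \<in> K"
    have "r x \<in> span (Q \<union> R)"
      using R(2) x span_mono[of R "Q \<union> R"] span_base[of "r x" "r ` K"] by auto
    moreover have "(\<Sum>f\<in>Q. inner x f *\<^sub>R f) \<in> span (Q \<union> R)"
      by (intro span_sum span_scale span_base) auto
    ultimately have "r x + (\<Sum>f\<in>Q. inner x f *\<^sub>R f) \<in> span (Q \<union> R)" by (rule span_add)
    then show "x \<in> span (Q \<union> R)" by (simp add: r_def)
  qed
  then have span: "span K = span (Q \<union> R)"
    using Qs Rs by (simp add: span_eq)
  have "card K = card (Q \<union> R)"
    using dim_eq_card[OF span orthonormal_independent[OF K(2,3)]]
      dim_eq_card[OF refl orthonormal_independent[OF orth n1]] by simp
  also have "\<dots> = card Q + card R" using disj Q(1) R(1) by (simp add: card_Un_disjoint)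
  finally have c1: "card K = card Q + card R" .
  have c2: "card Q = card W"
    using dim_eq_card[OF Q(2) orthonormal_independent[OF Q(3,4)]] dim_eq_card[OF refl W(2)] by simp
  have "(\<Sum>x\<in>K. (norm (P x))\<^sup>2) \<le> real (card K) - real (card W) + (\<Sum>f\<in>Q. (norm (P f))\<^sup>2)"
    if P: "linear P" "\<And>x. norm (P x) \<le> norm x" for P :: "'a \<Rightarrow> 'b"
  proof -
    have "(\<Sum>x\<in>K. (norm (P x))\<^sup>2) = (\<Sum>f\<in>Q \<union> R. (norm (P f))\<^sup>2)"
      by (rule trace_basis_independent) (use K Q R orth n1 span P in auto)
    also have "\<dots> = (\<Sum>f\<in>Q. (norm (P f))\<^sup>2) + (\<Sum>f\<in>R. (norm (P f))\<^sup>2)"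
      using disj Q(1) R(1) by (simp add: sum.union_disjoint)
    also have "(\<Sum>f\<in>R. (norm (P f))\<^sup>2) \<le> (\<Sum>f\<in>R. 1)"
    proof (rule sum_mono)
      fix f assume "f \<in> R"
      then have "norm (P f) \<le> 1" using P(2)[of f] R(4) by simp
      then show "(norm (P f))\<^sup>2 \<le> 1" by (simp add: power_le_one)
    qed
    finally show ?thesis using c1 c2 by simp
  qed
  then show ?thesis using that Q(1,2) span_superset[of Q] by blast
qed

section \<open>Unique continuation and peak polynomials\<close>

lemma pairwise_orthogonal_ket: "pairwise orthogonal (ket ` S)"
  by (auto simp: pairwise_def orthogonal_def inner_ket)

lemma inj_ket: "inj ket"
proof (rule injI)
  fix m n :: 'a assume "ket m = ket n"
  then have "coord (ket m) m = coord (ket n) m" by simp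
  then show "m = n" by (simp split: if_splits)
qed

lemma coord_span_ket:
  assumes "u \<in> span (ket ` S)" "n \<notin> S"
  shows "coord u n = 0"
  using assms(1) by (induction rule: span_induct_alt) (use assms(2) in auto)

lemma finite_support_in_span:
  assumes "finite S" "\<And>n. n \<notin> S \<Longrightarrow> coord u n = 0" "\<And>n. Im (coord u n) = 0"
  shows "u \<in> span (ket ` S)"
proof -
  have "u = (\<Sum>n\<in>S. Re (coord u n) *\<^sub>R ket n)"
    by (rule ell2_eqI) (use assms in \<open>auto simp: of_bool_def if_distrib complex_eq_iff cong: if_cong\<close>)
  also have "\<dots> \<in> span (ket ` S)" by (intro span_sum span_scale span_base) auto
  finally show ?thesis .
qed

text \<open>Unique continuation: the topmost site of the support in a coordinate direction is
  the only one that reaches the layer above it.\<close>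

lemma hop_eigen_finite_support:
  fixes v :: "int ^ 'n \<Rightarrow> real"
  assumes v: "\<And>n. \<bar>v n\<bar> \<le> C" and fin: "finite S" "\<And>n. n \<notin> S \<Longrightarrow> coord u n = 0"
    and eig: "hop neighbours v u = E *\<^sub>R u"
  shows "u = 0"
proof (rule ccontr)
  assume "u \<noteq> 0"
  define T where "T = {n. coord u n \<noteq> 0}"
  have T: "finite T" "T \<noteq> {}"
    using finite_subset[OF _ fin(1), of T] fin(2) \<open>u \<noteq> 0\<close> by (auto simp: T_def intro: ell2_eqI)
  \<comment> \<open>Index types are nonempty, so some coordinate direction exists.\<close>
  obtain i0 :: 'n where True by blast
  define M where "M = Max ((\<lambda>n. n $ i0) ` T)"
  obtain k where k: "k \<in> T" "k $ i0 = M"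
  proof -
    have "M \<in> (\<lambda>n. n $ i0) ` T" unfolding M_def using T by (intro Max_in) auto
    then show ?thesis using that by auto
  qed
  have top: "coord u n = 0" if "n $ i0 > M" for n
  proof (rule ccontr)
    assume "coord u n \<noteq> 0"
    then have "n $ i0 \<le> M" unfolding M_def using T by (intro Max_ge) (auto simp: T_def)
    then show False using that by simp
  qed
  define p where "p = k + axis i0 1"
  have pM: "p $ i0 = M + 1" using k by (simp add: p_def axis_def)
  have "coord u (p + j) = (if j = axis i0 (- 1) then coord u k else 0)" if "j \<in> neighbours" for j
  proof (cases "j = axis i0 (- 1)")
    case True
    have "p + j = k" unfolding p_def True by (simp add: vec_eq_iff axis_def)
    then show ?thesis using True by simp
  next
    case False
    then have "j $ i0 \<ge> 0" using that by (auto simp: neighbours_eq axis_def)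
    then show ?thesis using False pM by (simp add: top)
  qed
  then have "(\<Sum>j\<in>neighbours. coord u (p + j)) = (\<Sum>j\<in>neighbours. if j = axis i0 (- 1) then coord u k else 0)"
    by (intro sum.cong) auto
  also have "\<dots> = coord u k" by (auto simp: neighbours_eq)
  finally have "coord (hop neighbours v u) p = coord u k"
    using pM by (simp add: coord_hop[OF v] top)
  moreover have "coord (hop neighbours v u) p = 0" unfolding eig using pM by (simp add: top)
  ultimately show False using k(1) by (simp add: T_def)
qed

text \<open>As (1 - y)^i decreases in \<open>i\<close>, the left side is at most a geometric sum
  with value 1 - (1 - y)^(n + 1).\<close>

lemma mult_power_one_minus_le:
  fixes y :: real
  assumes "0 \<le> y" "y \<le> 1"
  shows "real (n + 1) * (y * (1 - y) ^ n) \<le> 1"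
proof -
  have "real (n + 1) * (y * (1 - y) ^ n) = (\<Sum>i\<le>n. y * (1 - y) ^ n)" by simp
  also have "\<dots> \<le> (\<Sum>i\<le>n. y * (1 - y) ^ i)"
    using assms by (intro sum_mono mult_left_mono power_decreasing) auto
  also have "\<dots> = 1 - (1 - y) ^ Suc n"
    by (induction n) (simp_all add: algebra_simps)
  also have "\<dots> \<le> 1" using assms by simp
  finally show ?thesis .
qed

text \<open>The value at \<open>E\<close> is 1. For s = 1 / (4 B^2) and |E| <= B the values on
  [-B, B] lie in [0, 1], and at every other point of that interval they tend to 0 as
  \<open>k\<close> grows.\<close>

definition peak :: "real \<Rightarrow> real \<Rightarrow> nat \<Rightarrow> real poly" where
  "peak s E k = ([:1:] - smult s ([:-E, 1:] * [:-E, 1:])) ^ k"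

lemma poly_peak: "poly (peak s E k) t = (1 - s * (t - E)\<^sup>2) ^ k"
  by (simp add: peak_def power2_eq_square algebra_simps)

lemma (in symop) peak_bounds:
  assumes "\<bar>E\<bar> \<le> B" "t \<in> {-B..B}"
  shows "0 \<le> 1 / (4 * B\<^sup>2) * (t - E)\<^sup>2" "1 / (4 * B\<^sup>2) * (t - E)\<^sup>2 \<le> 1"
proof -
  have "\<bar>t - E\<bar> \<le> 2 * B" using assms by auto
  then have "\<bar>t - E\<bar>\<^sup>2 \<le> (2 * B)\<^sup>2" by (rule power_mono) simp
  then have "(t - E)\<^sup>2 \<le> (2 * B)\<^sup>2" by simp
  then show "1 / (4 * B\<^sup>2) * (t - E)\<^sup>2 \<le> 1" using B_pos by (simp add: power_mult_distrib)
qed simp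

text \<open>In terms of y = s (t - E)^2, the square of the peak polynomial times t - E is 4 B^2 y (1
  - y)^(2 k), at most 4 B^2 / (2 k + 1). Peak polynomials are therefore small on the range of A -
  E.\<close>

lemma (in symop) peak_resolvent_le:
  assumes "\<bar>E\<bar> \<le> B"
  shows "(norm (opoly A (peak (1 / (4 * B\<^sup>2)) E k) (A g - E *\<^sub>R g)))\<^sup>2 \<le> 4 * B\<^sup>2 / real (2 * k + 1) * (norm g)\<^sup>2"
proof -
  define s where "s = 1 / (4 * B\<^sup>2)"
  define r where "r = peak s E k * [:-E, 1:]"
  have eq: "opoly A (peak s E k) (A g - E *\<^sub>R g) = opoly A r g"
    by (simp add: r_def opoly_mult[OF lin] opoly_linear_factor[OF lin] del: mult_pCons_right)
  have "\<bar>poly r t\<bar> \<le> sqrt (4 * B\<^sup>2 / real (2 * k + 1))" if t: "t \<in> {-B..B}" for t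
  proof (rule real_le_rsqrt)
    define y where "y = s * (t - E)\<^sup>2"
    have y: "0 \<le> y" "y \<le> 1" using peak_bounds[OF assms t] by (simp_all add: y_def s_def)
    have "poly r t = (1 - y) ^ k * (t - E)"
      by (simp add: r_def poly_peak y_def algebra_simps)
    moreover have "(t - E)\<^sup>2 = 4 * B\<^sup>2 * y" using B_pos by (simp add: y_def s_def)
    ultimately have "\<bar>poly r t\<bar>\<^sup>2 = 4 * B\<^sup>2 * (y * (1 - y) ^ (2 * k))"
      by (simp add: power_mult_distrib power_mult[symmetric] mult_ac)
    also have "\<dots> \<le> 4 * B\<^sup>2 * (1 / real (2 * k + 1))"
      using mult_power_one_minus_le[OF y, of "2 * k"] by (intro mult_left_mono) (auto simp: field_simps)
    finally show "\<bar>poly r t\<bar>\<^sup>2 \<le> 4 * B\<^sup>2 / real (2 * k + 1)" by simp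
  qed
  from opoly_norm_le[OF this] have "(norm (opoly A r g))\<^sup>2 \<le> (sqrt (4 * B\<^sup>2 / real (2 * k + 1)) * norm g)\<^sup>2"
    by (intro power_mono) auto
  then show ?thesis by (simp add: eq[unfolded s_def] power_mult_distrib)
qed

lemma hop_translate:
  assumes "\<And>n. \<bar>v n\<bar> \<le> C" "\<And>n. v (n + j) = v n"
  shows "hop J v (translate j u) = translate j (hop J v u)"
  by (rule ell2_eqI) (simp add: coord_hop[OF assms(1)] assms(2) add_ac)

lemma translate_linear: "linear (translate j)"
  by (rule linearI; rule ell2_eqI) simp_all

lemma translate_ket: "translate (- j) (ket m) = ket (m + j)"
  by (rule ell2_eqI) (auto simp: of_bool_def algebra_simps)

text \<open>The translates of \<open>m\<close> by periods contribute (2 a + 1)^\<nu> equal terms to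
  a trace whose bound grows only like the surface a^(\<nu> - 1). The resulting \<open>q\<close> is a
  peak polynomial, with value 1 at \<open>E\<close>.\<close>

lemma periodic_no_atoms:
  fixes v :: "int ^ 'n \<Rightarrow> real"
  assumes v: "\<And>n. \<bar>v n\<bar> \<le> C" and L: "0 < L"
    and per: "\<And>n e. v (n + (\<chi> i. int L * e $ i)) = v n"
    and e: "0 < e"
    and E: "\<bar>E\<bar> \<le> real (card (neighbours :: (int ^ 'n) set)) + C + 1"
  obtains q where "(norm (opoly (hop neighbours v) q (ket m)))\<^sup>2 < e * (poly q E)\<^sup>2"
proof -
  define H where "H = hop neighbours v"
  define B where "B = real (card (neighbours :: (int ^ 'n) set)) + C + 1"
  interpret symop H B unfolding H_def B_def by (rule hop_symop[OF v]) simp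
  have E: "\<bar>E\<bar> \<le> B" using E by (simp add: B_def)
  define \<nu> where "\<nu> = CARD('n)"
  have nu: "\<nu> > 0" by (simp add: \<nu>_def)
  define m0 where "m0 = Suc (nat (Max (range (\<lambda>i. \<bar>m $ i\<bar>))))"
  have m0: "\<bar>m $ i\<bar> \<le> int m0" for i
  proof -
    have "\<bar>m $ i\<bar> \<le> Max (range (\<lambda>i. \<bar>m $ i\<bar>))" by (rule Max_ge) auto
    then have "\<bar>m $ i\<bar> \<le> int (nat (Max (range (\<lambda>i. \<bar>m $ i\<bar>))))" by linarith
    then show ?thesis by (simp add: m0_def)
  qed
  \<comment> \<open>Chosen so that the side 2 M + 3 of the larger cube is at most D (2 a +
    1).\<close>
  define D where "D = 2 * m0 + L + 1"
  obtain a where "real (2 * \<nu> * D ^ \<nu> + 1) / e < real a" using reals_Archimedean2 by blast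
  then have a: "real (2 * \<nu> * D ^ \<nu> + 1) < e * real (2 * a + 1)"
  proof -
    assume "real (2 * \<nu> * D ^ \<nu> + 1) / e < real a"
    then have "real (2 * \<nu> * D ^ \<nu> + 1) < e * real a" using e by (simp add: pos_divide_less_eq mult.commute)
    also have "\<dots> \<le> e * real (2 * a + 1)" using e by (intro mult_left_mono) auto
    finally show ?thesis .
  qed
  \<comment> \<open>The cube of radius \<open>Suc M\<close> has to hold the translates of
    \<open>m\<close> by up to \<open>a\<close> periods in each direction. The \<open>Suc\<close> in
    \<open>m0\<close> makes the subtraction exact.\<close>
  define M where "M = m0 + L * a - 1"
  have SM': "Suc M = m0 + L * a" by (simp add: M_def m0_def)
  let ?K = "ket ` cube 0 (Suc M) :: (int ^ 'n) ell2 set"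
  let ?T = "\<lambda>u. H u - E *\<^sub>R u"
  let ?W = "?T ` ket ` cube 0 M"
  have linT: "linear ?T" by (intro linear_compose_sub lin linear_scale_self)
  have injT: "inj_on ?T (span (ket ` cube 0 M))"
  proof (rule linear_injective_on_subspace_0[THEN iffD2, OF linT subspace_span], intro ballI impI)
    fix u assume u: "u \<in> span (ket ` (cube 0 M :: (int ^ 'n) set))" "H u - E *\<^sub>R u = 0"
    show "u = 0"
      by (rule hop_eigen_finite_support[OF v, where S = "cube 0 M" and E = E]) (use u coord_span_ket in \<open>auto simp: H_def\<close>)
  qed
  have W: "finite ?W" "independent ?W" "?W \<subseteq> span ?K"
  proof -
    show "independent ?W"
    proof (rule linear_independent_injective_image[OF linT _ injT])
      show "independent (ket ` (cube 0 M :: (int ^ 'n) set))"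
        by (rule orthonormal_independent[OF pairwise_orthogonal_ket]) auto
    qed
    show "?W \<subseteq> span ?K"
    proof (clarify)
      fix n :: "int ^ 'n" assume n: "n \<in> cube 0 M"
      show "H (ket n) - E *\<^sub>R ket n \<in> span ?K"
      proof (rule finite_support_in_span)
        fix k :: "int ^ 'n" assume k: "k \<notin> cube 0 (Suc M)"
        then have "k \<noteq> n" using n cube_mono[of M "Suc M" 0] by auto
        moreover have "k + j \<noteq> n" if "j \<in> neighbours" for j
        proof
          assume "k + j = n"
          then have "k = n + (- j)" by auto
          moreover have "- j \<in> neighbours" using that by (simp add: neighbours_def)
          ultimately show False using cube_neighbour[OF n] k by blast
        qed
        ultimately show "coord (H (ket n) - E *\<^sub>R ket n) k = 0" by (simp add: H_def coord_hop[OF v])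
      qed (auto simp: H_def coord_hop[OF v])
    qed
  qed simp
  have cardW: "card ?W = card (cube 0 M :: (int ^ 'n) set)"
    using card_image[OF inj_on_subset[OF injT span_superset]] card_image[OF inj_on_subset[OF inj_ket subset_UNIV]] by simp
  define s where "s = 1 / (4 * B\<^sup>2)"
  have q1: "norm (opoly H (peak s E k) u) \<le> norm u" for k u
  proof -
    have "\<bar>poly (peak s E k) t\<bar> \<le> 1" if "t \<in> {-B..B}" for t
      using peak_bounds[OF E that] by (simp add: poly_peak s_def power_abs power_le_one)
    from opoly_norm_le[OF this] show ?thesis by simp
  qed
  have K: "finite ?K" "pairwise orthogonal ?K" "\<And>x. x \<in> ?K \<Longrightarrow> norm x = 1"
    by (auto simp: pairwise_orthogonal_ket)
  obtain Q where Q: "finite Q" "Q \<subseteq> span ?W" and tr: "\<And>P :: (int ^ 'n) ell2 \<Rightarrow> (int ^ 'n) ell2.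
      linear P \<Longrightarrow> (\<And>x. norm (P x) \<le> norm x) \<Longrightarrow>
      (\<Sum>x\<in>?K. (norm (P x))\<^sup>2) \<le> real (card ?K) - real (card ?W) + (\<Sum>f\<in>Q. (norm (P f))\<^sup>2)"
    using trace_le_codim[OF K W] by blast
  have "span ?W = ?T ` span (ket ` cube 0 M)" by (rule linear_span_image[OF linT])
  then have "\<forall>f\<in>Q. \<exists>g. f = ?T g" using Q(2) by blast
  then obtain g where g: "\<And>f. f \<in> Q \<Longrightarrow> f = ?T (g f)" by metis
  define G where "G = (\<Sum>f\<in>Q. (norm (g f))\<^sup>2)"
  \<comment> \<open>\<open>Q\<close> and the preimages \<open>g\<close> are fixed by now, so the
    exponent can be taken large enough to bring their whole contribution down to at most 1.\<close>
  obtain k where k: "4 * B\<^sup>2 * G < real k" using reals_Archimedean2 by blast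
  let ?P = "opoly H (peak s E k)"
  have "(\<Sum>f\<in>Q. (norm (?P f))\<^sup>2) \<le> (\<Sum>f\<in>Q. 4 * B\<^sup>2 / real (2 * k + 1) * (norm (g f))\<^sup>2)"
  proof (rule sum_mono)
    fix f assume f: "f \<in> Q"
    show "(norm (?P f))\<^sup>2 \<le> 4 * B\<^sup>2 / real (2 * k + 1) * (norm (g f))\<^sup>2"
      unfolding s_def by (subst g[OF f]) (rule peak_resolvent_le[OF E])
  qed
  also have "\<dots> = 4 * B\<^sup>2 * G / real (2 * k + 1)"
    by (simp add: G_def sum_distrib_left sum_divide_distrib)
  also have "\<dots> \<le> 1" using k by (simp add: divide_le_eq)
  finally have small: "(\<Sum>f\<in>Q. (norm (?P f))\<^sup>2) \<le> 1" .
  have cardK: "card ?K = card (cube 0 (Suc M) :: (int ^ 'n) set)"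
    by (rule card_image[OF inj_on_subset[OF inj_ket subset_UNIV]])
  have total: "(\<Sum>n\<in>cube 0 (Suc M). (norm (?P (ket n)))\<^sup>2) \<le> (2 * real M + 3) ^ \<nu> - (2 * real M + 1) ^ \<nu> + 1"
    using tr[of ?P, OF opoly_linear[OF lin] q1] small unfolding cardK cardW
    by (subst (asm) sum.reindex[OF inj_on_subset[OF inj_ket subset_UNIV]])
      (simp add: card_cube \<nu>_def algebra_simps)
  let ?f = "\<lambda>e :: int ^ 'n. m + (\<chi> i. int L * e $ i)"
  have injf: "inj_on ?f S" for S
    using L by (auto simp: inj_on_def vec_eq_iff)
  \<comment> \<open>Translations by periods commute with the operator, hence with its polynomials,
    and preserve norms.\<close>
  have shift: "norm (?P (ket (?f e))) = norm (?P (ket m))" for e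
  proof -
    define j where "j = - (\<chi> i. int L * e $ i)"
    have j: "j = (\<chi> i. int L * (- e) $ i)" by (simp add: j_def vec_eq_iff)
    have "ket (?f e) = translate j (ket m)" using translate_ket[of "- j" m] by (simp add: j_def)
    then have "?P (ket (?f e)) = translate j (?P (ket m))"
      using opoly_commute[OF lin translate_linear[of j], of "peak s E k" "ket m"]
        hop_translate[where v = v and C = C and j = j and J = neighbours, OF v] per[of _ "- e"] by (simp add: H_def j)
    then show ?thesis by simp
  qed
  have sub: "?f ` cube 0 a \<subseteq> cube 0 (Suc M)"
  proof clarify
    fix e :: "int ^ 'n" assume e: "e \<in> cube 0 a"
    show "?f e \<in> cube 0 (Suc M)"
      unfolding cube_def SM'
    proof (intro CollectI allI)
      fix i
      have "\<bar>int L * e $ i\<bar> \<le> int L * int a" using e by (simp add: cube_def abs_mult mult_left_mono)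
      then show "\<bar>?f e $ i - 0 $ i\<bar> \<le> int (m0 + L * a)" using m0[of i] by simp
    qed
  qed
  have "(2 * real a + 1) ^ \<nu> * (norm (?P (ket m)))\<^sup>2 = (\<Sum>n\<in>?f ` cube 0 a. (norm (?P (ket n)))\<^sup>2)"
    by (subst sum.reindex[OF injf]) (simp add: shift card_cube \<nu>_def add.commute)
  also have "\<dots> \<le> (\<Sum>n\<in>cube 0 (Suc M). (norm (?P (ket n)))\<^sup>2)"
    by (rule sum_mono2) (use sub in auto)
  also have "\<dots> \<le> (2 * real M + 3) ^ \<nu> - (2 * real M + 1) ^ \<nu> + 1" by (rule total)
  also have "\<dots> \<le> real \<nu> * 2 * (2 * real M + 3) ^ (\<nu> - 1) + 1"
    using power_diff_le[of "2 * real M + 1" "2 * real M + 3" \<nu>] by simp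
  also have "\<dots> \<le> real \<nu> * 2 * (real D * (2 * real a + 1)) ^ (\<nu> - 1) + 1"
  proof -
    have "2 * M + 3 \<le> D * (2 * a + 1)" using SM' by (simp add: D_def algebra_simps)
    from of_nat_mono[OF this, where ?'a = real] have "2 * real M + 3 \<le> real D * (2 * real a + 1)" by (simp add: algebra_simps)
    then show ?thesis by (intro add_mono mult_left_mono power_mono) auto
  qed
  also have "\<dots> \<le> (real \<nu> * 2 * real D ^ \<nu> + 1) * (2 * real a + 1) ^ (\<nu> - 1)"
  proof -
    have "real D ^ (\<nu> - 1) \<le> real D ^ \<nu>" by (intro power_increasing) (auto simp: D_def)
    then have "real \<nu> * 2 * (real D ^ (\<nu> - 1) * (2 * real a + 1) ^ (\<nu> - 1)) \<le> real \<nu> * 2 * (real D ^ \<nu> * (2 * real a + 1) ^ (\<nu> - 1))"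
      by (intro mult_left_mono mult_right_mono) auto
    moreover have "1 \<le> (2 * real a + 1) ^ (\<nu> - 1)" by (intro one_le_power) simp
    moreover have "(real \<nu> * 2 * real D ^ \<nu> + 1) * (2 * real a + 1) ^ (\<nu> - 1) =
      real \<nu> * 2 * (real D ^ \<nu> * (2 * real a + 1) ^ (\<nu> - 1)) + (2 * real a + 1) ^ (\<nu> - 1)"
      by (simp only: distrib_right mult.assoc mult_1)
    ultimately show ?thesis unfolding power_mult_distrib by linarith
  qed
  also have "\<dots> < (e * (2 * real a + 1)) * (2 * real a + 1) ^ (\<nu> - 1)"
    using a by (intro mult_strict_right_mono) (auto simp: mult_ac add_ac)
  also have "\<dots> = (2 * real a + 1) ^ \<nu> * e" using nu by (cases \<nu>) auto
  finally have "(norm (?P (ket m)))\<^sup>2 < e" by (simp add: mult_less_cancel_left)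
  then show ?thesis using that[of "peak s E k"] by (simp add: H_def poly_peak)
qed

section \<open>One-dimensional barriers\<close>

text \<open>The rows (p, q) and (r, s) of the transfer matrix that carries the pair u n, u (n + 1)
  to the pair \<open>length cs\<close> sites further on. The head of the list is the site met first,
  so its matrix, with rows (0, 1) and (-1, z - c), multiplies from the right.\<close>

fun tmat :: "complex \<Rightarrow> real list \<Rightarrow> complex \<times> complex \<times> complex \<times> complex" where
  "tmat z [] = (1, 0, 0, 1)"
| "tmat z (c # cs) = (case tmat z cs of (p, q, r, s) \<Rightarrow>
     (- q, p + q * (z - of_real c), - s, r + s * (z - of_real c)))"

definition ttrace :: "complex \<Rightarrow> real list \<Rightarrow> complex" where
  "ttrace z cs = (case tmat z cs of (p, q, r, s) \<Rightarrow> p + s)"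

lemma tmat_det:
  assumes "tmat z cs = (p, q, r, s)"
  shows "p * s - q * r = 1"
  using assms
proof (induction cs arbitrary: p q r s)
  case (Cons c cs)
  obtain p' q' r' s' where t: "tmat z cs = (p', q', r', s')" by (metis prod_cases4)
  have "p' * s' - q' * r' = 1" by (rule Cons.IH[OF t])
  moreover have e: "p = - q'" "q = p' + q' * (z - of_real c)" "r = - s'" "s = r' + s' * (z - of_real c)"
    using Cons.prems t by auto
  have "p * s - q * r = p' * s' - q' * r'" unfolding e by (simp add: algebra_simps)
  ultimately show ?case by simp
qed auto

lemma tmat_step:
  assumes "tmat z cs = (p, q, r, s)"
    and "\<And>i. i < length cs \<Longrightarrow> u (n + i + 2) = (z - of_real (cs ! i)) * u (n + i + 1) - u (n + i)"
  shows "u (n + length cs) = p * u n + q * u (n + 1)" "u (n + length cs + 1) = r * u n + s * u (n + 1)"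
  using assms
proof (induction cs arbitrary: n p q r s)
  case (Cons c cs)
  {
    case 1
    obtain p' q' r' s' where t: "tmat z cs = (p', q', r', s')" by (metis prod_cases4)
    have "u (Suc n + i + 2) = (z - of_real (cs ! i)) * u (Suc n + i + 1) - u (Suc n + i)" if "i < length cs" for i
      using 1(2)[of "Suc i"] that by simp
    from Cons.IH[OF t this] have "u (Suc n + length cs) = p' * u (Suc n) + q' * u (Suc n + 1)"
      "u (Suc n + length cs + 1) = r' * u (Suc n) + s' * u (Suc n + 1)" by auto
    moreover have u2: "u (n + 2) = (z - of_real c) * u (n + 1) - u n" using 1(2)[of 0] by simp
    moreover have e: "p = - q'" "q = p' + q' * (z - of_real c)" "r = - s'" "s = r' + s' * (z - of_real c)"
      using 1(1) t by auto
    have "p * u n + q * u (n + 1) = p' * u (Suc n) + q' * u (n + 2)"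
      "r * u n + s * u (n + 1) = r' * u (Suc n) + s' * u (n + 2)"
      unfolding e u2 by (simp_all add: algebra_simps)
    ultimately show ?case by simp
  next
    case 2
    obtain p' q' r' s' where t: "tmat z cs = (p', q', r', s')" by (metis prod_cases4)
    have "u (Suc n + i + 2) = (z - of_real (cs ! i)) * u (Suc n + i + 1) - u (Suc n + i)" if "i < length cs" for i
      using 2(2)[of "Suc i"] that by simp
    from Cons.IH[OF t this] have "u (Suc n + length cs) = p' * u (Suc n) + q' * u (Suc n + 1)"
      "u (Suc n + length cs + 1) = r' * u (Suc n) + s' * u (Suc n + 1)" by auto
    moreover have u2: "u (n + 2) = (z - of_real c) * u (n + 1) - u n" using 2(2)[of 0] by simp
    moreover have e: "p = - q'" "q = p' + q' * (z - of_real c)" "r = - s'" "s = r' + s' * (z - of_real c)"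
      using 2(1) t by auto
    have "p * u n + q * u (n + 1) = p' * u (Suc n) + q' * u (n + 2)"
      "r * u n + s * u (n + 1) = r' * u (Suc n) + s' * u (n + 2)"
      unfolding e u2 by (simp_all add: algebra_simps)
    ultimately show ?case by simp
  }
qed auto

text \<open>Cayley-Hamilton for the transfer matrix over one period, whose determinant is 1.\<close>

lemma period_recurrence:
  assumes "\<And>i. i < 2 * length cs \<Longrightarrow>
    u (n + i + 2) = (z - of_real (cs ! (i mod length cs))) * u (n + i + 1) - u (n + i)"
  shows "u (n + 2 * length cs) + u n = ttrace z cs * u (n + length cs)"
proof -
  obtain p q r s where t: "tmat z cs = (p, q, r, s)" by (metis prod_cases4)
  have 1: "u (n + i + 2) = (z - of_real (cs ! i)) * u (n + i + 1) - u (n + i)" if "i < length cs" for i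
    using assms[of i] that by simp
  have 2: "u (n + length cs + i + 2) = (z - of_real (cs ! i)) * u (n + length cs + i + 1) - u (n + length cs + i)"
    if "i < length cs" for i
    using assms[of "length cs + i"] that by (simp add: add.assoc)
  note a = tmat_step[OF t 1] and b = tmat_step[OF t 2]
  have "u (n + 2 * length cs) = p * u (n + length cs) + q * u (n + length cs + 1)"
    using b(1) by (simp add: mult_2 add.assoc)
  then have "u (n + 2 * length cs) + u n = p * (p * u n + q * u (n + 1)) + q * (r * u n + s * u (n + 1)) + u n"
    using a by simp
  also have "\<dots> = (p + s) * (p * u n + q * u (n + 1)) - (p * s - q * r) * u n + u n"
    by (simp add: algebra_simps)
  also have "\<dots> = ttrace z cs * u (n + length cs)"
    using a(1) tmat_det[OF t] by (simp add: ttrace_def t)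
  finally show ?thesis .
qed

text \<open>By the recurrence, a common bound on the two neighbours of a term bounds the term by 2 /
  (2 + \<kappa>) times as much. The exponent \<open>i\<close> counts the steps from both ends of the
  index range.\<close>

lemma hyperbolic_decay:
  fixes a :: "nat \<Rightarrow> complex"
  assumes rec: "\<And>j. j + 2 \<le> N \<Longrightarrow> a (j + 2) + a j = t * a (j + 1)"
    and bnd: "\<And>j. j \<le> N \<Longrightarrow> cmod (a j) \<le> A" and t: "2 + \<kappa> \<le> cmod t" and \<kappa>: "0 < \<kappa>"
    and j: "i \<le> j" "j + i \<le> N"
  shows "cmod (a j) \<le> A * (2 / (2 + \<kappa>)) ^ i"
  using j
proof (induction i arbitrary: j)
  case 0
  then show ?case using bnd by simp
next
  case (Suc i)
  obtain k where k: "j = Suc k" using Suc.prems by (cases j) auto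
  have "a (k + 2) + a k = t * a (k + 1)" by (rule rec) (use Suc.prems k in auto)
  then have "cmod t * cmod (a j) = cmod (a (k + 2) + a k)" by (simp add: k norm_mult)
  also have "\<dots> \<le> cmod (a (k + 2)) + cmod (a k)" by (rule norm_triangle_ineq)
  also have "\<dots> \<le> A * (2 / (2 + \<kappa>)) ^ i + A * (2 / (2 + \<kappa>)) ^ i"
    using Suc.prems k by (intro add_mono Suc.IH) auto
  finally have "(2 + \<kappa>) * cmod (a j) \<le> 2 * (A * (2 / (2 + \<kappa>)) ^ i)"
    using mult_right_mono[OF t norm_ge_zero, of "a j"] by linarith
  then have "cmod (a j) \<le> 2 * (A * (2 / (2 + \<kappa>)) ^ i) / (2 + \<kappa>)"
    using \<kappa> by (simp add: pos_le_divide_eq mult.commute)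
  then show ?case by (simp add: mult_ac)
qed

text \<open>For a constant block at energy c + 2 cos k the entries are, up to sign, Chebyshev
  polynomials of the second kind, sin (n k) / sin k.\<close>

lemma tmat_replicate:
  assumes "sin k \<noteq> 0"
  defines "S \<equiv> \<lambda>x. complex_of_real (sin (x * k) / sin k)"
  shows "tmat (of_real (c + 2 * cos k)) (replicate n c) =
    (- S (real n - 1), S (real n), - S (real n), S (real n + 1))"
proof (induction n)
  case 0
  show ?case using assms(1) by (simp add: S_def)
next
  case (Suc n)
  have rec: "2 * of_real (cos k) * S x = S (x + 1) + S (x - 1)" for x
  proof -
    have "2 * cos k * sin (x * k) = sin ((x + 1) * k) + sin ((x - 1) * k)"
      by (simp add: distrib_right left_diff_distrib sin_add sin_diff)
    then have "2 * cos k * (sin (x * k) / sin k) = sin ((x + 1) * k) / sin k + sin ((x - 1) * k) / sin k"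
      by (simp add: add_divide_distrib[symmetric])
    then show ?thesis unfolding S_def by (metis of_real_add of_real_mult of_real_numeral)
  qed
  show ?case
    using Suc rec[of "real n"] rec[of "real n + 1"] by (simp add: algebra_simps)
qed

text \<open>Changing one site of a constant block by \<open>d\<close> adds \<open>- d sin (N k) / sin k\<close> to the trace
  \<open>2 cos (N k)\<close>; just below \<open>N k = \<pi> j\<close> this exceeds 2 in modulus.\<close>

lemma hyperbolic_word:
  fixes \<alpha> \<beta> x :: real
  assumes "\<alpha> < \<beta>"
  obtains cs where "cs \<noteq> []" "set cs \<subseteq> {\<alpha>..\<beta>}" "2 < cmod (ttrace (of_real x) cs)"
proof (cases "\<exists>c\<in>{\<alpha>..\<beta>}. 2 < \<bar>x - c\<bar>")
  case True
  \<comment> \<open>Outside the band of some constant potential a single letter suffices: its trace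
    is x - c.\<close>
  then obtain c where c: "c \<in> {\<alpha>..\<beta>}" "2 < \<bar>x - c\<bar>" by blast
  have "cmod (ttrace (of_real x) [c]) = \<bar>x - c\<bar>"
    by (simp add: ttrace_def flip: of_real_diff)
  with c show ?thesis using that[of "[c]"] by simp
next
  case False
  \<comment> \<open>Half the interval: \<open>c\<close> will lie in the lower half, so that c and c
    + d are both admissible letters.\<close>
  define d where "d = (\<beta> - \<alpha>) / 2"
  have d: "0 < d" using assms by (simp add: d_def)
  have b: "\<bar>x - \<alpha>\<bar> \<le> 2" "\<bar>x - (\<alpha> + d)\<bar> \<le> 2"
  proof -
    have "\<alpha> + d \<in> {\<alpha>..\<beta>}" using assms by (auto simp: d_def field_simps)
    then show "\<bar>x - \<alpha>\<bar> \<le> 2" "\<bar>x - (\<alpha> + d)\<bar> \<le> 2" using False assms by (auto simp: not_less)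
  qed
  define k1 where "k1 = arccos ((x - \<alpha>) / 2)"
  define k2 where "k2 = arccos ((x - (\<alpha> + d)) / 2)"
  have k1: "0 \<le> k1" "k1 \<le> pi" "cos k1 = (x - \<alpha>) / 2" and k2: "0 \<le> k2" "k2 \<le> pi" "cos k2 = (x - (\<alpha> + d)) / 2"
    using b unfolding k1_def k2_def by (auto simp: arccos_lbound arccos_ubound abs_le_iff)
  have k12: "k1 < k2" using k1 k2 d cos_mono_less_eq[of k2 k1] by simp
  \<comment> \<open>Small enough for the first-order gain d sin \<tau> to exceed the second-order
    loss 2 - 2 cos \<tau>.\<close>
  define \<tau> where "\<tau> = min 1 (d / 4)"
  have \<tau>: "0 < \<tau>" "\<tau> \<le> 1" "\<tau> \<le> d / 4" using d by (auto simp: \<tau>_def)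
  obtain N where N: "pi / (k2 - k1) < real N" using reals_Archimedean2 by blast
  have "0 < pi / (k2 - k1)" using k12 by simp
  then have N0: "0 < real N" using N by linarith
  have Npi: "pi < real N * k2 - real N * k1" using N k12 by (simp add: field_simps)
  \<comment> \<open>The least integer with N k1 + \<tau> < j \<pi>. Since the range from N k1 to N
    k2 is longer than \<pi>, the momentum (j \<pi> - \<tau>) / N falls strictly between
    \<open>k1\<close> and \<open>k2\<close>.\<close>
  define j where "j = nat (\<lfloor>(real N * k1 + \<tau>) / pi\<rfloor> + 1)"
  have "0 \<le> \<lfloor>(real N * k1 + \<tau>) / pi\<rfloor>" using N0 k1 \<tau> by simp
  then have rj: "real j = of_int \<lfloor>(real N * k1 + \<tau>) / pi\<rfloor> + 1" by (simp add: j_def)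
  have j1: "real N * k1 + \<tau> < real j * pi"
  proof -
    have "(real N * k1 + \<tau>) / pi < real j" unfolding rj by linarith
    then show ?thesis by (simp add: divide_less_eq)
  qed
  have j2: "real j * pi \<le> real N * k1 + \<tau> + pi"
  proof -
    have "real j - 1 \<le> (real N * k1 + \<tau>) / pi" unfolding rj by linarith
    then have "(real j - 1) * pi \<le> real N * k1 + \<tau>" by (simp add: le_divide_eq)
    then show ?thesis by (simp add: algebra_simps)
  qed
  define k where "k = (real j * pi - \<tau>) / real N"
  have k: "k1 < k" "k < k2" using j1 j2 Npi N0 by (auto simp: k_def field_simps)
  have k0: "0 < k" "k < pi" using k k1 k2 by auto
  have s0: "0 < sin k" using k0 by (rule sin_gt_zero)
  define c where "c = x - 2 * cos k"
  have "cos k < cos k1" "cos k2 < cos k" using k k1 k2 by (auto intro!: cos_monotone_0_pi)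
  then have c: "\<alpha> \<le> c" "c \<le> \<alpha> + d" using k1(3) k2(3) by (auto simp: c_def)
  obtain n where n: "N = Suc n" using N0 by (cases N) auto
  define cs where "cs = (c + d) # replicate n c"
  have Nk: "real N * k = real j * pi - \<tau>" using N0 by (simp add: k_def)
  have "ttrace (of_real x) cs = of_real (2 * cos (real N * k) - d * (sin (real N * k) / sin k))"
  proof -
    define S where "S y = sin (y * k) / sin k" for y
    have x: "complex_of_real x = of_real (c + 2 * cos k)" by (simp add: c_def)
    have "ttrace (of_real x) cs =
      of_real (- S (real n) - S (real n) + S (real n + 1) * (x - (c + d)))"
      using tmat_replicate[of k c n] s0 unfolding cs_def ttrace_def x
      by (simp add: S_def c_def)
    also have "- S (real n) - S (real n) + S (real n + 1) * (x - (c + d)) =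
      2 * (cos k * S (real N) - S (real N - 1)) - d * S (real N)"
      by (simp add: n c_def algebra_simps)
    also have "cos k * S (real N) - S (real N - 1) = cos (real N * k)"
      using s0 by (simp add: S_def left_diff_distrib sin_diff field_simps)
    finally show ?thesis by (simp add: S_def)
  qed
  also have "cos (real N * k) = (-1) ^ j * cos \<tau>" unfolding Nk by (simp add: cos_diff)
  also have "sin (real N * k) = - ((-1) ^ j * sin \<tau>)" unfolding Nk by (simp add: sin_diff)
  also have "2 * ((-1) ^ j * cos \<tau>) - d * (- ((-1) ^ j * sin \<tau>) / sin k) = (-1) ^ j * (2 * cos \<tau> + d * (sin \<tau> / sin k))"
    by (simp add: algebra_simps)
  finally have "cmod (ttrace (of_real x) cs) = \<bar>2 * cos \<tau> + d * (sin \<tau> / sin k)\<bar>"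
    by (simp only: norm_of_real abs_mult power_abs abs_minus_cancel abs_one power_one mult_1)
  also have "\<dots> > 2"
  proof -
    define h where "h = \<tau> / 2"
    have h: "0 < h" "h \<le> 1 / 2" "h \<le> d / 8" using \<tau> by (auto simp: h_def)
    have "pi / 3 > 1 / 2" using pi_gt3 by simp
    then have "cos (pi / 3) \<le> cos h" using h by (intro cos_monotone_0_pi_le) auto
    then have ch: "1 / 2 \<le> cos h" by (simp add: cos_60)
    have sh: "0 < sin h" "sin h \<le> h" using h sin_gt_zero[of h] pi_gt3 by (auto intro: sin_x_le_x)
    have t: "cos \<tau> = 1 - 2 * (sin h)\<^sup>2" "sin \<tau> = 2 * sin h * cos h"
      using cos_double_sin[of h] sin_double[of h] by (simp_all add: h_def)
    have st: "0 \<le> sin \<tau>" unfolding t using sh ch by simp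
    have "sin \<tau> \<le> sin \<tau> / sin k"
      using s0 st sin_le_one[of k] by (simp add: le_divide_eq mult_left_le)
    then have "d * sin \<tau> \<le> d * (sin \<tau> / sin k)" using d by (intro mult_left_mono) auto
    moreover have "4 * (sin h)\<^sup>2 < d * sin \<tau>"
    proof -
      have "2 * sin h < d * cos h" 
      proof -
        have "2 * sin h \<le> d / 4" using sh h by simp
        also have "\<dots> < d * (1 / 2)" using d by simp
        also have "\<dots> \<le> d * cos h" using d ch by (intro mult_left_mono) auto
        finally show ?thesis .
      qed
      then have "2 * sin h * (2 * sin h) < 2 * sin h * (d * cos h)" using sh by simp
      then show ?thesis by (simp add: t power2_eq_square mult_ac)
    qed
    ultimately have "4 * (sin h)\<^sup>2 < d * (sin \<tau> / sin k)" by (metis less_le_trans)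
    then have "2 < 2 * cos \<tau> + d * (sin \<tau> / sin k)" by (simp add: t(1))
    then show ?thesis by linarith
  qed
  finally have "2 < cmod (ttrace (of_real x) cs)" .
  moreover have "set cs \<subseteq> {\<alpha>..\<beta>}" using c d by (auto simp: cs_def d_def field_simps)
  ultimately show ?thesis using that[of cs] by (simp add: cs_def)
qed

lemma continuous_tmat:
  "continuous_on UNIV (\<lambda>z. fst (tmat z cs)) \<and> continuous_on UNIV (\<lambda>z. fst (snd (tmat z cs))) \<and>
   continuous_on UNIV (\<lambda>z. fst (snd (snd (tmat z cs)))) \<and> continuous_on UNIV (\<lambda>z. snd (snd (snd (tmat z cs))))"
  by (induction cs) (auto simp: case_prod_beta intro!: continuous_intros)

lemma continuous_ttrace: "continuous_on UNIV (\<lambda>z. ttrace z cs)"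
  using continuous_tmat[of cs] unfolding ttrace_def case_prod_beta by (auto intro!: continuous_intros)

text \<open>Continuity of the trace gives each word a disc of complex energies, and compactness of
  [-X, X] leaves finitely many words. The cover uses half of each radius; the other half is left for
  the imaginary part.\<close>

lemma hyperbolic_words_uniform:
  fixes \<alpha> \<beta> X :: real
  assumes "\<alpha> < \<beta>"
  obtains Ws \<kappa> \<rho> where "0 < \<kappa>" "0 < \<rho>"
    "\<And>cs. cs \<in> set Ws \<Longrightarrow> cs \<noteq> [] \<and> set cs \<subseteq> {\<alpha>..\<beta>}"
    "\<And>x y. \<bar>x\<bar> \<le> X \<Longrightarrow> 0 \<le> y \<Longrightarrow> y \<le> \<rho> \<Longrightarrow> \<exists>cs\<in>set Ws. 2 + \<kappa> \<le> cmod (ttrace (Complex x y) cs)"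
proof -
  have "\<exists>cs \<kappa> \<rho>. cs \<noteq> [] \<and> set cs \<subseteq> {\<alpha>..\<beta>} \<and> 0 < \<kappa> \<and> 0 < \<rho> \<and>
      (\<forall>z. dist z (complex_of_real x) < \<rho> \<longrightarrow> 2 + \<kappa> \<le> cmod (ttrace z cs))" for x :: real
  proof -
    obtain cs where cs: "cs \<noteq> []" "set cs \<subseteq> {\<alpha>..\<beta>}" "2 < cmod (ttrace (of_real x) cs)"
      using hyperbolic_word[OF assms] by blast
    define \<kappa> where "\<kappa> = (cmod (ttrace (of_real x) cs) - 2) / 2"
    have \<kappa>: "0 < \<kappa>" "2 + \<kappa> < cmod (ttrace (of_real x) cs)" using cs(3) by (auto simp: \<kappa>_def field_simps)
    have "isCont (\<lambda>z. ttrace z cs) (of_real x)"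
      using continuous_ttrace[of cs] continuous_on_eq_continuous_at[OF open_UNIV] by blast
    then have "(\<lambda>z. cmod (ttrace z cs)) \<midarrow>of_real x\<rightarrow> cmod (ttrace (of_real x) cs)"
      unfolding isCont_def by (rule tendsto_norm)
    from order_tendstoD(1)[OF this \<kappa>(2)] obtain \<rho> where \<rho>: "0 < \<rho>"
      "\<And>z. z \<noteq> of_real x \<Longrightarrow> dist z (of_real x) < \<rho> \<Longrightarrow> 2 + \<kappa> < cmod (ttrace z cs)"
      unfolding eventually_at by auto
    have "2 + \<kappa> \<le> cmod (ttrace z cs)" if "dist z (of_real x) < \<rho>" for z
      using \<rho>(2)[OF _ that] \<kappa>(2) by (cases "z = of_real x") auto
    then show ?thesis using cs \<kappa> \<rho> by blast
  qed
  then obtain cs \<kappa> \<rho> where cs: "\<And>x. cs x \<noteq> [] \<and> set (cs x) \<subseteq> {\<alpha>..\<beta>}" and \<kappa>: "\<And>x::real. 0 < \<kappa> x" and \<rho>: "\<And>x. 0 < \<rho> x"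
    and hyp: "\<And>x z. dist z (complex_of_real x) < \<rho> x \<Longrightarrow> 2 + \<kappa> x \<le> cmod (ttrace z (cs x))"
    by metis
  have "compact {-X..X}" by simp
  then obtain I where I: "I \<subseteq> {-X..X}" "finite I" "{-X..X} \<subseteq> (\<Union>x\<in>I. ball x (\<rho> x / 2))"
    by (rule compactE_image[of _ "{-X..X}" "\<lambda>x. ball x (\<rho> x / 2)"]) (use \<rho> in force)+
  obtain Is where Is: "set Is = I" using finite_list[OF I(2)] by blast
  define k0 where "k0 = Min (insert 1 (\<kappa> ` I))"
  define r0 where "r0 = Min (insert 1 ((\<lambda>x. \<rho> x / 2) ` I)) / 2"
  have k0: "0 < k0" "\<And>x. x \<in> I \<Longrightarrow> k0 \<le> \<kappa> x" using I(2) \<kappa> by (auto simp: k0_def)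
  have "0 < Min (insert 1 ((\<lambda>x. \<rho> x / 2) ` I))" using I(2) \<rho> by auto
  moreover have "\<And>x. x \<in> I \<Longrightarrow> Min (insert 1 ((\<lambda>x. \<rho> x / 2) ` I)) \<le> \<rho> x / 2" using I(2) by (intro Min_le) auto
  ultimately have r0: "0 < r0" "\<And>x. x \<in> I \<Longrightarrow> r0 < \<rho> x / 2" unfolding r0_def by fastforce+
  show ?thesis
  proof (rule that[of k0 r0 "map cs Is"])
    fix x y :: real assume xy: "\<bar>x\<bar> \<le> X" "0 \<le> y" "y \<le> r0"
    then have "x \<in> {-X..X}" by auto
    then obtain x' where x': "x' \<in> I" "dist x' x < \<rho> x' / 2" using I(3) by (auto simp: subset_iff)
    have "dist (Complex x y) (of_real x') \<le> \<bar>x - x'\<bar> + \<bar>y\<bar>"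
      using cmod_le[of "Complex x y - of_real x'"] by (simp add: dist_norm)
    also have "\<dots> < \<rho> x'" using x' r0(2)[OF x'(1)] xy unfolding dist_real_def by linarith
    finally have "2 + \<kappa> x' \<le> cmod (ttrace (Complex x y) (cs x'))" by (rule hyp)
    then show "\<exists>cs\<in>set (map cs Is). 2 + k0 \<le> cmod (ttrace (Complex x y) cs)"
      using k0(2)[OF x'(1)] x'(1) Is by force
  qed (use k0 r0 cs in auto)
qed

section \<open>The Dirichlet problem on a finite chain\<close>

text \<open>On the sites 1..Q this is the inhomogeneous equation (h - z) g = c times the unit vector
  at \<open>m\<close>, with boundary zeros at 0 and Q + 1. A source site outside 1..Q gives the
  homogeneous equation.\<close>

definition dirichlet :: "complex \<Rightarrow> (nat \<Rightarrow> real) \<Rightarrow> nat \<Rightarrow> nat \<Rightarrow> complex \<Rightarrow> (nat \<Rightarrow> complex) \<Rightarrow> bool" where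
  "dirichlet z w Q m c g \<longleftrightarrow> g 0 = 0 \<and> g (Suc Q) = 0 \<and>
     (\<forall>n<Q. g (n + 2) + g n + (of_real (w (n + 1)) - z) * g (n + 1) = (if n + 1 = m then c else 0))"

text \<open>Multiply the equation by \<open>cnj (g n)\<close>, take imaginary parts and sum: the
  flux \<open>h\<close> telescopes to 0 by the boundary zeros, and Im z times the square sum of
  \<open>g\<close> is left against a single source term.\<close>

lemma dirichlet_bound:
  assumes g: "dirichlet z w Q m c g" and z: "0 < Im z" and n: "n \<le> Suc Q"
  shows "cmod (g n) \<le> cmod c / Im z"
proof -
  define h where "h n = Im (cnj (g n) * g (Suc n))" for n
  have sq: "Im (cnj x * (a + b + (of_real t - z) * x)) = Im (cnj x * a) - Im (cnj b * x) - Im z * (cmod x)\<^sup>2" for x a b t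
    unfolding cmod_power2 by (simp add: power2_eq_square algebra_simps)
  have site: "h (Suc k) - h k - Im z * (cmod (g (Suc k)))\<^sup>2 =
      Im (cnj (g (Suc k)) * (if Suc k = m then c else 0))" if "k < Q" for k
    using g that sq[of "g (Suc k)" "g (k + 2)" "g k" "w (k + 1)"] by (simp add: dirichlet_def h_def)
  have tele: "(\<Sum>k<Q. h (Suc k) - h k) = 0"
  proof -
    have "h Q = 0" "h 0 = 0" using g by (auto simp: h_def dirichlet_def)
    then show ?thesis by (simp add: sum_lessThan_telescope)
  qed
  have "(\<Sum>k<Q. Im (cnj (g (Suc k)) * (if Suc k = m then c else 0))) =
      (\<Sum>k<Q. (h (Suc k) - h k) - Im z * (cmod (g (Suc k)))\<^sup>2)"
    by (intro sum.cong refl) (rule site[symmetric], simp)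
  also have "\<dots> = - (Im z * (\<Sum>k<Q. (cmod (g (Suc k)))\<^sup>2))"
    unfolding sum_subtractf[of "\<lambda>k. h (Suc k) - h k"] tele by (simp add: sum_distrib_left)
  finally have "(\<Sum>k<Q. Im (cnj (g (Suc k)) * (if Suc k = m then c else 0))) = - (Im z * (\<Sum>k<Q. (cmod (g (Suc k)))\<^sup>2))" .
  moreover have "(\<Sum>k<Q. Im (cnj (g (Suc k)) * (if Suc k = m then c else 0))) =
      (if m \<in> {1..Q} then Im (cnj (g m) * c) else 0)"
  proof -
    have "(\<Sum>k<Q. Im (cnj (g (Suc k)) * (if Suc k = m then c else 0))) =
      (\<Sum>k<Q. if k = m - 1 \<and> 1 \<le> m then Im (cnj (g m) * c) else 0)"
      by (intro sum.cong) auto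
    then show ?thesis by auto
  qed
  ultimately have id: "Im z * (\<Sum>k<Q. (cmod (g (Suc k)))\<^sup>2) = (if m \<in> {1..Q} then - Im (cnj (g m) * c) else 0)"
  proof -
    assume "(\<Sum>k<Q. Im (cnj (g (Suc k)) * (if Suc k = m then c else 0))) = - (Im z * (\<Sum>k<Q. (cmod (g (Suc k)))\<^sup>2))"
      "(\<Sum>k<Q. Im (cnj (g (Suc k)) * (if Suc k = m then c else 0))) = (if m \<in> {1..Q} then Im (cnj (g m) * c) else 0)"
    then have "Im z * (\<Sum>k<Q. (cmod (g (Suc k)))\<^sup>2) = - (if m \<in> {1..Q} then Im (cnj (g m) * c) else 0)"
      by linarith
    also have "\<dots> = (if m \<in> {1..Q} then - Im (cnj (g m) * c) else 0)" 
    proof (cases "m \<in> {1..Q}")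
      case True
      show ?thesis unfolding if_P[OF True] ..
    next
      case False
      show ?thesis unfolding if_not_P[OF False] by simp
    qed
    finally show ?thesis .
  qed
  have cs: "- Im (cnj (g m) * c) \<le> cmod (g m) * cmod c"
    using abs_Im_le_cmod[of "cnj (g m) * c"] by (simp add: norm_mult)
  have le: "Im z * (cmod (g k))\<^sup>2 \<le> Im z * (\<Sum>k<Q. (cmod (g (Suc k)))\<^sup>2)" if k: "k \<in> {1..Q}" for k
  proof -
    have "(cmod (g (Suc (k - 1))))\<^sup>2 \<le> (\<Sum>k<Q. (cmod (g (Suc k)))\<^sup>2)"
      by (rule member_le_sum) (use k in auto)
    then show ?thesis using z k by simp
  qed
  show ?thesis
  proof (cases "n \<in> {1..Q}")
    case False
    then have "n = 0 \<or> n = Suc Q" using n by auto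
    then show ?thesis using g z by (auto simp: dirichlet_def)
  next
    case True
    have 0: "0 \<le> cmod c / Im z" using z by simp
    show ?thesis
    proof (cases "m \<in> {1..Q}")
      case False
      then have "Im z * (cmod (g n))\<^sup>2 \<le> 0"
        using le[OF True] id[unfolded if_not_P[OF False]] by simp
      then have "g n = 0" using z by (simp add: mult_le_0_iff)
      then show ?thesis using 0 by simp
    next
      case m: True
      note idm = id[unfolded if_P[OF m]]
      have gm: "cmod (g m) \<le> cmod c / Im z"
      proof (cases "g m = 0")
        case False
        have "(Im z * cmod (g m)) * cmod (g m) \<le> cmod c * cmod (g m)"
          using le[OF m] idm cs by (simp add: power2_eq_square mult_ac)
        then have "Im z * cmod (g m) \<le> cmod c" using False by simp
        then show ?thesis using z by (simp add: pos_le_divide_eq mult.commute)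
      qed (use 0 in simp)
      have "Im z * (cmod (g n))\<^sup>2 \<le> cmod (g m) * cmod c" using le[OF True] idm cs by simp
      also have "\<dots> \<le> cmod c / Im z * cmod c" using gm by (intro mult_right_mono) auto
      finally have "Im z * (cmod (g n))\<^sup>2 \<le> cmod c / Im z * cmod c" .
      then have "(cmod (g n))\<^sup>2 \<le> (cmod c / Im z)\<^sup>2"
        using z by (simp add: power2_eq_square field_simps)
      then show ?thesis by (rule power2_le_imp_le) (rule 0)
    qed
  qed
qed

text \<open>The solution started at the left boundary. Its value at Q + 1 is the characteristic
  polynomial of the chain of \<open>Q\<close> sites.\<close>

fun fsol :: "complex \<Rightarrow> (nat \<Rightarrow> real) \<Rightarrow> nat \<Rightarrow> complex" where
  "fsol z w 0 = 0"
| "fsol z w (Suc 0) = 1"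
| "fsol z w (Suc (Suc n)) = (z - of_real (w (Suc n))) * fsol z w (Suc n) - fsol z w n"

text \<open>The product of the solutions started at the two ends, divided by their Wronskian. The
  right solution is the left solution of the reflected potential, and the Wronskian equals
  \<open>fsol z w (Suc Q)\<close>.\<close>

definition green :: "complex \<Rightarrow> (nat \<Rightarrow> real) \<Rightarrow> nat \<Rightarrow> nat \<Rightarrow> nat \<Rightarrow> complex" where
  "green z w Q m n = - (fsol z w (min m n) * fsol z (\<lambda>i. w (Suc Q - i)) (Suc Q - max m n)) / fsol z w (Suc Q)"

text \<open>A zero would make \<open>fsol z w\<close> an eigenvector of the chain at a nonreal
  energy. The bound with source 0 excludes this, as the value at site 1 is 1.\<close>

lemma fsol_nonzero:
  assumes "0 < Im z" "0 < Q"
  shows "fsol z w (Suc Q) \<noteq> 0"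
proof
  assume "fsol z w (Suc Q) = 0"
  then have "dirichlet z w Q 0 0 (fsol z w)" by (simp add: dirichlet_def algebra_simps)
  from dirichlet_bound[OF this assms(1), of 1] show False by simp
qed

lemma green_dirichlet:
  assumes z: "0 < Im z" and m: "1 \<le> m" "m \<le> Q"
  shows "dirichlet z w Q m 1 (green z w Q m)"
proof -
  define f where "f = fsol z w"
  define g where "g n = fsol z (\<lambda>i. w (Suc Q - i)) (Suc Q - n)" for n
  have W0: "f (Suc Q) \<noteq> 0" unfolding f_def using fsol_nonzero[OF z] m by simp
  have G: "green z w Q m n = - (f (min m n) * g (max m n)) / f (Suc Q)" for n
    by (simp add: green_def f_def g_def)
  have frec: "f (n + 2) = (z - of_real (w (n + 1))) * f (n + 1) - f n" for n by (simp add: f_def)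
  have grec: "g n = (z - of_real (w (n + 1))) * g (n + 1) - g (n + 2)" if "n < Q" for n
  proof -
    have "Suc Q - n = Suc (Suc (Q - Suc n))" "Suc Q - (n + 1) = Suc (Q - Suc n)" "Suc Q - (n + 2) = Q - Suc n"
      using that by auto
    moreover have "Suc Q - Suc (Q - Suc n) = n + 1" using that by auto
    ultimately show ?thesis by (simp add: g_def)
  qed
  \<comment> \<open>The Wronskian is constant along the chain; the downward induction starts at site
    \<open>Q\<close>, where it is explicit.\<close>
  have wr: "f (n + 1) * g n - f n * g (n + 1) = f (Suc Q)" if "n \<le> Q" for n
    using that
  proof (induction rule: inc_induct)
    case base
    then show ?case by (simp add: g_def)
  next
    case (step n)
    have "f (n + 1) * g n - f n * g (n + 1) = f (n + 2) * g (n + 1) - f (n + 1) * g (n + 2)"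
      unfolding frec grec[OF step(2)] by (simp add: algebra_simps)
    then show ?case using step.IH by simp
  qed
  show ?thesis
    unfolding dirichlet_def
  proof (intro conjI allI impI)
    show "green z w Q m 0 = 0" by (simp add: G f_def)
    show "green z w Q m (Suc Q) = 0" using m by (simp add: G g_def max_def)
    fix n assume n: "n < Q"
    define t where "t = of_real (w (n + 1)) - z"
    have fr: "f (n + 2) = - t * f (n + 1) - f n" and gr: "g n = - t * g (n + 1) - g (n + 2)"
      using frec grec[OF n] by (simp_all add: t_def)
    consider "n + 1 < m" | "n + 1 = m" | "m < n + 1" by linarith
    then have "f (min m (n + 2)) * g (max m (n + 2)) + f (min m n) * g (max m n) + t * (f (min m (n + 1)) * g (max m (n + 1)))
      = (if n + 1 = m then - f (Suc Q) else 0)"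
    proof cases
      case 1
      then have "min m (n + 2) = n + 2" "max m (n + 2) = m" "min m n = n" "max m n = m"
        "min m (n + 1) = n + 1" "max m (n + 1) = m" by auto
      then show ?thesis using 1 by (simp add: fr[simplified] algebra_simps)
    next
      case 2
      have "f (n + 1) * g (n + 2) + f n * g (n + 1) + t * (f (n + 1) * g (n + 1)) = - (f (n + 1) * g n - f n * g (n + 1))"
        unfolding gr by (simp add: algebra_simps)
      also have "\<dots> = - f (Suc Q)" using wr[of n] n by simp
      finally show ?thesis using 2 by (simp add: min_def max_def)
    next
      case 3
      then have "min m (n + 2) = m" "max m (n + 2) = n + 2" "min m n = m" "max m n = n"
        "min m (n + 1) = m" "max m (n + 1) = n + 1" by auto
      then show ?thesis using 3 by (simp add: gr[simplified] algebra_simps)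
    qed
    then show "green z w Q m (n + 2) + green z w Q m n + (of_real (w (n + 1)) - z) * green z w Q m (n + 1) =
      (if n + 1 = m then 1 else 0)"
    proof -
      assume a: "f (min m (n + 2)) * g (max m (n + 2)) + f (min m n) * g (max m n) + t * (f (min m (n + 1)) * g (max m (n + 1)))
        = (if n + 1 = m then - f (Suc Q) else 0)"
      have lin: "- A / W + - B / W + t * (- C / W) = - (A + B + t * C) / W" for A B C W :: complex
        by (simp add: add_divide_distrib diff_divide_distrib)
      show ?thesis unfolding G t_def[symmetric] lin a using W0 by simp
    qed
  qed
qed

lemma continuous_fsol: "continuous_on S (\<lambda>z. fsol z w n)"
  \<comment> \<open>The energy is bound inside the claim, so the first argument of the recursion is
    a dummy.\<close>
  by (induction "undefined :: complex" w n rule: fsol.induct) (auto intro!: continuous_intros)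

lemma continuous_green:
  assumes "0 < Q"
  shows "continuous_on {z. 0 < Im z} (\<lambda>z. green z w Q m n)"
  unfolding green_def by (intro continuous_intros continuous_fsol) (use fsol_nonzero assms in auto)

text \<open>Sampled once per period, the solution obeys the three-term recurrence of
  \<open>period_recurrence\<close>, so in the middle of the 2 p periods it is exponentially small.
  To the right of that point it solves a Dirichlet problem driven by the midpoint value, which costs
  the second factor 1 / Im z.\<close>

lemma barrier_bound:
  assumes g: "dirichlet z w Q m 1 g" and z: "0 < Im z" and m: "1 \<le> m" "m \<le> n0"
    and cs: "cs \<noteq> []" and p: "1 \<le> p" and Q: "n0 + 2 * p * length cs \<le> Q"
    and w: "\<And>i. i < 2 * p * length cs \<Longrightarrow> w (n0 + 1 + i) = cs ! (i mod length cs)"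
    and hyp: "2 + \<kappa> \<le> cmod (ttrace z cs)" and \<kappa>: "0 < \<kappa>"
  shows "cmod (g Q) \<le> (2 / (2 + \<kappa>)) ^ p / (Im z)\<^sup>2"
proof -
  define L where "L = length cs"
  have L: "0 < L" using cs by (simp add: L_def)
  have eq: "g (k + 2) = (z - of_real (w (k + 1))) * g (k + 1) - g k" if "m \<le> k" "k < Q" for k
  proof -
    have "g (k + 2) + g k + (of_real (w (k + 1)) - z) * g (k + 1) = 0"
      using g that by (auto simp: dirichlet_def)
    then have "g (k + 2) = - (g k + (of_real (w (k + 1)) - z) * g (k + 1))"
      by (metis add.assoc eq_neg_iff_add_eq_0)
    then show ?thesis by (simp add: algebra_simps)
  qed
  define a where "a j = g (n0 + j * L)" for j
  have rec: "a (j + 2) + a j = ttrace z cs * a (j + 1)" if j: "j + 2 \<le> 2 * p" for j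
  proof -
    have "g (n0 + j * L + 2 * L) + g (n0 + j * L) = ttrace z cs * g (n0 + j * L + L)"
      unfolding L_def
    proof (rule period_recurrence, fold L_def)
      fix i assume i: "i < 2 * L"
      have lt: "j * L + i < 2 * p * L"
      proof -
        have "j * L + i < (j + 2) * L" using i by (simp add: algebra_simps)
        also have "\<dots> \<le> 2 * p * L" using j by (intro mult_right_mono) auto
        finally show ?thesis .
      qed
      have "w (n0 + 1 + (j * L + i)) = cs ! ((j * L + i) mod L)" using w lt by (simp add: L_def)
      then have "w (n0 + j * L + i + 1) = cs ! (i mod L)" by (simp add: add_ac)
      moreover have "n0 + j * L + i < Q" using lt Q by (simp add: L_def)
      ultimately show "g (n0 + j * L + i + 2) = (z - of_real (cs ! (i mod L))) * g (n0 + j * L + i + 1) - g (n0 + j * L + i)"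
        using eq[of "n0 + j * L + i"] m by simp
    qed
    moreover have "n0 + (j + 2) * L = n0 + j * L + 2 * L" "n0 + (j + 1) * L = n0 + j * L + L" by simp_all
    ultimately show ?thesis unfolding a_def by metis
  qed
  have bnd: "cmod (a j) \<le> 1 / Im z" if "j \<le> 2 * p" for j
  proof -
    have "j * L \<le> 2 * p * L" using that by (intro mult_right_mono) auto
    then have "n0 + j * L \<le> Suc Q" using Q unfolding L_def[symmetric] by linarith
    from dirichlet_bound[OF g z this] show ?thesis by (simp add: a_def)
  qed
  have ap: "cmod (a p) \<le> 1 / Im z * (2 / (2 + \<kappa>)) ^ p"
    by (rule hyperbolic_decay[OF rec bnd hyp \<kappa>]) auto
  define s where "s = n0 + p * L"
  have sQ: "s < Q"
  proof -
    have "0 < p * L" using p L by simp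
    moreover have "2 * p * L = p * L + p * L" by simp
    ultimately show ?thesis using Q unfolding s_def L_def[symmetric] by linarith
  qed
  have sm: "m \<le> s" using m by (simp add: s_def)
  \<comment> \<open>Setting the value at \<open>s\<close> to 0 moves it to the right-hand side of
    the equation at the next site.\<close>
  define h where "h n = (if n = 0 then 0 else g (s + n))" for n
  have "dirichlet z (\<lambda>n. w (s + n)) (Q - s) 1 (- g s) h"
    unfolding dirichlet_def
  proof (intro conjI allI impI)
    show "h 0 = 0" by (simp add: h_def)
    show "h (Suc (Q - s)) = 0" using g sQ by (simp add: h_def dirichlet_def)
    fix n assume n: "n < Q - s"
    have "g (s + n + 2) = (z - of_real (w (s + n + 1))) * g (s + n + 1) - g (s + n)"
      by (rule eq) (use sm n in auto)
    then show "h (n + 2) + h n + (of_real (w (s + (n + 1))) - z) * h (n + 1) = (if n + 1 = 1 then - g s else 0)"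
      by (cases "n = 0") (simp_all add: h_def algebra_simps)
  qed
  from dirichlet_bound[OF this z, of "Q - s"] have "cmod (g Q) \<le> cmod (a p) / Im z"
    using sQ by (simp add: h_def a_def s_def)
  also have "\<dots> \<le> 1 / Im z * (2 / (2 + \<kappa>)) ^ p / Im z"
    using ap z by (intro divide_right_mono) auto
  finally show ?thesis by (simp add: power2_eq_square)
qed

lemma dirichlet_reverse:
  assumes "dirichlet z w Q m c g" "1 \<le> m" "m \<le> Q" "\<And>n. 1 \<le> n \<Longrightarrow> n \<le> Q \<Longrightarrow> w (Suc Q - n) = w n"
  shows "dirichlet z w Q (Suc Q - m) c (\<lambda>n. g (Suc Q - n))"
  unfolding dirichlet_def
proof (intro conjI allI impI)
  show "g (Suc Q - 0) = 0" "g (Suc Q - Suc Q) = 0" using assms(1) by (auto simp: dirichlet_def)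
  fix n assume n: "n < Q"
  define k where "k = Q - Suc n"
  have k: "k < Q" "Suc Q - (n + 2) = k" "Suc Q - n = k + 2" "Suc Q - (n + 1) = k + 1"
    using n by (auto simp: k_def)
  have wk: "w (n + 1) = w (k + 1)" using assms(4)[of "n + 1"] n unfolding k(4) by simp
  have c: "(n + 1 = Suc Q - m) = (k + 1 = m)" using n assms(2,3) by (auto simp: k_def)
  show "g (Suc Q - (n + 2)) + g (Suc Q - n) + (of_real (w (n + 1)) - z) * g (Suc Q - (n + 1)) =
    (if n + 1 = Suc Q - m then c else 0)"
    unfolding k(2-4) wk c using assms(1) k(1) by (simp add: dirichlet_def add_ac)
qed

lemma nth_concat_replicate:
  assumes "i < k * length cs"
  shows "concat (replicate k cs) ! i = cs ! (i mod length cs)"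
  using assms
proof (induction k arbitrary: i)
  case (Suc k)
  show ?case
  proof (cases "i < length cs")
    case False
    then have "concat (replicate (Suc k) cs) ! i = concat (replicate k cs) ! (i - length cs)"
      by (simp add: nth_append)
    also have "\<dots> = cs ! ((i - length cs) mod length cs)" using Suc False by (intro Suc.IH) auto
    finally show ?thesis using False by (simp add: le_mod_geq)
  qed (simp add: nth_append)
qed simp

section \<open>Barrier potentials on the line\<close>

text \<open>A core of 2 r + 1 sites at level \<alpha> stands between two mirror-image barriers, each
  containing 2 p copies of every word. At any energy of the window some word is hyperbolic, and its
  block separates the core from the end. \<open>q m j z\<close> is the Green function of this chain,
  centred at 0 and extended by 0.\<close>

lemma barrier_potential:
  fixes \<alpha> \<beta> X :: real and r :: nat
  assumes "\<alpha> < \<beta>"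
  obtains \<sigma> \<rho> and Lt :: nat where "0 < \<sigma>" "\<sigma> < 1" "0 < \<rho>"
    "\<And>p. 1 \<le> p \<Longrightarrow> \<exists>w :: int \<Rightarrow> real. \<exists>q :: int \<Rightarrow> int \<Rightarrow> complex \<Rightarrow> complex.
       (\<forall>n. \<alpha> \<le> w n \<and> w n \<le> \<beta>) \<and>
       (\<forall>m j. \<bar>m\<bar> \<le> int r \<longrightarrow> continuous_on {z. 0 < Im z} (q m j)) \<and>
       (\<forall>m j z. int (r + p * Lt) < \<bar>j\<bar> \<longrightarrow> q m j z = 0) \<and>
       (\<forall>m j z. \<bar>m\<bar> \<le> int r \<longrightarrow> 0 < Im z \<longrightarrow> \<bar>j\<bar> \<le> int (r + p * Lt) \<longrightarrow>
          q m (j + 1) z + q m (j - 1) z + (of_real (w j) - z) * q m j z = of_bool (j = m)) \<and>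
       (\<forall>m j z. \<bar>m\<bar> \<le> int r \<longrightarrow> 0 < Im z \<longrightarrow> Im z \<le> \<rho> \<longrightarrow> \<bar>Re z\<bar> \<le> X \<longrightarrow> \<bar>j\<bar> = int (r + p * Lt) \<longrightarrow>
          cmod (q m j z) \<le> \<sigma> ^ p / (Im z)\<^sup>2)"
proof -
  obtain Ws \<kappa> \<rho> where \<kappa>: "0 < \<kappa>" and \<rho>: "0 < \<rho>" and Ws: "\<And>cs. cs \<in> set Ws \<Longrightarrow> cs \<noteq> [] \<and> set cs \<subseteq> {\<alpha>..\<beta>}"
    and hyp: "\<And>x y. \<bar>x\<bar> \<le> X \<Longrightarrow> 0 \<le> y \<Longrightarrow> y \<le> \<rho> \<Longrightarrow> \<exists>cs\<in>set Ws. 2 + \<kappa> \<le> cmod (ttrace (Complex x y) cs)"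
    by (rule hyperbolic_words_uniform[OF assms, of X]) (rule that; assumption)
  define Lt where "Lt = 2 * (\<Sum>cs\<leftarrow>Ws. length cs)"
  define \<sigma> where "\<sigma> = 2 / (2 + \<kappa>)"
  show ?thesis
  proof (rule that[of \<sigma> \<rho> Lt])
    show "0 < \<sigma>" "\<sigma> < 1" using \<kappa> by (auto simp: \<sigma>_def)
    show "0 < \<rho>" by (rule \<rho>)
    fix p :: nat assume p: "1 \<le> p"
    define D where "D = concat (map (\<lambda>cs. concat (replicate (2 * p) cs)) Ws)"
    \<comment> \<open>The mirror symmetry reduces the left end to the right end by
      \<open>dirichlet_reverse\<close>.\<close>
    define F where "F = rev D @ replicate (2 * r + 1) \<alpha> @ D"
    define R where "R = r + p * Lt"
    define Q where "Q = 2 * R + 1"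
    have lenD: "length D = p * Lt"
      unfolding D_def Lt_def by (induction Ws) (simp_all add: length_concat sum_list_replicate algebra_simps)
    have lenF: "length F = Q" by (simp add: F_def lenD Q_def R_def)
    have revF: "rev F = F" by (simp add: F_def replicate_append_same)
    have setF: "set F \<subseteq> {\<alpha>..\<beta>}" 
    proof -
      have "\<alpha> \<le> x \<and> x \<le> \<beta>" if "cs \<in> set Ws" "x \<in> set cs" for cs x using Ws that by force
      then show ?thesis using assms by (auto simp: F_def D_def split: if_splits)
    qed
    define wn where "wn s = (if 1 \<le> s \<and> s \<le> Q then F ! (s - 1) else \<alpha>)" for s
    have wn: "\<alpha> \<le> wn s \<and> wn s \<le> \<beta>" for s
    proof (cases "1 \<le> s \<and> s \<le> Q")
      case True
      then have "F ! (s - 1) \<in> set F" using lenF by (intro nth_mem) auto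
      then show ?thesis using setF True by (auto simp: wn_def)
    qed (use assms in \<open>auto simp: wn_def\<close>)
    have wsym: "wn (Suc Q - n) = wn n" if "1 \<le> n" "n \<le> Q" for n
    proof -
      have "F ! (n - 1) = rev F ! (n - 1)" by (simp add: revF)
      also have "\<dots> = F ! (Q - Suc (n - 1))" using that lenF by (subst rev_nth) auto
      finally have "F ! (n - 1) = F ! (Q - n)" using that by simp
      moreover have "1 \<le> Suc Q - n" "Suc Q - n \<le> Q" "Suc Q - n - 1 = Q - n" using that by auto
      ultimately show ?thesis using that unfolding wn_def by presburger
    qed
    \<comment> \<open>Position \<open>j\<close> on the line is site j + R + 1 of the chain, so the
      positions -R..R are the sites 1..Q.\<close>
    define w where "w j = wn (nat (j + int R + 1))" for j :: int
    define q where "q m j z = (if \<bar>j\<bar> \<le> int R then green z wn Q (nat (m + int R + 1)) (nat (j + int R + 1)) else 0)" for m j z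
    have Q0: "0 < Q" by (simp add: Q_def)
    have msite: "1 \<le> nat (m + int R + 1)" "nat (m + int R + 1) \<le> length D + 2 * r + 1" "nat (m + int R + 1) \<le> Q" if "\<bar>m\<bar> \<le> int r" for m
    proof -
      have "- int r \<le> m" "m \<le> int r" using that by auto
      then show "1 \<le> nat (m + int R + 1)" "nat (m + int R + 1) \<le> length D + 2 * r + 1" "nat (m + int R + 1) \<le> Q"
        by (auto simp: R_def Q_def lenD nat_le_iff le_nat_iff simp del: of_nat_mult)
    qed
    have right: "cmod (g Q) \<le> \<sigma> ^ p / (Im z)\<^sup>2"
      if g: "dirichlet z wn Q s 1 g" and s: "1 \<le> s" "s \<le> length D + 2 * r + 1" and z: "0 < Im z" "Im z \<le> \<rho>" "\<bar>Re z\<bar> \<le> X" for g z s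
    proof -
      obtain cs where cs: "cs \<in> set Ws" "2 + \<kappa> \<le> cmod (ttrace z cs)"
        using hyp[of "Re z" "Im z"] z by (auto simp: complex_surj)
      obtain W1 W2 where W: "Ws = W1 @ cs # W2" using split_list[OF cs(1)] by blast
      define A where "A = concat (map (\<lambda>cs. concat (replicate (2 * p) cs)) W1)"
      define B where "B = concat (map (\<lambda>cs. concat (replicate (2 * p) cs)) W2)"
      have D: "D = A @ concat (replicate (2 * p) cs) @ B" by (simp add: D_def W A_def B_def)
      define n0 where "n0 = length D + 2 * r + 1 + length A"
      have lenc: "length (concat (replicate (2 * p) cs)) = 2 * p * length cs"
        by (simp add: length_concat sum_list_replicate)
      have n0Q: "n0 + 2 * p * length cs \<le> Q"
        unfolding lenF[symmetric] F_def using lenc by (simp add: n0_def D)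
      have F': "F = (rev D @ replicate (2 * r + 1) \<alpha> @ A) @ concat (replicate (2 * p) cs) @ B"
        by (simp add: F_def D)
      have "wn (n0 + 1 + i) = cs ! (i mod length cs)" if i: "i < 2 * p * length cs" for i
      proof -
        have "wn (n0 + 1 + i) = F ! (n0 + i)" using i n0Q by (simp add: wn_def)
        also have "\<dots> = (concat (replicate (2 * p) cs) @ B) ! i"
          unfolding F' by (subst nth_append) (simp add: n0_def)
        also have "\<dots> = cs ! (i mod length cs)"
          using i lenc nth_concat_replicate[OF i] by (simp add: nth_append)
        finally show ?thesis .
      qed
      from barrier_bound[OF g z(1) s(1) _ _ p n0Q this cs(2) \<kappa>] Ws[OF cs(1)] s(2)
      show ?thesis by (simp add: n0_def \<sigma>_def)
    qed
    have gd: "dirichlet z wn Q (nat (m + int R + 1)) 1 (green z wn Q (nat (m + int R + 1)))"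
      if "\<bar>m\<bar> \<le> int r" "0 < Im z" for m z
      by (rule green_dirichlet[OF that(2)]) (use msite[OF that(1)] in auto)
    have rec: "q m (j + 1) z + q m (j - 1) z + (of_real (w j) - z) * q m j z = of_bool (j = m)"
      if "\<bar>m\<bar> \<le> int r" "0 < Im z" "\<bar>j\<bar> \<le> int R" for m j z
    proof -
      define n where "n = nat (j + int R)"
      let ?g = "green z wn Q (nat (m + int R + 1))"
      have n: "n < Q" using that by (auto simp: n_def Q_def)
      have g0: "?g 0 = 0" "?g (Suc Q) = 0" using gd[OF that(1,2)] by (auto simp: dirichlet_def)
      have "q m j z = ?g (n + 1)" using that by (simp add: q_def n_def nat_add_distrib)
      moreover have "q m (j + 1) z = ?g (n + 2)"
      proof (cases "j = int R")
        case True
        then have "n + 2 = Suc Q" by (simp add: n_def Q_def)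
        then show ?thesis using g0 True by (simp add: q_def)
      next
        case False
        then have "\<bar>j + 1\<bar> \<le> int R" "nat (j + 1 + int R + 1) = n + 2" using that by (auto simp: n_def)
        then show ?thesis by (simp add: q_def)
      qed
      moreover have "q m (j - 1) z = ?g n"
      proof (cases "j = - int R")
        case True
        then have "n = 0" by (simp add: n_def)
        then show ?thesis using g0 True by (simp add: q_def)
      next
        case False
        then have "\<bar>j - 1\<bar> \<le> int R" "nat (j - 1 + int R + 1) = n" using that by (auto simp: n_def)
        then show ?thesis by (simp add: q_def)
      qed
      moreover have "w j = wn (n + 1)" using that by (simp add: w_def n_def nat_add_distrib)
      moreover have "(n + 1 = nat (m + int R + 1)) = (j = m)" using that by (auto simp: n_def R_def)
      ultimately show ?thesis using gd[OF that(1,2)] n by (simp add: dirichlet_def)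
    qed
    have bnd: "cmod (q m j z) \<le> \<sigma> ^ p / (Im z)\<^sup>2"
      if mr: "\<bar>m\<bar> \<le> int r" and z: "0 < Im z" "Im z \<le> \<rho>" "\<bar>Re z\<bar> \<le> X" and j: "\<bar>j\<bar> = int R" for m j z
    proof (cases "j = int R")
      case True
      then have "nat (j + int R + 1) = Q" by (simp add: Q_def)
      then have "q m j z = green z wn Q (nat (m + int R + 1)) Q" using j unfolding q_def by simp
      then show ?thesis using right[OF gd[OF mr z(1)] msite(1,2)[OF mr] z] by simp
    next
      case False
      then have jR: "j = - int R" using j by auto
      then have q1: "q m j z = green z wn Q (nat (m + int R + 1)) (Suc Q - Q)" by (simp add: q_def)
      have d: "dirichlet z wn Q (Suc Q - nat (m + int R + 1)) 1 (\<lambda>n. green z wn Q (nat (m + int R + 1)) (Suc Q - n))"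
        by (rule dirichlet_reverse[OF gd[OF mr z(1)] _ _ wsym]) (use msite[OF mr] in auto)
      have s: "1 \<le> Suc Q - nat (m + int R + 1)" "Suc Q - nat (m + int R + 1) \<le> length D + 2 * r + 1"
        using mr msite[OF mr] by (auto simp: Q_def R_def lenD simp del: of_nat_mult)
      show ?thesis unfolding q1 by (rule right[OF d s z])
    qed
    have cont: "continuous_on {z. 0 < Im z} (q m j)" for m j
      unfolding q_def by (cases "\<bar>j\<bar> \<le> int R") (auto intro!: continuous_green Q0)
    show "\<exists>w :: int \<Rightarrow> real. \<exists>q :: int \<Rightarrow> int \<Rightarrow> complex \<Rightarrow> complex.
       (\<forall>n. \<alpha> \<le> w n \<and> w n \<le> \<beta>) \<and>
       (\<forall>m j. \<bar>m\<bar> \<le> int r \<longrightarrow> continuous_on {z. 0 < Im z} (q m j)) \<and>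
       (\<forall>m j z. int (r + p * Lt) < \<bar>j\<bar> \<longrightarrow> q m j z = 0) \<and>
       (\<forall>m j z. \<bar>m\<bar> \<le> int r \<longrightarrow> 0 < Im z \<longrightarrow> \<bar>j\<bar> \<le> int (r + p * Lt) \<longrightarrow>
          q m (j + 1) z + q m (j - 1) z + (of_real (w j) - z) * q m j z = of_bool (j = m)) \<and>
       (\<forall>m j z. \<bar>m\<bar> \<le> int r \<longrightarrow> 0 < Im z \<longrightarrow> Im z \<le> \<rho> \<longrightarrow> \<bar>Re z\<bar> \<le> X \<longrightarrow> \<bar>j\<bar> = int (r + p * Lt) \<longrightarrow>
          cmod (q m j z) \<le> \<sigma> ^ p / (Im z)\<^sup>2)"
      unfolding R_def[symmetric]
    proof (intro exI[of _ w] exI[of _ q] conjI)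
      show "\<forall>n. \<alpha> \<le> w n \<and> w n \<le> \<beta>" using wn by (simp add: w_def)
      show "\<forall>m j z. int R < \<bar>j\<bar> \<longrightarrow> q m j z = 0" by (simp add: q_def)
    qed (use rec bnd cont in blast)+
  qed
qed

section \<open>Separable potentials\<close>

definition proj :: "'a set \<Rightarrow> 'a ell2 \<Rightarrow> 'a ell2" where
  "proj S = multop (indicator S)"

lemma indicator_abs_le: "\<bar>indicator S n :: real\<bar> \<le> 1"
  by (simp add: indicator_def)

lemma coord_proj [simp]: "coord (proj S u) n = (if n \<in> S then coord u n else 0)"
  unfolding proj_def by (subst coord_multop[of _ 1]) (auto simp: indicator_abs_le)

lemma norm_proj_le: "norm (proj S u) \<le> norm u"
  unfolding proj_def using norm_multop_le[of "indicator S" 1 u] by (simp add: indicator_abs_le)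

lemma linear_proj: "linear (proj S)"
  by (rule linearI; rule ell2_eqI) simp_all

lemma inner_proj: "inner (proj S u) w = inner u (proj S w)"
  unfolding proj_def by (rule inner_multop_sym[of _ 1]) (simp add: indicator_abs_le)

lemma proj_scaleC: "proj S (scaleC_ell2 z u) = scaleC_ell2 z (proj S u)"
  by (rule ell2_eqI) simp

lemma norm_proj_Union_le:
  assumes "finite I"
  shows "norm (proj (\<Union>i\<in>I. S i) u) \<le> (\<Sum>i\<in>I. norm (proj (S i) u))"
  using assms
proof induction
  case empty
  have "proj {} u = 0" by (rule ell2_eqI) simp
  then show ?case by simp
next
  case (insert i I)
  have "proj (\<Union>i\<in>insert i I. S i) u = proj (S i) u + proj (- S i) (proj (\<Union>i\<in>I. S i) u)"
    by (rule ell2_eqI) auto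
  then have "norm (proj (\<Union>i\<in>insert i I. S i) u) \<le> norm (proj (S i) u) + norm (proj (- S i) (proj (\<Union>i\<in>I. S i) u))"
    by (simp only: norm_triangle_ineq)
  also have "\<dots> \<le> norm (proj (S i) u) + norm (proj (\<Union>i\<in>I. S i) u)"
    by (intro add_left_mono norm_proj_le)
  finally have "norm (proj (\<Union>i\<in>insert i I. S i) u) \<le> norm (proj (S i) u) + norm (proj (\<Union>i\<in>I. S i) u)" .
  then show ?case using insert by simp
qed

text \<open>Restricting the sum to a set \<open>K\<close> of coordinates lets
  \<open>sepv w (- {i})\<close> denote the part transverse to direction \<open>i\<close>.\<close>

definition sepv :: "(int \<Rightarrow> real) \<Rightarrow> 'n set \<Rightarrow> int ^ 'n \<Rightarrow> real" where
  "sepv w K n = (\<Sum>k\<in>K. w (n $ k))"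

lemma sepv_bound:
  fixes K :: "('n::finite) set"
  assumes "\<And>n. \<bar>w n\<bar> \<le> C"
  shows "\<bar>sepv w K n\<bar> \<le> real CARD('n) * C"
proof -
  have C: "0 \<le> C" using assms[of 0] by linarith
  have "\<bar>sepv w K n\<bar> \<le> (\<Sum>k\<in>K. \<bar>w (n $ k)\<bar>)" unfolding sepv_def by (rule sum_abs)
  also have "\<dots> \<le> (\<Sum>k\<in>(UNIV :: 'n set). C)"
    by (rule order_trans[OF sum_mono2[of UNIV K] sum_mono]) (auto simp: assms)
  finally show ?thesis by simp
qed

definition trans_nb :: "'n \<Rightarrow> (int ^ 'n) set" where
  "trans_nb i = neighbours - {axis i 1, axis i (- 1)}"

lemma trans_nb_nth: "j \<in> trans_nb i \<Longrightarrow> j $ i = 0"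
  by (auto simp: trans_nb_def neighbours_eq axis_def)

lemma uminus_trans_nb: "uminus ` trans_nb i = (trans_nb i :: (int ^ 'n) set)"
proof -
  have ax: "- axis i c = axis i (- c)" for c :: int and i :: 'n by (simp add: vec_eq_iff axis_def)
  have "uminus ` trans_nb i \<subseteq> (trans_nb i :: (int ^ 'n) set)"
  proof clarify
    fix j :: "int ^ 'n" assume j: "j \<in> trans_nb i"
    then have "- j \<in> neighbours" by (simp add: trans_nb_def neighbours_def)
    moreover have "- j \<noteq> axis i 1" "- j \<noteq> axis i (- 1)"
      using j ax[of i 1] ax[of i "- 1"] by (auto simp: trans_nb_def minus_equation_iff[of j])
    ultimately show "- j \<in> trans_nb i" by (simp add: trans_nb_def)
  qed
  then show ?thesis by (metis (no_types, lifting) image_subset_iff minus_minus rev_image_eqI subsetI subset_antisym)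
qed

text \<open>Splitting off direction \<open>i\<close>: the remaining part \<open>hop (trans_nb i) (sepv w (- {i}))\<close> commutes with
  everything that happens in direction \<open>i\<close>, so its polynomials may be treated as scalars there.\<close>

lemma hop_split:
  fixes i :: "'n::finite"
  assumes w: "\<And>n. \<bar>w n\<bar> \<le> C"
  shows "hop neighbours (sepv w UNIV) u = translate (axis i 1) u + translate (axis i (- 1)) u +
     multop (\<lambda>n. w (n $ i)) u + hop (trans_nb i) (sepv w (- {i})) u"
proof (rule ell2_eqI)
  fix n :: "int ^ 'n"
  have sub: "{axis i 1, axis i (- 1)} \<subseteq> (neighbours :: (int ^ 'n) set)" by (auto simp: neighbours_eq)
  have "(\<Sum>j\<in>neighbours. coord u (n + j)) =
      (\<Sum>j\<in>trans_nb i. coord u (n + j)) + (\<Sum>j\<in>{axis i 1, axis i (- 1)}. coord u (n + j))"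
    unfolding trans_nb_def by (rule sum.subset_diff[OF sub finite_neighbours])
  moreover have "sepv w UNIV n = w (n $ i) + sepv w (- {i}) n"
    unfolding sepv_def by (simp add: sum.remove[of UNIV i] Compl_eq_Diff_UNIV)
  ultimately show "coord (hop neighbours (sepv w UNIV) u) n = coord (translate (axis i 1) u + translate (axis i (- 1)) u +
     multop (\<lambda>n. w (n $ i)) u + hop (trans_nb i) (sepv w (- {i})) u) n"
    by (simp add: coord_hop[OF sepv_bound[OF w]] coord_multop[of "\<lambda>n. w (n $ i)", OF w] axis_eq_axis algebra_simps)
qed

definition slice :: "int ^ 'n \<Rightarrow> 'n \<Rightarrow> int \<Rightarrow> int ^ 'n" where
  "slice m i j = m + axis i (j - m $ i)"

lemma slice_nth: "slice m i j $ i = j" by (simp add: slice_def)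

lemma slice_shift: "slice m i j + axis i c = slice m i (j + c)" "slice m i j - axis i c = slice m i (j - c)"
  by (simp_all add: slice_def vec_eq_iff axis_def)

lemma slice_self: "slice m i (m $ i) = m"
  by (simp add: slice_def vec_eq_iff axis_def)

text \<open>Transverse hops do not change the \<open>i\<close>-th coordinate.\<close>

lemma opoly_slice_support:
  fixes i :: "'n::finite"
  assumes w: "\<And>n. \<bar>w n\<bar> \<le> C" and n: "n $ i \<noteq> k $ i"
  shows "coord (opoly (hop (trans_nb i) (sepv w (- {i}))) p (ket k)) n = 0"
  using n
proof (induction p arbitrary: n)
  case (pCons c p)
  have "n \<noteq> k" using pCons.prems by auto
  moreover have "coord (opoly (hop (trans_nb i) (sepv w (- {i}))) p (ket k)) (n + j) = 0" if "j \<in> trans_nb i" for j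
    using trans_nb_nth[OF that] pCons.prems by (intro pCons.IH) simp
  ultimately show ?case
    using pCons.IH[OF pCons.prems]
    by (simp add: opoly_pCons[OF linear_hop[OF sepv_bound[OF w]]] coord_hop[OF sepv_bound[OF w]])
qed simp

lemma opoly_slice_translate:
  fixes i :: "'n::finite"
  assumes w: "\<And>n. \<bar>w n\<bar> \<le> C"
  shows "translate (axis i c) (opoly (hop (trans_nb i) (sepv w (- {i}))) p (ket k)) =
     opoly (hop (trans_nb i) (sepv w (- {i}))) p (ket (k - axis i c))"
proof -
  have inv: "sepv w (- {i}) (n + axis i c) = sepv w (- {i}) n" for n
    unfolding sepv_def by (rule sum.cong) (auto simp: axis_def)
  have tk: "ket (k - axis i c) = translate (axis i c) (ket k)"
    using translate_ket[of "- axis i c" k] by simp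
  show ?thesis unfolding tk
    by (rule opoly_commute[OF linear_hop[OF sepv_bound[OF w]] translate_linear, symmetric])
      (rule hop_translate[where v = "sepv w (- {i})" and C = "real CARD('n) * C",
          OF sepv_bound[where w = w and C = C, OF w] inv])
qed

text \<open>On the vectors p(H') applied to sites of the line through \<open>m\<close> in direction
  \<open>i\<close>, the full operator acts as a one-dimensional Jacobi operator with polynomial
  coefficients: the potential at \<open>j\<close> is w j + t, where t stands for H'.\<close>

lemma hop_slice:
  fixes i :: "'n::finite"
  assumes w: "\<And>n. \<bar>w n\<bar> \<le> C"
  defines "H' \<equiv> hop (trans_nb i) (sepv w (- {i}))"
  shows "hop neighbours (sepv w UNIV) (opoly H' p (ket (slice m i j))) =
     opoly H' p (ket (slice m i (j - 1))) + opoly H' p (ket (slice m i (j + 1))) +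
     opoly H' ([:w j, 1:] * p) (ket (slice m i j))"
proof -
  have lin: "linear H'" unfolding H'_def by (rule linear_hop[OF sepv_bound[OF w]])
  have tr: "translate (axis i c) (opoly H' p (ket (slice m i j))) = opoly H' p (ket (slice m i (j - c)))" for c
    unfolding H'_def opoly_slice_translate[OF w] slice_shift ..
  have mw: "multop (\<lambda>n. w (n $ i)) (opoly H' p (ket (slice m i j))) = w j *\<^sub>R opoly H' p (ket (slice m i j))"
  proof (rule ell2_eqI)
    fix n
    show "coord (multop (\<lambda>n. w (n $ i)) (opoly H' p (ket (slice m i j)))) n = coord (w j *\<^sub>R opoly H' p (ket (slice m i j))) n"
      using opoly_slice_support[where w = w and C = C and n = n and i = i and k = "slice m i j" and p = p, OF w]
      by (cases "n $ i = j") (simp_all add: coord_multop[of "\<lambda>n. w (n $ i)", OF w] slice_nth H'_def)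
  qed
  have "hop neighbours (sepv w UNIV) (opoly H' p (ket (slice m i j))) =
    translate (axis i 1) (opoly H' p (ket (slice m i j))) + translate (axis i (- 1)) (opoly H' p (ket (slice m i j))) +
    multop (\<lambda>n. w (n $ i)) (opoly H' p (ket (slice m i j))) + H' (opoly H' p (ket (slice m i j)))"
    unfolding H'_def by (rule hop_split[OF w])
  then show ?thesis
    unfolding tr mw opoly_mult[OF lin] opoly_linear_factor[OF lin] by (simp add: algebra_simps)
qed

text \<open>Reindexing moves the shifts from the basis vectors to the coefficients. \<open>T\<close>
  exceeds the support of \<open>P\<close> by one site on each side, because one application of the
  operator spreads by one.\<close>

lemma hop_slice_sum:
  fixes i :: "'n::finite" and R :: nat
  assumes w: "\<And>n. \<bar>w n\<bar> \<le> C" and P: "\<And>j. int R < \<bar>j\<bar> \<Longrightarrow> P j = 0"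
  defines "H' \<equiv> hop (trans_nb i) (sepv w (- {i}))"
    and "T \<equiv> {- int R - 1..int R + 1}"
  shows "hop neighbours (sepv w UNIV) (\<Sum>j\<in>T. opoly H' (P j) (ket (slice m i j))) =
    (\<Sum>j\<in>T. opoly H' (P (j + 1) + P (j - 1) + [:w j, 1:] * P j) (ket (slice m i j)))"
proof -
  have lin: "linear H'" unfolding H'_def by (rule linear_hop[OF sepv_bound[OF w]])
  have l0: "linear (hop neighbours (sepv w (UNIV :: 'n set)))" by (rule linear_hop[OF sepv_bound[OF w]])
  have a: "(\<Sum>j\<in>T. opoly H' (P j) (ket (slice m i (j - 1)))) = (\<Sum>j\<in>T. opoly H' (P (j + 1)) (ket (slice m i j)))"
    by (rule sum.reindex_bij_witness_not_neutral[of "{int R + 1, - int R - 1}" "{int R + 1, int R}" _ "\<lambda>j. j + 1" "\<lambda>j. j - 1"])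
      (auto simp: T_def P)
  have b: "(\<Sum>j\<in>T. opoly H' (P j) (ket (slice m i (j + 1)))) = (\<Sum>j\<in>T. opoly H' (P (j - 1)) (ket (slice m i j)))"
    by (rule sum.reindex_bij_witness_not_neutral[of "{int R + 1, - int R - 1}" "{- int R - 1, - int R}" _ "\<lambda>j. j - 1" "\<lambda>j. j + 1"])
      (auto simp: T_def P)
  have "hop neighbours (sepv w UNIV) (\<Sum>j\<in>T. opoly H' (P j) (ket (slice m i j))) =
    (\<Sum>j\<in>T. opoly H' (P j) (ket (slice m i (j - 1))) + opoly H' (P j) (ket (slice m i (j + 1))) +
      opoly H' ([:w j, 1:] * P j) (ket (slice m i j)))"
    unfolding linear_sum[OF l0] H'_def hop_slice[OF w] ..
  then show ?thesis
    unfolding sum.distrib a b opoly_add[OF lin] by simp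
qed

text \<open>The ansatz for \<Phi> is the sum over \<open>j\<close> of q_j(z - H') applied to the
  sites of the line. As H' commutes with the motion in direction \<open>i\<close>, the
  one-dimensional equation at energy z - t carries over with H' in place of t, up to the end values
  of \<open>q\<close>. Approximating real and imaginary parts by polynomials gives the substitution
  a meaning.\<close>

lemma slice_approx:
  fixes i :: "'n::finite" and m :: "int ^ 'n" and R :: nat and q :: "int \<Rightarrow> complex \<Rightarrow> complex"
    and w :: "int \<Rightarrow> real" and C :: real
  defines "B' \<equiv> real (card (trans_nb i :: (int ^ 'n) set)) + real CARD('n) * C + 1"
  assumes w: "\<And>n. \<bar>w n\<bar> \<le> C" and z: "0 < Im z" and e: "0 < e"
    and cont: "\<And>j. continuous_on {z. 0 < Im z} (q j)"
    and out: "\<And>j z. int R < \<bar>j\<bar> \<Longrightarrow> q j z = 0"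
    and rec: "\<And>j z. 0 < Im z \<Longrightarrow> \<bar>j\<bar> \<le> int R \<Longrightarrow>
      q (j + 1) z + q (j - 1) z + (of_real (w j) - z) * q j z = of_bool (j = m $ i)"
    and mR: "\<bar>m $ i\<bar> \<le> int R"
    and small: "\<And>j t. \<bar>t\<bar> \<le> B' \<Longrightarrow> \<bar>j\<bar> = int R \<Longrightarrow> cmod (q j (z - of_real t)) \<le> e"
  obtains \<Phi> where "norm (hop neighbours (sepv w UNIV) \<Phi> - scaleC_ell2 z \<Phi> - ket m) \<le> 5 * e"
    "\<And>n. int R < \<bar>n $ i\<bar> \<Longrightarrow> coord \<Phi> n = 0"
proof -
  define H' where "H' = hop (trans_nb i) (sepv w (- {i}) :: int ^ 'n \<Rightarrow> real)"
  define H0 where "H0 = hop neighbours (sepv w (UNIV :: 'n set))"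
  define T where "T = {- int R - 1..int R + 1}"
  interpret symop H' B' unfolding H'_def B'_def by (rule hop_symop[where C = "real CARD('n) * C" and v = "sepv w (- {i})", OF sepv_bound[where w = w and C = C, OF w] uminus_trans_nb])
  have l0: "linear H0" unfolding H0_def by (rule linear_hop[OF sepv_bound[OF w]])
  have s0: "H0 (scaleC_ell2 y u) = scaleC_ell2 y (H0 u)" for y u unfolding H0_def by (rule hop_scaleC[OF sepv_bound[OF w]])
  define E \<eta> where "E = Re z" and "\<eta> = Im z"
  have C0: "0 \<le> C" using w[of 0] by linarith
  define K where "K = 2 + C + \<bar>E\<bar> + B' + \<bar>\<eta>\<bar>"
  have K: "K > 0" using C0 B_pos by (simp add: K_def)
  \<comment> \<open>The error allowed to each polynomial, chosen so that all such errors add up to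
    \<open>e\<close>. The two end layers, in real and imaginary part, add 4 e.\<close>
  define \<tau> where "\<tau> = e / ((2 * real R + 1) * (2 * K) + 4)"
  have den: "0 < (2 * real R + 1) * (2 * K) + 4" using K by (intro add_nonneg_pos mult_nonneg_nonneg) auto
  have \<tau>: "0 < \<tau>" using e den by (simp add: \<tau>_def)
  define Q where "Q j t = q j (z - of_real t)" for j and t :: real
  have cQ: "continuous_on {-B'..B'} (Q j)" for j
    unfolding Q_def by (rule continuous_on_compose2[OF cont]) (use z in \<open>auto intro!: continuous_intros\<close>)
  have "\<exists>p. (\<forall>t\<in>{-B'..B'}. \<bar>Re (Q j t) - poly p t\<bar> < \<tau>) \<and> (int R < \<bar>j\<bar> \<longrightarrow> p = 0)" for j
  proof (cases "int R < \<bar>j\<bar>")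
    case True
    then show ?thesis using out \<tau> by (intro exI[of _ 0]) (simp add: Q_def)
  next
    case False
    have "continuous_on {-B'..B'} (\<lambda>t. Re (Q j t))" by (intro continuous_intros cQ)
    from poly_approx[OF this \<tau>] obtain p where "\<And>t. t \<in> {-B'..B'} \<Longrightarrow> \<bar>Re (Q j t) - poly p t\<bar> < \<tau>" by blast
    then show ?thesis using False by blast
  qed
  then obtain P where P: "\<And>j t. t \<in> {-B'..B'} \<Longrightarrow> \<bar>Re (Q j t) - poly (P j) t\<bar> < \<tau>" "\<And>j. int R < \<bar>j\<bar> \<Longrightarrow> P j = 0" by metis
  have "\<exists>p. (\<forall>t\<in>{-B'..B'}. \<bar>Im (Q j t) - poly p t\<bar> < \<tau>) \<and> (int R < \<bar>j\<bar> \<longrightarrow> p = 0)" for j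
  proof (cases "int R < \<bar>j\<bar>")
    case True
    then show ?thesis using out \<tau> by (intro exI[of _ 0]) (simp add: Q_def)
  next
    case False
    have "continuous_on {-B'..B'} (\<lambda>t. Im (Q j t))" by (intro continuous_intros cQ)
    from poly_approx[OF this \<tau>] obtain p where "\<And>t. t \<in> {-B'..B'} \<Longrightarrow> \<bar>Im (Q j t) - poly p t\<bar> < \<tau>" by blast
    then show ?thesis using False by blast
  qed
  then obtain I where I: "\<And>j t. t \<in> {-B'..B'} \<Longrightarrow> \<bar>Im (Q j t) - poly (I j) t\<bar> < \<tau>" "\<And>j. int R < \<bar>j\<bar> \<Longrightarrow> I j = 0" by metis
  define k where "k j = ket (slice m i j)" for j
  define X where "X = (\<Sum>j\<in>T. opoly H' (P j) (k j))"
  define Y where "Y = (\<Sum>j\<in>T. opoly H' (I j) (k j))"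
  define \<Phi> where "\<Phi> = X + scaleC_ell2 \<i> Y"
  \<comment> \<open>\<open>Pr\<close> and \<open>Pi\<close> are the real and imaginary parts of the
    residual at layer \<open>j\<close>, obtained by expanding (w j - E + t - i \<eta>) (P + i
    I).\<close>
  define Pr where "Pr j = P (j + 1) + P (j - 1) + [:w j - E, 1:] * P j + smult \<eta> (I j) - [:of_bool (j = m $ i):]" for j
  define Pi where "Pi j = I (j + 1) + I (j - 1) + [:w j - E, 1:] * I j - smult \<eta> (P j)" for j
  have H0X: "H0 X = (\<Sum>j\<in>T. opoly H' (P (j + 1) + P (j - 1) + [:w j, 1:] * P j) (k j))"
    unfolding X_def H0_def H'_def T_def k_def by (rule hop_slice_sum[OF w P(2)])
  have H0Y: "H0 Y = (\<Sum>j\<in>T. opoly H' (I (j + 1) + I (j - 1) + [:w j, 1:] * I j) (k j))"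
    unfolding Y_def H0_def H'_def T_def k_def by (rule hop_slice_sum[OF w I(2)])
  have km: "ket m = (\<Sum>j\<in>T. opoly H' [:of_bool (j = m $ i):] (k j))"
  proof -
    have "(\<Sum>j\<in>T. opoly H' [:of_bool (j = m $ i):] (k j)) = (\<Sum>j\<in>T. if j = m $ i then k j else 0)"
      by (rule sum.cong) (auto simp: opoly_const[OF lin])
    also have "\<dots> = ket m" using mR by (auto simp: T_def k_def slice_self)
    finally show ?thesis ..
  qed
  have wE: "[:w j - E, 1:] * p = [:w j, 1:] * p - smult E p" for j p
    by (simp add: smult_diff_left algebra_simps)
  have re: "H0 X - E *\<^sub>R X + \<eta> *\<^sub>R Y - ket m = (\<Sum>j\<in>T. opoly H' (Pr j) (k j))"
    unfolding H0X km unfolding X_def Y_def Pr_def wE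
    by (simp add: opoly_add[OF lin] opoly_diff[OF lin] opoly_smult[OF lin] sum.distrib sum_subtractf scaleR_sum_right algebra_simps)
  have im: "H0 Y - E *\<^sub>R Y - \<eta> *\<^sub>R X = (\<Sum>j\<in>T. opoly H' (Pi j) (k j))"
    unfolding H0Y unfolding X_def Y_def Pi_def wE
    by (simp add: opoly_add[OF lin] opoly_diff[OF lin] opoly_smult[OF lin] sum.distrib sum_subtractf scaleR_sum_right algebra_simps)
  have "H0 \<Phi> - scaleC_ell2 z \<Phi> - ket m = (H0 X - E *\<^sub>R X + \<eta> *\<^sub>R Y - ket m) + scaleC_ell2 \<i> (H0 Y - E *\<^sub>R Y - \<eta> *\<^sub>R X)"
    unfolding \<Phi>_def linear_add[OF l0] s0
    by (rule ell2_eqI) (simp add: complex_eq_iff E_def \<eta>_def algebra_simps)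
  also have "norm \<dots> \<le> norm (\<Sum>j\<in>T. opoly H' (Pr j) (k j)) + norm (\<Sum>j\<in>T. opoly H' (Pi j) (k j))"
    unfolding re im using norm_triangle_ineq[of "\<Sum>j\<in>T. opoly H' (Pr j) (k j)" "scaleC_ell2 \<i> (\<Sum>j\<in>T. opoly H' (Pi j) (k j))"] by simp
  finally have n1: "norm (H0 \<Phi> - scaleC_ell2 z \<Phi> - ket m) \<le> norm (\<Sum>j\<in>T. opoly H' (Pr j) (k j)) + norm (\<Sum>j\<in>T. opoly H' (Pi j) (k j))" .
  define bd where "bd j = (if \<bar>j\<bar> \<le> int R then \<tau> * K else \<tau> + e)" for j
  have point: "\<bar>poly (Pr j) t\<bar> \<le> bd j \<and> \<bar>poly (Pi j) t\<bar> \<le> bd j" if j: "j \<in> T" and t: "t \<in> {-B'..B'}" for j t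
  proof (cases "\<bar>j\<bar> \<le> int R")
    case True
    have rj: "Q (j + 1) t + Q (j - 1) t + (of_real (w j) - (z - of_real t)) * Q j t = of_bool (j = m $ i)"
      unfolding Q_def by (rule rec) (use z True in auto)
    let ?a = "\<lambda>j. poly (P j) t - Re (Q j t)" and ?b = "\<lambda>j. poly (I j) t - Im (Q j t)"
    have ab: "\<bar>?a l\<bar> \<le> \<tau>" "\<bar>?b l\<bar> \<le> \<tau>" for l using P(1)[OF t, of l] I(1)[OF t, of l] by (auto simp: abs_minus_commute less_imp_le)
    define c where "c = w j - E + t"
    have c: "\<bar>c\<bar> \<le> C + \<bar>E\<bar> + B'" using w[of j] t by (auto simp: c_def)
    have "Re (Q (j + 1) t) + Re (Q (j - 1) t) + c * Re (Q j t) + \<eta> * Im (Q j t) = of_bool (j = m $ i)"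
      using arg_cong[OF rj, of Re] by (simp add: c_def E_def \<eta>_def of_bool_def algebra_simps)
    then have pr: "poly (Pr j) t = ?a (j + 1) + ?a (j - 1) + c * ?a j + \<eta> * ?b j"
      by (simp add: Pr_def c_def algebra_simps)
    have "Im (Q (j + 1) t) + Im (Q (j - 1) t) + c * Im (Q j t) - \<eta> * Re (Q j t) = 0"
      using arg_cong[OF rj, of Im] by (simp add: c_def E_def \<eta>_def of_bool_def algebra_simps)
    then have pi: "poly (Pi j) t = ?b (j + 1) + ?b (j - 1) + c * ?b j - \<eta> * ?a j"
      by (simp add: Pi_def c_def algebra_simps)
    have m1: "\<bar>c * x\<bar> \<le> (C + \<bar>E\<bar> + B') * \<tau>" if "\<bar>x\<bar> \<le> \<tau>" for x
      unfolding abs_mult using c that \<tau> by (intro mult_mono) auto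
    have m2: "\<bar>\<eta> * x\<bar> \<le> \<bar>\<eta>\<bar> * \<tau>" if "\<bar>x\<bar> \<le> \<tau>" for x
      unfolding abs_mult using that by (intro mult_left_mono) auto
    have Kt: "\<tau> * K = \<tau> + \<tau> + (C + \<bar>E\<bar> + B') * \<tau> + \<bar>\<eta>\<bar> * \<tau>" by (simp add: K_def algebra_simps)
    have tri: "\<bar>a + b + c + d\<bar> \<le> x + y + u + v \<and> \<bar>a + b + c - d\<bar> \<le> x + y + u + v"
      if "\<bar>a\<bar> \<le> x" "\<bar>b\<bar> \<le> y" "\<bar>c\<bar> \<le> u" "\<bar>d\<bar> \<le> v" for a b c d x y u v :: real
      using that by linarith
    have "\<bar>poly (Pr j) t\<bar> \<le> \<tau> * K"
      unfolding pr Kt by (rule conjunct1[OF tri[OF ab(1) ab(1) m1[OF ab(1)] m2[OF ab(2)]]])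
    moreover have "\<bar>poly (Pi j) t\<bar> \<le> \<tau> * K"
      unfolding pi Kt by (rule conjunct2[OF tri[OF ab(2) ab(2) m1[OF ab(2)] m2[OF ab(1)]]])
    ultimately show ?thesis using True by (simp add: bd_def)
  next
    case False
    then have jR: "j = int R + 1 \<or> j = - int R - 1" using j by (auto simp: T_def)
    \<comment> \<open>On an end layer only the coefficient of the adjacent layer \<open>l\<close>
      survives.\<close>
    define l where "l = (if j = int R + 1 then int R else - int R)"
    have l: "\<bar>l\<bar> = int R" by (simp add: l_def)
    have jm: "j \<noteq> m $ i" using mR False by auto
    have "Pr j = P l" "Pi j = I l"
      using jR jm unfolding Pr_def Pi_def l_def by (auto simp: P(2) I(2))
    moreover have "cmod (Q l t) \<le> e" unfolding Q_def by (rule small) (use t l in auto)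
    then have "\<bar>Re (Q l t)\<bar> \<le> e" "\<bar>Im (Q l t)\<bar> \<le> e"
      using abs_Re_le_cmod abs_Im_le_cmod order_trans by blast+
    ultimately show ?thesis using P(1)[OF t, of l] I(1)[OF t, of l] False by (auto simp: bd_def)
  qed
  have bsum: "norm (\<Sum>j\<in>T. opoly H' (F j) (k j)) \<le> (\<Sum>j\<in>T. bd j)"
    if "\<And>j t. j \<in> T \<Longrightarrow> t \<in> {-B'..B'} \<Longrightarrow> \<bar>poly (F j) t\<bar> \<le> bd j" for F
  proof -
    have "norm (\<Sum>j\<in>T. opoly H' (F j) (k j)) \<le> (\<Sum>j\<in>T. norm (opoly H' (F j) (k j)))" by (rule norm_sum)
    also have "\<dots> \<le> (\<Sum>j\<in>T. bd j)"
    proof (rule sum_mono)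
      fix j assume "j \<in> T"
      from opoly_norm_le[OF that[OF this], of "k j"] show "norm (opoly H' (F j) (k j)) \<le> bd j" by (simp add: k_def)
    qed
    finally show ?thesis .
  qed
  have Tsum: "(\<Sum>j\<in>T. bd j) = (2 * real R + 1) * (\<tau> * K) + 2 * (\<tau> + e)"
  proof -
    have T': "T = insert (int R + 1) (insert (- int R - 1) {- int R..int R})" by (auto simp: T_def)
    have "(\<Sum>j\<in>{- int R..int R}. bd j) = (\<Sum>j\<in>{- int R..int R}. \<tau> * K)"
      by (rule sum.cong) (auto simp: bd_def)
    then show ?thesis unfolding T' by (simp add: bd_def algebra_simps)
  qed
  have "norm (H0 \<Phi> - scaleC_ell2 z \<Phi> - ket m) \<le> 2 * ((2 * real R + 1) * (\<tau> * K) + 2 * (\<tau> + e))"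
    using n1 bsum[of Pr] bsum[of Pi] point unfolding Tsum by fastforce
  also have "\<dots> = \<tau> * ((2 * real R + 1) * (2 * K) + 4) + 4 * e" by (simp add: algebra_simps)
  also have "\<tau> * ((2 * real R + 1) * (2 * K) + 4) = e" using den by (simp add: \<tau>_def)
  finally have main: "norm (H0 \<Phi> - scaleC_ell2 z \<Phi> - ket m) \<le> 5 * e" by simp
  have "coord \<Phi> n = 0" if "int R < \<bar>n $ i\<bar>" for n
  proof -
    have "coord (opoly H' (F j) (k j)) n = 0" if "\<And>j. int R < \<bar>j\<bar> \<Longrightarrow> F j = 0" for F j
    proof (cases "n $ i = j")
      case True
      then show ?thesis using that \<open>int R < \<bar>n $ i\<bar>\<close> by simp
    next
      case False
      then show ?thesis unfolding H'_def k_def by (intro opoly_slice_support[OF w]) (simp add: slice_nth)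
    qed
    then show ?thesis using P(2) I(2) by (simp add: \<Phi>_def X_def Y_def)
  qed
  with main show ?thesis using that unfolding H0_def by blast
qed

section \<open>Decay of resolvents outside a box\<close>

lemma hop_csymop:
  assumes "\<And>n. \<bar>v n\<bar> \<le> C" "uminus ` J = J"
  shows "csymop (hop J v) (real (card J) + C + 1)"
  using hop_symop[where v = v and C = C and J = J, OF assms] hop_scaleC[where v = v and C = C, OF assms(1)]
  by (simp add: csymop_def csymop_axioms_def)

lemma (in csymop) resolvent_ex:
  assumes "Im z \<noteq> 0"
  shows "\<exists>u. A u - scaleC_ell2 z u = y"
  using bij_is_surj[OF bij_resolvent[OF assms]] unfolding surj_def by metis

lemma (in csymop) resolvent_norm_le:
  assumes "0 < Im z"
  shows "norm u \<le> norm (A u - scaleC_ell2 z u) / Im z"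
  using norm_resolvent_ge[of z u] assms by (simp add: pos_le_divide_eq mult.commute)

lemma compl_cube: "- cube 0 R = (\<Union>i\<in>UNIV. {n :: int ^ 'n. int R < \<bar>n $ i\<bar>})"
  by (auto simp: cube_def not_le[symmetric])

text \<open>Outside the cube some coordinate exceeds \<open>R\<close> in modulus. For each
  direction, \<open>u\<close> is within 5 e / Im z of a vector that vanishes where that coordinate
  is so large, and the contributions of the directions add up.\<close>

lemma sep_resolvent_outside:
  fixes w :: "int \<Rightarrow> real" and q :: "int \<Rightarrow> int \<Rightarrow> complex \<Rightarrow> complex" and m :: "int ^ 'n"
  assumes w: "\<And>n. \<bar>w n\<bar> \<le> C" and z: "0 < Im z" and e: "0 < e" and rR: "r \<le> R"
    and cont: "\<And>m j. \<bar>m\<bar> \<le> int r \<Longrightarrow> continuous_on {z. 0 < Im z} (q m j)"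
    and out: "\<And>m j z. int R < \<bar>j\<bar> \<Longrightarrow> q m j z = 0"
    and rec: "\<And>m j z. \<bar>m\<bar> \<le> int r \<Longrightarrow> 0 < Im z \<Longrightarrow> \<bar>j\<bar> \<le> int R \<Longrightarrow>
      q m (j + 1) z + q m (j - 1) z + (of_real (w j) - z) * q m j z = of_bool (j = m)"
    and small: "\<And>m j t. \<bar>m\<bar> \<le> int r \<Longrightarrow> \<bar>t\<bar> \<le> 2 * real CARD('n) + real CARD('n) * C + 1 \<Longrightarrow> \<bar>j\<bar> = int R \<Longrightarrow>
      cmod (q m j (z - of_real t)) \<le> e"
    and m: "m \<in> cube 0 r" and u: "hop neighbours (sepv w UNIV) u - scaleC_ell2 z u = ket m"
  shows "norm (proj (- cube 0 R) u) \<le> real CARD('n) * (5 * e / Im z)"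
proof -
  interpret csymop "hop neighbours (sepv w (UNIV :: 'n set))" "real (card (neighbours :: (int ^ 'n) set)) + real CARD('n) * C + 1"
    by (rule hop_csymop[where C = "real CARD('n) * C" and v = "sepv w UNIV", OF sepv_bound[where w = w and C = C, OF w] uminus_neighbours])
  have "norm (proj {n. int R < \<bar>n $ i\<bar>} u) \<le> 5 * e / Im z" for i
  proof -
    have mi: "\<bar>m $ i\<bar> \<le> int r" using m by (simp add: cube_def)
    have cd: "real (card (trans_nb i :: (int ^ 'n) set)) \<le> 2 * real CARD('n)"
      using card_mono[of neighbours "trans_nb i"] card_neighbours[where 'n = 'n] by (auto simp: trans_nb_def)
    obtain \<Phi> where \<Phi>: "norm (hop neighbours (sepv w UNIV) \<Phi> - scaleC_ell2 z \<Phi> - ket m) \<le> 5 * e"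
      "\<And>n. int R < \<bar>n $ i\<bar> \<Longrightarrow> coord \<Phi> n = 0"
    proof (rule slice_approx[of w C z e "q (m $ i)" R m i])
      show "\<bar>m $ i\<bar> \<le> int R" using mi rR by simp
      show "cmod (q (m $ i) j (z - of_real t)) \<le> e"
        if "\<bar>t\<bar> \<le> real (card (trans_nb i)) + real CARD('n) * C + 1" "\<bar>j\<bar> = int R" for j t
        by (rule small[OF mi _ that(2)]) (use that(1) cd in linarith)
    qed (use w z e cont out rec mi in auto)
    have "hop neighbours (sepv w UNIV) (\<Phi> - u) - scaleC_ell2 z (\<Phi> - u) =
      hop neighbours (sepv w UNIV) \<Phi> - scaleC_ell2 z \<Phi> - ket m"
      unfolding linear_diff[OF lin] scaleC_diff u[symmetric] by simp
    then have "norm (\<Phi> - u) \<le> 5 * e / Im z"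
      using resolvent_norm_le[OF z, of "\<Phi> - u"] \<Phi>(1) z by (smt (verit) divide_right_mono)
    moreover have "proj {n. int R < \<bar>n $ i\<bar>} u = proj {n. int R < \<bar>n $ i\<bar>} (u - \<Phi>)"
      by (rule ell2_eqI) (simp add: \<Phi>(2))
    ultimately show ?thesis
      using norm_proj_le[of "{n. int R < \<bar>n $ i\<bar>}" "u - \<Phi>"] by (simp add: norm_minus_commute)
  qed
  then have "(\<Sum>i\<in>UNIV. norm (proj {n. int R < \<bar>n $ i\<bar>} u)) \<le> (\<Sum>i\<in>(UNIV :: 'n set). 5 * e / Im z)"
    by (intro sum_mono)
  moreover have "norm (proj (- cube 0 R) u) \<le> (\<Sum>i\<in>UNIV. norm (proj {n. int R < \<bar>n $ i\<bar>} u))"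
    unfolding compl_cube by (rule norm_proj_Union_le) simp
  ultimately show ?thesis by simp
qed

text \<open>The second resolvent identity: for a perturbation supported in \<open>F\<close>, the
  perturbed vector is the unperturbed one at \<open>m\<close> minus a combination of unperturbed
  ones with sources in \<open>F\<close>, the coefficients being at most D / Im z.\<close>

lemma perturbed_resolvent_outside:
  fixes v v0 :: "int ^ 'n \<Rightarrow> real"
  assumes v: "\<And>n. \<bar>v n\<bar> \<le> C" and v0: "\<And>n. \<bar>v0 n\<bar> \<le> C0"
    and eq: "\<And>n. n \<notin> F \<Longrightarrow> v n = v0 n" and F: "finite F" and D: "\<And>n. \<bar>v n - v0 n\<bar> \<le> D"
    and z: "0 < Im z" and m: "m \<in> F"
    and out: "\<And>n u. n \<in> F \<Longrightarrow> hop neighbours v0 u - scaleC_ell2 z u = ket n \<Longrightarrow> norm (proj S u) \<le> e"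
    and u: "hop neighbours v u - scaleC_ell2 z u = ket m"
  shows "norm (proj S u) \<le> (1 + real (card F) * D / Im z) * e"
proof -
  interpret A: csymop "hop neighbours v" "real (card (neighbours :: (int ^ 'n) set)) + C + 1"
    by (rule hop_csymop[where v = v and C = C, OF v uminus_neighbours])
  interpret A0: csymop "hop neighbours v0" "real (card (neighbours :: (int ^ 'n) set)) + C0 + 1"
    by (rule hop_csymop[where v = v0 and C = C0, OF v0 uminus_neighbours])
  let ?R = "\<lambda>u. hop neighbours v0 u - scaleC_ell2 z u"
  have ex: "\<exists>x. ?R x = ket n" for n by (rule A0.resolvent_ex) (use z in simp)
  define g where "g n = (SOME x. ?R x = ket n)" for n
  have g: "?R (g n) = ket n" for n unfolding g_def by (rule someI_ex[OF ex])
  define c where "c n = of_real (v n - v0 n) * coord u n" for n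
  define u' where "u' = g m - (\<Sum>n\<in>F. scaleC_ell2 (c n) (g n))"
  have linR: "linear ?R" by (rule A0.linear_resolvent)
  have Rc: "?R (scaleC_ell2 y x) = scaleC_ell2 y (?R x)" for y x
    by (simp add: A0.A_scaleC scaleC_diff mult.commute)
  have "?R u' = ket m - (\<Sum>n\<in>F. scaleC_ell2 (c n) (ket n))"
    unfolding u'_def linear_diff[OF linR] linear_sum[OF linR] Rc g ..
  also have "\<dots> = ?R u"
  proof (rule ell2_eqI)
    fix k
    have "coord (hop neighbours v u) k = coord (hop neighbours v0 u) k + c k"
      by (simp add: coord_hop[where v = v and C = C, OF v] coord_hop[where v = v0 and C = C0, OF v0] c_def algebra_simps)
    moreover have "coord (hop neighbours v u) k - z * coord u k = of_bool (k = m)"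
      using arg_cong[OF u, of "\<lambda>u. coord u k"] by simp
    moreover have "(\<Sum>n\<in>F. c n * of_bool (k = n)) = c k"
      using F eq[of k] by (cases "k \<in> F") (auto simp: of_bool_def if_distrib c_def cong: if_cong)
    ultimately show "coord (ket m - (\<Sum>n\<in>F. scaleC_ell2 (c n) (ket n))) k = coord (?R u) k"
      by (simp add: algebra_simps)
  qed
  finally have "?R u' = ?R u" .
  have uu: "u = u'"
  proof -
    have "inj ?R" using z by (intro bij_is_inj A0.bij_resolvent) simp
    then show ?thesis by (rule injD) (rule \<open>?R u' = ?R u\<close>[symmetric])
  qed
  have nu: "norm u \<le> 1 / Im z" using A.resolvent_norm_le[OF z, of u] u by simp
  have e0: "0 \<le> e" using out[OF m g] norm_ge_zero order_trans by blast
  have "norm (proj S u) \<le> norm (proj S (g m)) + norm (\<Sum>n\<in>F. scaleC_ell2 (c n) (proj S (g n)))"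
    unfolding uu u'_def linear_diff[OF linear_proj] linear_sum[OF linear_proj] proj_scaleC
    by (rule norm_triangle_ineq4)
  also have "\<dots> \<le> e + (\<Sum>n\<in>F. D * (1 / Im z) * e)"
  proof (intro add_mono out[OF m g] order_trans[OF norm_sum] sum_mono)
    fix n assume n: "n \<in> F"
    have "cmod (c n) \<le> D * (1 / Im z)"
      unfolding c_def norm_mult norm_of_real using D[of n] coord_le_norm[of u n] nu by (intro mult_mono) auto
    then show "norm (scaleC_ell2 (c n) (proj S (g n))) \<le> D * (1 / Im z) * e"
      unfolding norm_scaleC using out[OF n g] e0 by (intro mult_mono) (auto intro: order_trans[OF norm_ge_zero])
  qed
  also have "\<dots> = (1 + real (card F) * D / Im z) * e" by (simp add: algebra_simps)
  finally show ?thesis .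
qed

section \<open>Compression to a finite box\<close>

context csymop
begin

lemma compression_csymop: "csymop (\<lambda>u. proj S (A (proj S u))) B"
proof -
  have "symop (\<lambda>u. proj S (A (proj S u))) B"
  proof (rule symop.intro)
    show "linear (\<lambda>u. proj S (A (proj S u)))"
      using linear_compose[OF linear_compose[OF linear_proj lin] linear_proj] by (simp add: o_def)
    show "inner (proj S (A (proj S x))) y = inner x (proj S (A (proj S y)))" for x y
      by (simp add: inner_proj sym)
    show "norm (proj S (A (proj S x))) \<le> B * norm x" for x
      using norm_proj_le[of S "A (proj S x)"] bound[of "proj S x"] mult_left_mono[OF norm_proj_le[of S x], of B] B_pos
      by linarith
  qed (rule B_pos)
  then show ?thesis by (simp add: csymop_def csymop_axioms_def proj_scaleC A_scaleC)
qed

text \<open>The difference inside \<open>S\<close> solves the compressed equation with right-hand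
  side \<open>- proj S (A (proj (- S) u))\<close>, the leakage of the tail of \<open>u\<close> back
  into \<open>S\<close>.\<close>

lemma compression_resolvent_close:
  assumes z: "0 < Im z" and m: "m \<in> S"
    and u: "A u - scaleC_ell2 z u = ket m"
    and uS: "proj S (A (proj S uS)) - scaleC_ell2 z uS = ket m"
  shows "cmod (coord u m - coord uS m) \<le> B * norm (proj (- S) u) / Im z"
proof -
  interpret S: csymop "\<lambda>u. proj S (A (proj S u))" B by (rule compression_csymop)
  define d where "d = proj S u - uS"
  have split: "A u = A (proj S u) + A (proj (- S) u)"
  proof -
    have "u = proj S u + proj (- S) u" by (rule ell2_eqI) simp
    then show ?thesis using linear_add[OF lin] by metis
  qed
  have km: "proj S (ket m) = ket m" by (rule ell2_eqI) (use m in auto)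
  have "proj S (A (proj S u)) - scaleC_ell2 z (proj S u) = proj S (A u - scaleC_ell2 z u) - proj S (A (proj (- S) u))"
    unfolding split linear_diff[OF linear_proj] linear_add[OF linear_proj] proj_scaleC by simp
  then have e: "proj S (A (proj S u)) - scaleC_ell2 z (proj S u) = ket m - proj S (A (proj (- S) u))"
    unfolding u km .
  have pp: "proj S (proj S u) = proj S u" by (rule ell2_eqI) simp
  have "proj S (A (proj S d)) - scaleC_ell2 z d = - proj S (A (proj (- S) u))"
  proof -
    have "proj S (A (proj S d)) - scaleC_ell2 z d =
      (proj S (A (proj S u)) - scaleC_ell2 z (proj S u)) - (proj S (A (proj S uS)) - scaleC_ell2 z uS)"
      unfolding d_def linear_diff[OF linear_proj] pp linear_diff[OF lin] scaleC_diff by simp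
    then show ?thesis unfolding e uS by simp
  qed
  then have "norm d \<le> norm (proj S (A (proj (- S) u))) / Im z"
    using S.resolvent_norm_le[OF z, of d] by simp
  also have "\<dots> \<le> B * norm (proj (- S) u) / Im z"
    using norm_proj_le[of S "A (proj (- S) u)"] bound[of "proj (- S) u"] z by (intro divide_right_mono) auto
  finally have "norm d \<le> B * norm (proj (- S) u) / Im z" .
  moreover have "coord d m = coord u m - coord uS m" using m by (simp add: d_def)
  ultimately show ?thesis using coord_le_norm[of d m] by simp
qed

text \<open>With (A - z)(A - cnj z) y = ket m, the resolvent vector is (A - cnj z) y. Matrix
  elements of real polynomials between \<open>y\<close> and \<open>ket m\<close> are real, so only
  Im z times the \<open>m\<close>-th coordinate of \<open>y\<close> survives, and
  \<open>SM_resolvent\<close> evaluates it.\<close>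

lemma Im_resolvent:
  assumes z: "0 < Im z" and u: "A u - scaleC_ell2 z u = ket m"
  shows "Im (coord u m) = (\<integral>t. Im z / ((t - Re z)\<^sup>2 + (Im z)\<^sup>2) \<partial>SM (ket m))"
proof -
  obtain y where y: "opoly A (Tq (Re z) (Im z)) y = ket m"
    using bij_is_surj[OF bij_Tq[of "Im z" "Re z"]] z unfolding surj_def by (metis less_irrefl)
  have "A (A y - scaleC_ell2 (cnj z) y) - scaleC_ell2 z (A y - scaleC_ell2 (cnj z) y) = ket m"
    using y unfolding opoly_Tq_scaleC .
  then have eq: "A u - scaleC_ell2 z u =
      A (A y - scaleC_ell2 (cnj z) y) - scaleC_ell2 z (A y - scaleC_ell2 (cnj z) y)"
    using u by simp
  have "inj (\<lambda>u. A u - scaleC_ell2 z u)" using z by (intro bij_is_inj bij_resolvent) simp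
  then have uy: "u = A y - scaleC_ell2 (cnj z) y" by (rule injD) (rule eq)
  have im0: "Im (cinner_ell2 (ket m) (opoly A p y)) = 0" for p
  proof -
    have "inner (scaleC_ell2 \<i> (opoly A (Tq (Re z) (Im z)) y)) (opoly A p y) =
      inner (scaleC_ell2 \<i> y) (opoly A (Tq (Re z) (Im z) * p) y)"
      by (simp add: opoly_scaleC[symmetric] opoly_sym opoly_mult[OF lin])
    then show ?thesis by (simp add: cinner_eq y[symmetric] inner_i_opoly)
  qed
  have c1: "Im (coord (A y) m) = 0"
    using im0[of "[:0, 1:]"] by (simp add: cinner_ket opoly_linear_factor[OF lin])
  have c2: "Im (coord y m) = 0"
    using im0[of 1] by (simp add: cinner_ket opoly_1[OF lin])
  have "Im (coord u m) = Im z * Re (coord y m)"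
    unfolding uy using c1 c2 by simp
  also have "Re (coord y m) = (\<integral>t. 1 / poly (Tq (Re z) (Im z)) t \<partial>SM (ket m))"
    unfolding inner_ket[symmetric]
    by (rule SM_resolvent[OF y]) (use z in \<open>simp add: poly_Tq add_nonneg_pos\<close>)
  also have "Im z * \<dots> = (\<integral>t. Im z * (1 / poly (Tq (Re z) (Im z)) t) \<partial>SM (ket m))"
    by (rule integral_mult_right_zero[symmetric])
  finally show ?thesis by (simp add: poly_Tq)
qed

end

text \<open>The iterates of \<open>x\<close> up to exponent card F are linearly dependent, so a
  nonzero polynomial of degree at most card F annihilates \<open>x\<close>. The integral of its
  square is 0, hence its roots carry the measure.\<close>

lemma (in symop) SM_finite_support:
  assumes F: "finite F" and k: "\<And>k. (A ^^ k) x \<in> span F"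
  obtains Z where "finite Z" "card Z \<le> card F" "AE t in SM x. t \<in> Z"
proof -
  have "\<exists>p. p \<noteq> 0 \<and> degree p \<le> card F \<and> opoly A p x = 0"
  proof (cases "inj_on (\<lambda>k. (A ^^ k) x) {..card F}")
    \<comment> \<open>\<open>dependent\<close> speaks of sets, so coinciding iterates are treated
      apart; they give a difference of two monomials at once.\<close>
    case False
    then obtain i j where ij: "i \<le> card F" "j \<le> card F" "i \<noteq> j" "(A ^^ i) x = (A ^^ j) x"
      by (auto simp: inj_on_def)
    define p :: "real poly" where "p = monom 1 i - monom 1 j"
    have "coeff p i = 1" using ij by (simp add: p_def)
    then have "p \<noteq> 0" by auto
    moreover have "degree p \<le> card F"
      unfolding p_def using ij by (intro degree_diff_le order_trans[OF degree_monom_le]) auto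
    ultimately show ?thesis using ij by (intro exI[of _ p]) (simp add: p_def opoly_diff[OF lin] opoly_monom[OF lin])
  next
    case inj: True
    let ?S = "(\<lambda>k. (A ^^ k) x) ` {..card F}"
    have "dependent ?S"
    proof (rule ccontr)
      assume "\<not> dependent ?S"
      then have "card ?S \<le> card F" using independent_span_bound[OF F, of ?S] k by auto
      then show False using card_image[OF inj] by simp
    qed
    then obtain c y where c: "(\<Sum>v\<in>?S. c v *\<^sub>R v) = 0" "y \<in> ?S" "c y \<noteq> 0"
      using dependent_finite[of ?S] by auto
    define p where "p = (\<Sum>k\<le>card F. monom (c ((A ^^ k) x)) k)"
    have cp: "coeff p k = c ((A ^^ k) x)" if "k \<le> card F" for k
      using that by (simp add: p_def coeff_sum)
    obtain l where "l \<le> card F" "y = (A ^^ l) x" using c(2) by auto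
    then have "p \<noteq> 0" using cp c(3) by (metis coeff_0)
    moreover have "degree p \<le> card F" unfolding p_def
      by (intro degree_sum_le) (auto intro: order_trans[OF degree_monom_le])
    moreover have "opoly A p x = 0"
    proof -
      have "opoly A p x = (\<Sum>k\<le>card F. c ((A ^^ k) x) *\<^sub>R (A ^^ k) x)"
        unfolding p_def opoly_sum[OF lin]
        by (intro sum.cong refl) (metis opoly_monom[OF lin] opoly_smult[OF lin] mult.right_neutral smult_monom)
      also have "\<dots> = 0" using c(1) by (simp add: sum.reindex[OF inj])
      finally show ?thesis .
    qed
    ultimately show ?thesis by blast
  qed
  then obtain p where p: "p \<noteq> 0" "degree p \<le> card F" "opoly A p x = 0" by blast
  have "(\<integral>t. (poly p t)\<^sup>2 \<partial>SM x) = 0" using norm_opoly[of p x] p(3) by simp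
  moreover have "integrable (SM x) (\<lambda>t. (poly p t)\<^sup>2)"
  proof -
    have "(\<lambda>t. (poly p t)\<^sup>2) = poly (p\<^sup>2)" by (simp add: fun_eq_iff)
    then show ?thesis by simp
  qed
  ultimately have "AE t in SM x. (poly p t)\<^sup>2 = 0"
    by (subst (asm) integral_nonneg_eq_0_iff_AE) auto
  then have "AE t in SM x. t \<in> {t. poly p t = 0}" by simp
  moreover have "finite {t. poly p t = 0}" by (rule poly_roots_finite[OF p(1)])
  moreover have "card {t. poly p t = 0} \<le> card F"
    using card_poly_roots_bound[OF p(1)] p(2) by simp
  ultimately show ?thesis using that by blast
qed

section \<open>Poisson smoothing\<close>

text \<open>\<pi> times the Poisson kernel of the upper half-plane at height \<open>h\<close>; its
  total mass is \<pi>.\<close>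

definition poisson :: "real \<Rightarrow> real \<Rightarrow> real" where
  "poisson h s = h / (s\<^sup>2 + h\<^sup>2)"

lemma poisson_bounds:
  assumes "0 < h"
  shows "0 \<le> poisson h s" "poisson h s \<le> 1 / h"
proof -
  show "0 \<le> poisson h s" using assms by (simp add: poisson_def)
  have "h / (s\<^sup>2 + h\<^sup>2) \<le> h / h\<^sup>2" using assms by (intro divide_left_mono) (auto intro!: mult_pos_pos add_nonneg_pos)
  then show "poisson h s \<le> 1 / h" using assms by (simp add: poisson_def power2_eq_square)
qed

lemma poisson_measurable [measurable]: "poisson h \<in> borel_measurable borel"
  unfolding poisson_def[abs_def] by measurable

text \<open>Up to sign the difference quotient is h (s + t) / (a b). As 2 h |s| <= a and 2 h |t| <=
  b, it is at most the mean of 1 / a and 1 / b.\<close>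

lemma poisson_lipschitz:
  assumes h: "0 < h"
  shows "\<bar>poisson h s - poisson h t\<bar> \<le> \<bar>s - t\<bar> / h\<^sup>2"
proof -
  define a b where "a = s\<^sup>2 + h\<^sup>2" and "b = t\<^sup>2 + h\<^sup>2"
  have ab: "h\<^sup>2 \<le> a" "h\<^sup>2 \<le> b" "0 < h\<^sup>2" using h by (auto simp: a_def b_def)
  then have pos: "0 < a" "0 < b" by linarith+
  have "poisson h s - poisson h t = (h * (t + s)) * (t - s) / (a * b)"
    using pos unfolding poisson_def a_def[symmetric] b_def[symmetric]
    by (simp add: field_simps) (simp add: a_def b_def power2_eq_square algebra_simps)
  also have "\<bar>\<dots>\<bar> = \<bar>h * (t + s)\<bar> * \<bar>s - t\<bar> / (a * b)"
    using pos by (simp add: abs_mult abs_minus_commute)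
  also have "\<dots> \<le> ((a + b) / 2) * \<bar>s - t\<bar> / (a * b)"
  proof (intro divide_right_mono mult_right_mono)
    have "0 \<le> (\<bar>s\<bar> - h)\<^sup>2" "0 \<le> (\<bar>t\<bar> - h)\<^sup>2" by simp_all
    then have "2 * (h * \<bar>s\<bar>) \<le> a" "2 * (h * \<bar>t\<bar>) \<le> b" unfolding a_def b_def power2_diff by (simp_all add: mult_ac)
    then have "h * \<bar>t\<bar> + h * \<bar>s\<bar> \<le> (a + b) / 2" by simp
    moreover have "\<bar>h * (t + s)\<bar> \<le> h * \<bar>t\<bar> + h * \<bar>s\<bar>"
      using h abs_triangle_ineq[of t s] by (simp add: abs_mult distrib_left[symmetric])
    ultimately show "\<bar>h * (t + s)\<bar> \<le> (a + b) / 2" by (rule order_trans[rotated])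
  qed (use pos in auto)
  also have "\<dots> = (1 / a + 1 / b) / 2 * \<bar>s - t\<bar>" using pos by (simp add: field_simps)
  also have "\<dots> \<le> (1 / h\<^sup>2) * \<bar>s - t\<bar>"
  proof (rule mult_right_mono)
    have "1 / a \<le> 1 / h\<^sup>2" "1 / b \<le> 1 / h\<^sup>2" using ab pos by (auto intro!: divide_left_mono mult_pos_pos)
    then have "1 / a + 1 / b \<le> 1 / h\<^sup>2 + 1 / h\<^sup>2" by (rule add_mono)
    then show "(1 / a + 1 / b) / 2 \<le> 1 / h\<^sup>2" by simp
  qed simp
  finally show ?thesis by simp
qed

lemma poisson_integral_Icc:
  assumes h: "0 < h" and ab: "a \<le> b"
  shows "has_bochner_integral lborel (\<lambda>E. poisson h (t - E) * indicator {a..b} E) (arctan ((b - t) / h) - arctan ((a - t) / h))"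
proof (rule has_bochner_integral_FTC_Icc_real[OF ab])
  fix x :: real
  have "((\<lambda>E. arctan ((E - t) / h)) has_real_derivative (1 / h * (1 / (1 + ((x - t) / h)\<^sup>2)))) (at x)"
    using h by (auto intro!: derivative_eq_intros simp: field_simps)
  moreover have "1 / h * (1 / (1 + ((x - t) / h)\<^sup>2)) = poisson h (t - x)"
    using h unfolding poisson_def power2_commute[of t x] by (simp add: field_simps power2_eq_square)
  ultimately show "((\<lambda>E. arctan ((E - t) / h)) has_real_derivative poisson h (t - x)) (at x)" by simp
  show "isCont (\<lambda>E. poisson h (t - E)) x"
    unfolding poisson_def using h by (intro continuous_intros) (simp add: sum_power2_eq_zero_iff)
qed

text \<open>\<open>F\<close> is the Poisson smoothing of the indicator of \<open>U\<close>, the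
  closed M h-neighbourhood of the points of \<open>Z\<close> in [-B, B]. It is at least c \<pi> at
  these points and at most (1 - c) \<pi> at distance beyond 2 M h from them. So its \<mu>'-integral
  is at least c \<pi>, its \<mu>-integral is hardly smaller, and f = (1 - F / \<pi>) / c has a small
  integral for \<open>c\<close> near 1 while being at least 1 far from the points.\<close>

lemma poisson_concentration:
  fixes \<mu> \<mu>' :: "real measure"
  assumes fin: "finite_measure \<mu>" "finite_measure \<mu>'" and sets: "sets \<mu> = sets borel" "sets \<mu>' = sets borel"
    and mass: "measure \<mu> UNIV = 1" "measure \<mu>' UNIV = 1"
    and bd': "AE t in \<mu>'. \<bar>t\<bar> \<le> B" and Z: "finite Z" "AE t in \<mu>'. t \<in> Z" and B: "0 < B"
    and h: "0 < h" and M: "0 < M" "M * h \<le> 1"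
    and close: "\<And>E. \<bar>E\<bar> \<le> B + 1 \<Longrightarrow> \<bar>(\<integral>t. poisson h (t - E) \<partial>\<mu>) - (\<integral>t. poisson h (t - E) \<partial>\<mu>')\<bar> \<le> \<omega>"
  defines "c \<equiv> 2 * arctan M / pi"
  obtains f where "continuous_on UNIV f" "\<And>t. 0 \<le> f t"
    "\<And>t. \<bar>t\<bar> \<le> B \<Longrightarrow> f t < 1 \<Longrightarrow> \<exists>e\<in>Z. \<bar>t - e\<bar> \<le> 2 * M * h"
    "(\<integral>t. f t \<partial>\<mu>) \<le> (1 - c + (2 * B + 2) * \<omega> / pi) / c"
    "\<And>t. f t \<le> 1 / c"
proof -
  interpret m: finite_measure \<mu> by (rule fin)
  interpret m': finite_measure \<mu>' by (rule fin)
  note [measurable_cong] = sets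
  have space: "space \<mu> = UNIV" "space \<mu>' = UNIV"
    using sets_eq_imp_space_eq[OF sets(1)] sets_eq_imp_space_eq[OF sets(2)] by simp_all
  have \<omega>: "0 \<le> \<omega>" using close[of 0] B by linarith
  have cpos: "0 < c" using M by (simp add: c_def)
  have Mh: "0 < M * h" using M h by simp
  define Z' where "Z' = Z \<inter> {-B..B}"
  define U where "U = (\<Union>e\<in>Z'. {e - M * h..e + M * h})"
  define J where "J = {-(B + 1)..B + 1}"
  have UJ: "U \<subseteq> J" using M by (auto simp: U_def J_def Z'_def)
  have Um [measurable]: "U \<in> sets borel" unfolding U_def using Z(1) by (intro sets.finite_UN) (auto simp: Z'_def)
  have pm: "(\<lambda>E. poisson h (t - E) * indicator U E) \<in> borel_measurable borel" for t by measurable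
  have intU: "integrable lborel (\<lambda>E. poisson h (t - E) * indicator U E)" for t
  proof (rule integrableI_bounded_set[where A = J and B = "1 / h"])
    show "AE x in lborel. x \<in> J \<longrightarrow> norm (poisson h (t - x) * indicator U x) \<le> 1 / h"
      using poisson_bounds[OF h] h by (auto simp: indicator_def)
    show "AE x in lborel. x \<notin> J \<longrightarrow> poisson h (t - x) * indicator U x = 0"
      using UJ by (auto simp: indicator_def)
  qed (auto simp: J_def emeasure_lborel_Icc_eq)
  define F where "F t = (\<integral>E. poisson h (t - E) * indicator U E \<partial>lborel)" for t
  have F0: "0 \<le> F t" for t unfolding F_def
    by (rule Bochner_Integration.integral_nonneg) (simp add: poisson_bounds h)
  note I = has_bochner_integral_integral_eq[OF poisson_integral_Icc[OF h]] 
  note Ii = integrable.intros[OF poisson_integral_Icc[OF h]]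
  have Fle: "F t \<le> pi" and Ffar: "(\<And>e. e \<in> Z' \<Longrightarrow> 2 * M * h < \<bar>t - e\<bar>) \<Longrightarrow> F t \<le> pi - 2 * arctan M" for t
  proof -
    \<comment> \<open>Makes the interval of radius \<open>T\<close> about \<open>t\<close> contain
      \<open>J\<close> for every position of \<open>t\<close>.\<close>
    define T where "T = \<bar>t\<bar> + B + 1"
    have T: "0 < T" "M * h \<le> T" using B M by (auto simp: T_def)
    have UT: "U \<subseteq> {t - T..t + T}"
    proof
      fix x assume "x \<in> U"
      then have "x \<in> J" using UJ by blast
      then show "x \<in> {t - T..t + T}" by (auto simp: J_def T_def)
    qed
    have IT: "(\<integral>E. poisson h (t - E) * indicator {t - T..t + T} E \<partial>lborel) = 2 * arctan (T / h)"
      by (subst I) (use T in \<open>simp_all add: arctan_minus\<close>)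
    have at: "2 * arctan (T / h) \<le> pi" using arctan_ubound[of "T / h"] by simp
    have "F t \<le> (\<integral>E. poisson h (t - E) * indicator {t - T..t + T} E \<partial>lborel)"
      unfolding F_def
      by (rule Bochner_Integration.integral_mono[OF intU Ii]) (use T UT poisson_bounds[OF h] in \<open>auto simp: indicator_def\<close>)
    then show "F t \<le> pi" using IT at by simp
    assume far: "\<And>e. e \<in> Z' \<Longrightarrow> 2 * M * h < \<bar>t - e\<bar>"
    have disj: "E \<notin> {t - M * h..t + M * h}" if "E \<in> U" for E
    proof
      assume E: "E \<in> {t - M * h..t + M * h}"
      obtain e where "e \<in> Z'" "E \<in> {e - M * h..e + M * h}" using \<open>E \<in> U\<close> by (auto simp: U_def)
      then have "\<bar>t - e\<bar> \<le> 2 * M * h" using E by auto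
      then show False using far[OF \<open>e \<in> Z'\<close>] by simp
    qed
    have sub: "{t - M * h..t + M * h} \<subseteq> {t - T..t + T}" using T by auto
    have IM: "(\<integral>E. poisson h (t - E) * indicator {t - M * h..t + M * h} E \<partial>lborel) = 2 * arctan M"
      by (subst I) (use Mh h in \<open>simp_all add: arctan_minus\<close>)
    have "F t \<le> (\<integral>E. poisson h (t - E) * indicator {t - T..t + T} E - poisson h (t - E) * indicator {t - M * h..t + M * h} E \<partial>lborel)"
      unfolding F_def
    proof (rule Bochner_Integration.integral_mono[OF intU])
      show "integrable lborel (\<lambda>E. poisson h (t - E) * indicator {t - T..t + T} E - poisson h (t - E) * indicator {t - M * h..t + M * h} E)"
        by (intro Bochner_Integration.integrable_diff Ii) (use T Mh in auto)
      fix E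
      show "poisson h (t - E) * indicator U E \<le> poisson h (t - E) * indicator {t - T..t + T} E - poisson h (t - E) * indicator {t - M * h..t + M * h} E"
        using disj[of E] UT sub poisson_bounds(1)[OF h, of "t - E"] by (auto simp: indicator_def)
    qed
    also have "\<dots> = 2 * arctan (T / h) - 2 * arctan M"
      by (subst Bochner_Integration.integral_diff) (use T Mh IT IM in \<open>auto intro!: Ii\<close>)
    finally show "F t \<le> pi - 2 * arctan M" using at by simp
  qed
  have Fnear: "2 * arctan M \<le> F e" if "e \<in> Z'" for e
  proof -
    have "2 * arctan M = (\<integral>E. poisson h (e - E) * indicator {e - M * h..e + M * h} E \<partial>lborel)"
      by (subst I) (use Mh h in \<open>simp_all add: arctan_minus\<close>)
    also have "\<dots> \<le> F e" unfolding F_def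
      by (rule Bochner_Integration.integral_mono[OF Ii intU]) (use Mh that poisson_bounds[OF h] in \<open>auto simp: indicator_def U_def\<close>)
    finally show ?thesis .
  qed
  have Flip: "\<bar>F s - F t\<bar> \<le> (2 * B + 2) / h\<^sup>2 * \<bar>s - t\<bar>" for s t
  proof -
    have "F s - F t = (\<integral>E. poisson h (s - E) * indicator U E - poisson h (t - E) * indicator U E \<partial>lborel)"
      unfolding F_def by (rule Bochner_Integration.integral_diff[symmetric]) (rule intU)+
    also have "\<bar>\<dots>\<bar> \<le> (\<integral>E. \<bar>poisson h (s - E) * indicator U E - poisson h (t - E) * indicator U E\<bar> \<partial>lborel)"
      by (rule integral_abs_bound)
    also have "\<dots> \<le> (\<integral>E. \<bar>s - t\<bar> / h\<^sup>2 * indicator J E \<partial>lborel)"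
    proof (rule Bochner_Integration.integral_mono)
      show "integrable lborel (\<lambda>E. \<bar>poisson h (s - E) * indicator U E - poisson h (t - E) * indicator U E\<bar>)"
        by (intro integrable_abs Bochner_Integration.integrable_diff intU)
      show "integrable lborel (\<lambda>E. \<bar>s - t\<bar> / h\<^sup>2 * indicator J E)"
        by (intro integrable_mult_right integrable_real_indicator) (auto simp: J_def emeasure_lborel_Icc_eq)
      show "\<bar>poisson h (s - E) * indicator U E - poisson h (t - E) * indicator U E\<bar> \<le> \<bar>s - t\<bar> / h\<^sup>2 * indicator J E" for E
        using poisson_lipschitz[OF h, of "s - E" "t - E"] UJ by (auto simp: indicator_def)
    qed
    also have "\<dots> = (2 * B + 2) / h\<^sup>2 * \<bar>s - t\<bar>" using B by (simp add: J_def)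
    finally show ?thesis .
  qed
  have Fcont: "continuous_on UNIV F"
  proof (rule continuous_on_iff[THEN iffD2], intro ballI allI impI)
    fix t e :: real assume "0 < e"
    define L where "L = (2 * B + 2) / h\<^sup>2"
    have L: "0 < L" using B h by (simp add: L_def)
    show "\<exists>d>0. \<forall>s\<in>UNIV. dist s t < d \<longrightarrow> dist (F s) (F t) < e"
    proof (intro exI[of _ "e / L"] conjI ballI impI)
      show "0 < e / L" using L \<open>0 < e\<close> by simp
      fix s assume "dist s t < e / L"
      then have "L * \<bar>s - t\<bar> < e" using L by (simp add: dist_real_def field_simps)
      then show "dist (F s) (F t) < e" using Flip[of s t] by (simp add: dist_real_def L_def)
    qed
  qed
  have Fm [measurable]: "F \<in> borel_measurable borel" by (rule borel_measurable_continuous_onI[OF Fcont])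
  have fub: "(\<integral>t. F t \<partial>\<rho>) = (\<integral>E. (\<integral>t. poisson h (t - E) \<partial>\<rho>) * indicator U E \<partial>lborel)"
    and fubi: "integrable lborel (\<lambda>E. (\<integral>t. poisson h (t - E) \<partial>\<rho>) * indicator U E)"
    if "finite_measure \<rho>" and s [measurable_cong]: "sets \<rho> = sets borel" for \<rho> :: "real measure"
  proof -
    interpret r: finite_measure \<rho> by fact
    interpret P: pair_sigma_finite \<rho> lborel ..
    have sp: "space \<rho> = UNIV" using sets_eq_imp_space_eq[OF s] by simp
    have fl: "emeasure \<rho> UNIV < \<top>" using r.emeasure_finite[of UNIV] top.not_eq_extremum by blast
    have su: "UNIV \<in> sets \<rho>" using s by simp
    have sJ: "J \<in> sets lborel" by (simp add: J_def)
    have int: "integrable (\<rho> \<Otimes>\<^sub>M lborel) (\<lambda>(t, E). poisson h (t - E) * indicator U E)"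
    proof (rule integrableI_bounded_set[where A = "UNIV \<times> J" and B = "1 / h"])
      show "UNIV \<times> J \<in> sets (\<rho> \<Otimes>\<^sub>M lborel)"
        by (rule pair_measureI[OF su sJ])
      show "(\<lambda>(t, E). poisson h (t - E) * indicator U E) \<in> borel_measurable (\<rho> \<Otimes>\<^sub>M lborel)"
        by measurable
      have "emeasure (\<rho> \<Otimes>\<^sub>M lborel) (UNIV \<times> J) = emeasure \<rho> UNIV * emeasure lborel J"
        by (rule lborel.emeasure_pair_measure_Times[OF su sJ])
      then show "emeasure (\<rho> \<Otimes>\<^sub>M lborel) (UNIV \<times> J) < \<infinity>"
        using fl by (simp add: J_def ennreal_mult_less_top emeasure_lborel_Icc_eq)
      show "AE x in \<rho> \<Otimes>\<^sub>M lborel. x \<in> UNIV \<times> J \<longrightarrow> norm (case x of (t, E) \<Rightarrow> poisson h (t - E) * indicator U E) \<le> 1 / h"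
        by (rule AE_I2) (use poisson_bounds[OF h] h in \<open>auto simp: indicator_def\<close>)
      show "AE x in \<rho> \<Otimes>\<^sub>M lborel. x \<notin> UNIV \<times> J \<longrightarrow> (case x of (t, E) \<Rightarrow> poisson h (t - E) * indicator U E) = 0"
        by (rule AE_I2) (use UJ in \<open>auto simp: indicator_def\<close>)
    qed
    show "(\<integral>t. F t \<partial>\<rho>) = (\<integral>E. (\<integral>t. poisson h (t - E) \<partial>\<rho>) * indicator U E \<partial>lborel)"
      unfolding F_def using P.Fubini_integral[OF int] by simp
    show "integrable lborel (\<lambda>E. (\<integral>t. poisson h (t - E) \<partial>\<rho>) * indicator U E)"
      using P.integrable_snd[OF int] by simp
  qed
  have diff: "(\<integral>t. F t \<partial>\<mu>') - (\<integral>t. F t \<partial>\<mu>) \<le> (2 * B + 2) * \<omega>"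
  proof -
    have "(\<integral>t. F t \<partial>\<mu>') - (\<integral>t. F t \<partial>\<mu>) =
      (\<integral>E. (\<integral>t. poisson h (t - E) \<partial>\<mu>') * indicator U E - (\<integral>t. poisson h (t - E) \<partial>\<mu>) * indicator U E \<partial>lborel)"
      unfolding fub[OF fin(1) sets(1)] fub[OF fin(2) sets(2)]
      by (rule Bochner_Integration.integral_diff[symmetric]) (intro fubi fin sets)+
    also have "\<dots> \<le> (\<integral>E. \<omega> * indicator J E \<partial>lborel)"
    proof (rule Bochner_Integration.integral_mono)
      show "integrable lborel (\<lambda>E. (\<integral>t. poisson h (t - E) \<partial>\<mu>') * indicator U E - (\<integral>t. poisson h (t - E) \<partial>\<mu>) * indicator U E)"
        by (intro Bochner_Integration.integrable_diff fubi fin sets)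
      show "integrable lborel (\<lambda>E. \<omega> * indicator J E)"
        by (intro integrable_mult_right integrable_real_indicator) (auto simp: J_def emeasure_lborel_Icc_eq)
      fix E
      show "(\<integral>t. poisson h (t - E) \<partial>\<mu>') * indicator U E - (\<integral>t. poisson h (t - E) \<partial>\<mu>) * indicator U E \<le> \<omega> * indicator J E"
      proof (cases "E \<in> U")
        case True
        then have "E \<in> J" using UJ by auto
        then have "\<bar>E\<bar> \<le> B + 1" by (auto simp: J_def)
        then show ?thesis using close[of E] True \<open>E \<in> J\<close> by simp
      qed (use \<omega> in \<open>simp add: indicator_def\<close>)
    qed
    also have "\<dots> = (2 * B + 2) * \<omega>" using B by (simp add: J_def)
    finally show ?thesis .
  qed
  have low: "2 * arctan M \<le> (\<integral>t. F t \<partial>\<mu>')"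
  proof -
    have "2 * arctan M = (\<integral>t. 2 * arctan M \<partial>\<mu>')" using mass space by simp
    also have "\<dots> \<le> (\<integral>t. F t \<partial>\<mu>')"
    proof (rule integral_mono_AE)
      show "integrable \<mu>' F" by (rule m'.integrable_const_bound[where B = pi]) (use F0 Fle in auto)
      show "AE t in \<mu>'. 2 * arctan M \<le> F t"
        using bd' Z(2) by eventually_elim (rule Fnear, auto simp: Z'_def)
    qed simp
    finally show ?thesis .
  qed
  have Fi: "integrable \<mu> F" by (rule m.integrable_const_bound[where B = pi]) (use F0 Fle in auto)
  define f where "f t = (1 - F t / pi) / c" for t
  show ?thesis
  proof (rule that[of f])
    show "continuous_on UNIV f" unfolding f_def using cpos by (intro continuous_intros Fcont) auto
    show "0 \<le> f t" for t using Fle[of t] cpos by (simp add: f_def)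
    show "f t \<le> 1 / c" for t using F0[of t] cpos by (simp add: f_def divide_right_mono)
    show "\<exists>e\<in>Z. \<bar>t - e\<bar> \<le> 2 * M * h" if "\<bar>t\<bar> \<le> B" "f t < 1" for t
    proof (rule ccontr)
      assume "\<not> ?thesis"
      then have "F t \<le> pi - 2 * arctan M" by (intro Ffar) (auto simp: Z'_def not_le)
      then have "F t / pi \<le> (pi - 2 * arctan M) / pi" by (rule divide_right_mono) simp
      also have "\<dots> = 1 - c" by (simp add: c_def diff_divide_distrib)
      finally have "c \<le> 1 - F t / pi" by simp
      then have "1 \<le> f t" using cpos by (simp add: f_def)
      then show False using that by simp
    qed
    have "(\<integral>t. f t \<partial>\<mu>) = (1 - (\<integral>t. F t \<partial>\<mu>) / pi) / c"
      unfolding f_def using Fi mass space by simp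
    also have "\<dots> \<le> (1 - c + (2 * B + 2) * \<omega> / pi) / c"
    proof (rule divide_right_mono)
      have "(2 * arctan M - (2 * B + 2) * \<omega>) / pi \<le> (\<integral>t. F t \<partial>\<mu>) / pi"
        using diff low by (intro divide_right_mono) auto
      then show "1 - (\<integral>t. F t \<partial>\<mu>) / pi \<le> 1 - c + (2 * B + 2) * \<omega> / pi"
        by (simp add: c_def diff_divide_distrib)
    qed (use cpos in simp)
    finally show "(\<integral>t. f t \<partial>\<mu>) \<le> (1 - c + (2 * B + 2) * \<omega> / pi) / c" .
  qed
qed

text \<open>Writing \<sigma> = s^k turns the sequence into the \<open>k\<close>-th power of n
  s^n.\<close>

lemma nat_power_times_power_tendsto_0:
  fixes \<sigma> :: real
  assumes "0 < \<sigma>" "\<sigma> < 1" "0 < k"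
  shows "(\<lambda>n. real n ^ k * \<sigma> ^ n) \<longlonglongrightarrow> 0"
proof -
  define s where "s = root k \<sigma>"
  have s: "s ^ k = \<sigma>" "norm s < 1"
    using assms by (auto simp: s_def)
  have "(\<lambda>n. real n * s ^ n) \<longlonglongrightarrow> 0" by (rule powser_times_n_limit_0[OF s(2)])
  from tendsto_power[OF this, of k] have "(\<lambda>n. (real n * s ^ n) ^ k) \<longlonglongrightarrow> 0"
    using assms(3) by (simp add: zero_power)
  moreover have "(real n * s ^ n) ^ k = real n ^ k * \<sigma> ^ n" for n
    unfolding s(1)[symmetric] by (simp add: power_mult_distrib power_mult[symmetric] mult.commute)
  ultimately show ?thesis by simp
qed

lemma finite_subset_cube:
  assumes "finite S"
  obtains r where "S \<subseteq> (cube 0 r :: (int ^ 'n) set)"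
proof -
  have "\<exists>r. x \<in> cube 0 r" for x :: "int ^ 'n"
  proof -
    have "\<bar>x $ i\<bar> \<le> int (nat (Max (range (\<lambda>i. \<bar>x $ i\<bar>))))" for i
    proof -
      have "\<bar>x $ i\<bar> \<le> Max (range (\<lambda>i. \<bar>x $ i\<bar>))" by (rule Max_ge) auto
      then show ?thesis by linarith
    qed
    then show ?thesis by (intro exI[of _ "nat (Max (range (\<lambda>i. \<bar>x $ i\<bar>)))"]) (simp add: cube_def)
  qed
  then obtain r where r: "\<And>x :: int ^ 'n. x \<in> cube 0 (r x)" by metis
  define M where "M = Max (insert 0 (r ` S))"
  have "x \<in> cube 0 M" if "x \<in> S" for x
  proof -
    have "r x \<le> M" unfolding M_def using assms that by (intro Max_ge) auto
    then show ?thesis using r[of x] cube_mono by blast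
  qed
  then show ?thesis using that by blast
qed

section \<open>Density of nearly singular potentials\<close>

context symop
begin

text \<open>The criterion below involves only one matrix element of a polynomial of \<open>A\<close>, hence is an
  open condition on the potential.\<close>

definition nearly_singular :: "real \<Rightarrow> 'h \<Rightarrow> bool" where
  "nearly_singular e x \<longleftrightarrow> (\<exists>p. (\<forall>t\<in>{-B..B}. 0 \<le> poly p t) \<and>
     emeasure lborel {t \<in> {-B..B}. poly p t < 1} < ennreal e \<and> inner x (opoly A p x) < e)"

text \<open>Adding the margin \<open>g\<close> before approximating keeps the polynomial above
  \<open>f\<close>, hence nonnegative and above 1 wherever \<open>f\<close> is at least 1. As
  \<open>g\<close> is a quarter of the slack, the 2 g added to the integral still fit.\<close>

lemma nearly_singularI:
  assumes x: "norm x = 1" and e: "0 < e" and f: "continuous_on UNIV f" "\<And>t. 0 \<le> f t" "\<And>t. f t \<le> K"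
    and Z: "finite Z" "\<And>t. \<bar>t\<bar> \<le> B \<Longrightarrow> f t < 1 \<Longrightarrow> \<exists>y\<in>Z. \<bar>t - y\<bar> \<le> d" and d: "0 \<le> d" "real (card Z) * (2 * d) < e"
    and int: "(\<integral>t. f t \<partial>SM x) < e"
  shows "nearly_singular e x"
proof -
  define g where "g = (e - (\<integral>t. f t \<partial>SM x)) / 4"
  have g: "0 < g" using int by (simp add: g_def)
  have "continuous_on {-B..B} (\<lambda>t. f t + g)"
    by (intro continuous_intros continuous_on_subset[OF f(1)]) auto
  from poly_approx[OF this g] obtain p where p: "\<And>t. t \<in> {-B..B} \<Longrightarrow> \<bar>f t + g - poly p t\<bar> < g" by blast
  have pf: "f t < poly p t" "poly p t < f t + 2 * g" if "t \<in> {-B..B}" for t using p[OF that] by auto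
  have fm: "f \<in> borel_measurable borel" by (rule borel_measurable_continuous_onI[OF f(1)])
  have fi: "integrable (SM x) f"
    by (rule integrable_bounded[OF fm, of K]) (use f in auto)
  show ?thesis
    unfolding nearly_singular_def
  proof (intro exI[of _ p] conjI ballI)
    show "0 \<le> poly p t" if "t \<in> {-B..B}" for t using pf(1)[OF that] f(2)[of t] by simp
    have "{t \<in> {-B..B}. poly p t < 1} \<subseteq> (\<Union>y\<in>Z. {y - d..y + d})"
    proof clarify
      fix t assume t: "t \<in> {-B..B}" "poly p t < 1"
      then have "\<bar>t\<bar> \<le> B" "f t < 1" using pf(1)[OF t(1)] by auto
      from Z(2)[OF this] obtain y where "y \<in> Z" "\<bar>t - y\<bar> \<le> d" by blast
      then show "t \<in> (\<Union>y\<in>Z. {y - d..y + d})" by (intro UN_I[of y]) auto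
    qed
    then have "emeasure lborel {t \<in> {-B..B}. poly p t < 1} \<le> emeasure lborel (\<Union>y\<in>Z. {y - d..y + d})"
      using Z(1) by (intro emeasure_mono) auto
    also have "\<dots> \<le> (\<Sum>y\<in>Z. emeasure lborel {y - d..y + d})"
      using Z(1) by (intro emeasure_subadditive_finite) auto
    also have "\<dots> = (\<Sum>y\<in>Z. ennreal (2 * d))" using d by (intro sum.cong) auto
    also have "\<dots> = ennreal (real (card Z) * (2 * d))"
      using d by (subst sum_ennreal) auto
    also have "\<dots> < ennreal e" using d e by (intro ennreal_lessI)
    finally show "emeasure lborel {t \<in> {-B..B}. poly p t < 1} < ennreal e" .
    have "inner x (opoly A p x) = (\<integral>t. poly p t \<partial>SM x)" by (simp add: SM_poly)
    also have "\<dots> \<le> (\<integral>t. f t + 2 * g \<partial>SM x)"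
    proof (rule integral_mono_AE)
      show "AE t in SM x. poly p t \<le> f t + 2 * g"
        using SM_bound[of x] by eventually_elim (rule less_imp_le[OF pf(2)], auto)
    qed (use fi in auto)
    also have "\<dots> = (\<integral>t. f t \<partial>SM x) + 2 * g" using fi SM_mass[of x] x by simp
    also have "\<dots> < e" using int by (simp add: g_def field_simps)
    finally show "inner x (opoly A p x) < e" .
  qed
qed

end

text \<open>The compression keeps supports inside \<open>S\<close>, and its matrix elements are
  real, so the real span of the basis vectors is not left.\<close>

lemma compression_finite_support:
  fixes v :: "int ^ 'n \<Rightarrow> real"
  assumes v: "\<And>n. \<bar>v n\<bar> \<le> C" and m: "m \<in> S" and S: "finite S"
  shows "((\<lambda>u. proj S (hop neighbours v (proj S u))) ^^ k) (ket m) \<in> span (ket ` S)"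
proof -
  have "(\<forall>n. n \<notin> S \<longrightarrow> coord (((\<lambda>u. proj S (hop neighbours v (proj S u))) ^^ k) (ket m)) n = 0) \<and>
    (\<forall>n. Im (coord (((\<lambda>u. proj S (hop neighbours v (proj S u))) ^^ k) (ket m)) n) = 0)"
    by (induction k)
      (use m in \<open>auto simp: coord_hop[where v = v and C = C, OF v] if_distrib[of Im] intro!: sum.neutral\<close>)
  then show ?thesis by (intro finite_support_in_span[OF S]) auto
qed

lemma nearly_singular_dense:
  fixes a b e :: real and v0 :: "int ^ 'n \<Rightarrow> real"
  assumes ab: "a < b" and v0: "v0 \<in> configs a b" and S: "finite S" and e: "0 < e"
  obtains v where "v \<in> configs a b" "\<And>n. n \<in> S \<Longrightarrow> v n = v0 n"
    "symop.nearly_singular (hop neighbours v) (2 * real CARD('n) + (\<bar>a\<bar> + \<bar>b\<bar>) + 1) e (ket m)"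
proof -
  define \<nu> where "\<nu> = CARD('n)"
  have nu: "0 < \<nu>" by (simp add: \<nu>_def)
  define C where "C = \<bar>a\<bar> + \<bar>b\<bar>"
  have C0: "0 \<le> C" by (simp add: C_def)
  define B where "B = 2 * real \<nu> + C + 1"
  have B: "1 \<le> B" using C0 by (simp add: B_def)
  obtain r where r: "insert m S \<subseteq> cube 0 r" using finite_subset_cube[of "insert m S"] S by auto
  have mr: "m \<in> cube 0 r" using r by simp
  \<comment> \<open>The separable potential adds \<nu> one-dimensional values, so these are taken in
    [a / \<nu>, b / \<nu>].\<close>
  have "a / real \<nu> < b / real \<nu>" using ab nu by (simp add: divide_strict_right_mono)
  then obtain \<sigma> \<rho> and Lt :: nat where \<sigma>: "0 < \<sigma>" "\<sigma> < 1" and \<rho>: "0 < \<rho>" and bar: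
    "\<And>p. 1 \<le> p \<Longrightarrow> \<exists>w :: int \<Rightarrow> real. \<exists>q :: int \<Rightarrow> int \<Rightarrow> complex \<Rightarrow> complex.
       (\<forall>n. a / real \<nu> \<le> w n \<and> w n \<le> b / real \<nu>) \<and>
       (\<forall>m j. \<bar>m\<bar> \<le> int r \<longrightarrow> continuous_on {z. 0 < Im z} (q m j)) \<and>
       (\<forall>m j z. int (r + p * Lt) < \<bar>j\<bar> \<longrightarrow> q m j z = 0) \<and>
       (\<forall>m j z. \<bar>m\<bar> \<le> int r \<longrightarrow> 0 < Im z \<longrightarrow> \<bar>j\<bar> \<le> int (r + p * Lt) \<longrightarrow>
          q m (j + 1) z + q m (j - 1) z + (of_real (w j) - z) * q m j z = of_bool (j = m)) \<and>
       (\<forall>m j z. \<bar>m\<bar> \<le> int r \<longrightarrow> 0 < Im z \<longrightarrow> Im z \<le> \<rho> \<longrightarrow> \<bar>Re z\<bar> \<le> 2 * B + 1 \<longrightarrow> \<bar>j\<bar> = int (r + p * Lt) \<longrightarrow>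
          cmod (q m j z) \<le> \<sigma> ^ p / (Im z)\<^sup>2)"
    \<comment> \<open>The energies met below are Re z - t with |Re z| <= B + 1 and |t| <= B, whence
      the window 2 B + 1.\<close>
    by (rule barrier_potential[where \<alpha> = "a / real \<nu>" and \<beta> = "b / real \<nu>" and X = "2 * B + 1" and r = r]) (rule that; assumption)
  define cM where "cM M = 2 * arctan M / pi" for M :: real
  have "\<exists>M>0. (1 - cM M) / cM M < e / 4"
  proof -
    have "((\<lambda>M. (1 - cM M) / cM M) \<longlongrightarrow> (1 - 2 * (pi / 2) / pi) / (2 * (pi / 2) / pi)) at_top"
      unfolding cM_def by (intro tendsto_intros tendsto_arctan_at_top) auto
    then have "\<forall>\<^sub>F M in at_top. (1 - cM M) / cM M < e / 4"
      by (rule order_tendstoD) (use e in auto)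
    then have "\<forall>\<^sub>F M in at_top. (1 - cM M) / cM M < e / 4 \<and> 0 < M"
      by (intro eventually_conj eventually_gt_at_top)
    then show ?thesis using eventually_happens'[OF trivial_limit_at_top_linorder] by blast
  qed
  then obtain M where M: "0 < M" "(1 - cM M) / cM M < e / 4" by blast
  define c where "c = cM M"
  have c: "0 < c" using M by (simp add: c_def cM_def)
  \<comment> \<open>\<omega> will carry \<eta> to the power -5: two from the barrier, and one each
    from the residual estimate, the perturbation on the core and the compression. With \<eta> =
    p^-(\<nu> + 1) this is p^k.\<close>
  define k where "k = 5 * (\<nu> + 1)"
  define D where "D = b - a"
  define G where "G = real (card (cube 0 r :: (int ^ 'n) set)) * D"
  have G: "0 \<le> G" using ab by (simp add: G_def D_def)
  define K where "K = real (2 * r + 2 * Lt + 1) ^ \<nu>"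
  have K: "0 \<le> K" by (simp add: K_def)
  define W where "W = B * (1 + G) * (real \<nu> * 5)"
  have W: "0 \<le> W" using B G by (simp add: W_def)
  have "(\<lambda>p. real p ^ k * \<sigma> ^ p) \<longlonglongrightarrow> 0"
    by (rule nat_power_times_power_tendsto_0[OF \<sigma>]) (simp add: k_def)
  from tendsto_mult_right_zero[OF this, of "(2 * B + 2) / pi / c * W"]
  have "\<forall>\<^sub>F p in sequentially. (2 * B + 2) / pi / c * W * (real p ^ k * \<sigma> ^ p) < e / 4"
    by (rule order_tendstoD) (use e in auto)
  moreover have "\<forall>\<^sub>F p in sequentially. max (1 / \<rho>) (max M (4 * M * K / e)) < real p"
    by (rule eventually_compose_filterlim[OF eventually_gt_at_top filterlim_real_sequentially])
  moreover have "\<forall>\<^sub>F p in sequentially. 1 \<le> p" by (rule eventually_ge_at_top)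
  ultimately have "\<forall>\<^sub>F p in sequentially. (2 * B + 2) / pi / c * W * (real p ^ k * \<sigma> ^ p) < e / 4 \<and>
      max (1 / \<rho>) (max M (4 * M * K / e)) < real p \<and> 1 \<le> p"
    by eventually_elim auto
  then obtain p where p: "(2 * B + 2) / pi / c * W * (real p ^ k * \<sigma> ^ p) < e / 4"
      "1 / \<rho> < real p" "M < real p" "4 * M * K / e < real p" "1 \<le> p"
    using eventually_happens'[OF sequentially_bot] by auto
  \<comment> \<open>The box has O(p^\<nu>) sites, so with this height the 2 M \<eta>-neighbourhoods
    of that many points have total length O(1 / p).\<close>
  define \<eta> where "\<eta> = 1 / real p ^ (\<nu> + 1)"
  have p1: "1 \<le> real p" using p(5) by simp
  have pp: "real p \<le> real p ^ (\<nu> + 1)" using p1 by (intro self_le_power) auto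
  have \<eta>: "0 < \<eta>" "\<eta> \<le> 1" "\<eta> \<le> 1 / real p"
    using p1 pp by (auto simp: \<eta>_def frac_le divide_simps intro: order_trans[OF p1])
  have \<eta>\<rho>: "\<eta> \<le> \<rho>"
  proof -
    have "1 / real p < \<rho>" using p(2) \<rho> p1 by (simp add: field_simps)
    then show ?thesis using \<eta>(3) by simp
  qed
  have M\<eta>: "M * \<eta> \<le> 1"
  proof -
    have "M * \<eta> \<le> real p * (1 / real p)" using p(3) M \<eta> by (intro mult_mono) auto
    then show ?thesis using p1 by simp
  qed
  define R where "R = r + p * Lt"
  have rR: "r \<le> R" by (simp add: R_def)
  obtain w :: "int \<Rightarrow> real" and q :: "int \<Rightarrow> int \<Rightarrow> complex \<Rightarrow> complex" where
    w: "\<And>n. a / real \<nu> \<le> w n \<and> w n \<le> b / real \<nu>" and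
    q1: "\<And>m j. \<bar>m\<bar> \<le> int r \<Longrightarrow> continuous_on {z. 0 < Im z} (q m j)" and
    q2: "\<And>m j z. int R < \<bar>j\<bar> \<Longrightarrow> q m j z = 0" and
    q3: "\<And>m j z. \<bar>m\<bar> \<le> int r \<Longrightarrow> 0 < Im z \<Longrightarrow> \<bar>j\<bar> \<le> int R \<Longrightarrow>
          q m (j + 1) z + q m (j - 1) z + (of_real (w j) - z) * q m j z = of_bool (j = m)" and
    q4: "\<And>m j z. \<bar>m\<bar> \<le> int r \<Longrightarrow> 0 < Im z \<Longrightarrow> Im z \<le> \<rho> \<Longrightarrow> \<bar>Re z\<bar> \<le> 2 * B + 1 \<Longrightarrow> \<bar>j\<bar> = int R \<Longrightarrow>
          cmod (q m j z) \<le> \<sigma> ^ p / (Im z)\<^sup>2"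
    using bar[OF p(5)] unfolding R_def[symmetric] by blast
  have wC: "\<bar>w n\<bar> \<le> C / real \<nu>" for n
  proof -
    have "- C \<le> a" "b \<le> C" by (auto simp: C_def)
    then have "- C / real \<nu> \<le> a / real \<nu>" "b / real \<nu> \<le> C / real \<nu>" by (intro divide_right_mono; simp)+
    then show ?thesis using w[of n] by (simp add: abs_le_iff)
  qed
  have sepc: "a \<le> sepv w UNIV n \<and> sepv w UNIV n \<le> b" for n :: "int ^ 'n"
  proof -
    have "(\<Sum>i\<in>(UNIV :: 'n set). a / real \<nu>) \<le> sepv w UNIV n" "sepv w UNIV n \<le> (\<Sum>i\<in>(UNIV :: 'n set). b / real \<nu>)"
      unfolding sepv_def by (rule sum_mono, simp add: w)+
    then show ?thesis using nu by (simp add: \<nu>_def)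
  qed
  \<comment> \<open>On the core cube the values of \<open>v0\<close> replace the separable ones;
    \<open>perturbed_resolvent_outside\<close> absorbs this finite perturbation.\<close>
  define v where "v n = (if n \<in> cube 0 r then v0 n else sepv w UNIV n)" for n
  have vc: "v \<in> configs a b" using v0 sepc by (auto simp: v_def configs_def)
  have vb: "\<bar>v n\<bar> \<le> C" for n using configs_bound[OF vc, of n] by (simp add: C_def)
  have sepb: "\<bar>sepv w UNIV n\<bar> \<le> C" for n :: "int ^ 'n" using sepc[of n] by (auto simp: C_def abs_le_iff)
  have vD: "\<bar>v n - sepv w UNIV n\<bar> \<le> D" for n
    using vc sepc[of n] by (auto simp: configs_def D_def abs_le_iff dest!: spec[of _ n])
  have card_nb: "real (card (neighbours :: (int ^ 'n) set)) = 2 * real \<nu>"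
    by (simp add: card_neighbours \<nu>_def)
  interpret csymop "hop neighbours v" B
    using hop_csymop[where v = v and C = C, OF vb uminus_neighbours] by (simp add: card_nb B_def)
  interpret S: csymop "\<lambda>u. proj (cube 0 R) (hop neighbours v (proj (cube 0 R) u))" B
    by (rule compression_csymop)
  have mR: "m \<in> cube 0 R" using mr cube_mono[OF rR] by auto
  define e0 where "e0 = \<sigma> ^ p / \<eta>\<^sup>2"
  have e0: "0 < e0" using \<sigma> \<eta> by (simp add: e0_def)
  define \<omega> where "\<omega> = B * ((1 + real (card (cube 0 r :: (int ^ 'n) set)) * D / \<eta>) * (real \<nu> * (5 * e0 / \<eta>))) / \<eta>"
  have close: "\<bar>(\<integral>t. poisson \<eta> (t - E) \<partial>SM (ket m)) - (\<integral>t. poisson \<eta> (t - E) \<partial>S.SM (ket m))\<bar> \<le> \<omega>"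
    if E: "\<bar>E\<bar> \<le> B + 1" for E
  proof -
    define z where "z = Complex E \<eta>"
    have z: "Im z = \<eta>" "Re z = E" "0 < Im z" using \<eta> by (auto simp: z_def)
    obtain u where u: "hop neighbours v u - scaleC_ell2 z u = ket m" using resolvent_ex[of z "ket m"] z by auto
    obtain uS where uS: "proj (cube 0 R) (hop neighbours v (proj (cube 0 R) uS)) - scaleC_ell2 z uS = ket m"
      using S.resolvent_ex[of z "ket m"] z by auto
    have sep_out: "norm (proj (- cube 0 R) u) \<le> real \<nu> * (5 * e0 / Im z)"
      if "n \<in> cube 0 r" "hop neighbours (sepv w UNIV) u - scaleC_ell2 z u = ket n" for n :: "int ^ 'n" and u
      unfolding \<nu>_def
    proof (rule sep_resolvent_outside[where w = w and C = "C / real \<nu>" and r = r and q = q and m = n])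
      show "cmod (q m j (z - of_real t)) \<le> e0"
        if "\<bar>m\<bar> \<le> int r" "\<bar>t\<bar> \<le> 2 * real CARD('n) + real CARD('n) * (C / real \<nu>) + 1" "\<bar>j\<bar> = int R" for m j t
      proof -
        have "\<bar>t\<bar> \<le> B" using that(2) nu by (simp add: B_def \<nu>_def)
        then have "\<bar>Re (z - of_real t)\<bar> \<le> 2 * B + 1" using E z by auto
        from q4[OF that(1) _ _ this that(3)] show ?thesis using z \<eta>\<rho> by (simp add: e0_def)
      qed
    qed (use wC z e0 rR q1 q2 q3 that in auto)
    have "norm (proj (- cube 0 R) u) \<le> (1 + real (card (cube 0 r :: (int ^ 'n) set)) * D / Im z) * (real \<nu> * (5 * e0 / Im z))"
      by (rule perturbed_resolvent_outside[where v = v and ?v0.0 = "sepv w UNIV" and C = C and ?C0.0 = C and F = "cube 0 r" and m = m])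
        (use vb sepb vD z mr sep_out u in \<open>auto simp: v_def\<close>)
    then have "B * norm (proj (- cube 0 R) u) / Im z \<le> \<omega>"
      unfolding \<omega>_def z(1) using B \<eta> by (intro divide_right_mono mult_left_mono) auto
    then have "cmod (coord u m - coord uS m) \<le> \<omega>"
      using compression_resolvent_close[OF z(3) mR u uS] by simp
    then have "\<bar>Im (coord u m) - Im (coord uS m)\<bar> \<le> \<omega>"
      using abs_Im_le_cmod[of "coord u m - coord uS m"] by simp
    moreover have "Im (coord u m) = (\<integral>t. poisson \<eta> (t - E) \<partial>SM (ket m))"
      using Im_resolvent[OF z(3) u] by (simp add: z poisson_def)
    moreover have "Im (coord uS m) = (\<integral>t. poisson \<eta> (t - E) \<partial>S.SM (ket m))"
      using S.Im_resolvent[OF z(3) uS] by (simp add: z poisson_def)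
    ultimately show ?thesis by simp
  qed
  obtain Z where Z: "finite Z" "card Z \<le> card (ket ` (cube 0 R :: (int ^ 'n) set))" "AE t in S.SM (ket m). t \<in> Z"
    by (rule S.SM_finite_support[of "ket ` cube 0 R" "ket m"])
      (auto intro!: compression_finite_support[where v = v and C = C, OF vb mR])
  have cardZ: "real (card Z) \<le> K * real p ^ \<nu>"
  proof -
    have "card Z \<le> card (cube 0 R :: (int ^ 'n) set)" using Z(2) card_image_le[of "cube 0 R :: (int ^ 'n) set" ket] by simp
    also have "\<dots> = (2 * R + 1) ^ \<nu>" by (simp add: card_cube \<nu>_def)
    also have "\<dots> \<le> ((2 * r + 2 * Lt + 1) * p) ^ \<nu>"
    proof (rule power_mono)
      show "2 * R + 1 \<le> (2 * r + 2 * Lt + 1) * p" using p(5) by (cases p) (simp_all add: R_def algebra_simps)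
    qed simp
    finally have "real (card Z) \<le> real (((2 * r + 2 * Lt + 1) * p) ^ \<nu>)" by (rule of_nat_mono)
    then show ?thesis by (simp only: of_nat_power of_nat_mult power_mult_distrib K_def)
  qed
  obtain f where f: "continuous_on UNIV f" "\<And>t. 0 \<le> f t"
    "\<And>t. \<bar>t\<bar> \<le> B \<Longrightarrow> f t < 1 \<Longrightarrow> \<exists>y\<in>Z. \<bar>t - y\<bar> \<le> 2 * M * \<eta>"
    "(\<integral>t. f t \<partial>SM (ket m)) \<le> (1 - c + (2 * B + 2) * \<omega> / pi) / c"
    "\<And>t. f t \<le> 1 / c"
    by (rule poisson_concentration[OF SM_finite[of "ket m"] S.SM_finite[of "ket m"] sets_SM S.sets_SM _ _ S.SM_bound Z(1,3) _ \<eta>(1) M(1) M\<eta> close])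
      (use SM_mass[of "ket m"] S.SM_mass[of "ket m"] B in \<open>auto simp: c_def cM_def\<close>)
  have \<omega>W: "\<omega> \<le> W * (real p ^ k * \<sigma> ^ p)"
  proof -
    have "1 + real (card (cube 0 r :: (int ^ 'n) set)) * D / \<eta> \<le> (1 + G) / \<eta>"
      using \<eta> by (simp add: G_def field_simps)
    then have "\<omega> \<le> B * ((1 + G) / \<eta> * (real \<nu> * (5 * e0 / \<eta>))) / \<eta>"
      unfolding \<omega>_def using B \<eta> e0 by (intro divide_right_mono mult_left_mono mult_right_mono) auto
    also have "\<dots> = W * (\<sigma> ^ p / \<eta> ^ 5)"
      unfolding W_def e0_def by (simp add: field_simps power2_eq_square eval_nat_numeral)
    also have "\<sigma> ^ p / \<eta> ^ 5 = real p ^ k * \<sigma> ^ p"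
    proof -
      have "\<eta> ^ 5 = 1 / real p ^ k"
        by (simp only: \<eta>_def k_def power_divide power_one power_mult[symmetric] mult.commute[of 5])
      then show ?thesis by simp
    qed
    finally show ?thesis .
  qed
  have int: "(\<integral>t. f t \<partial>SM (ket m)) < e"
  proof -
    have "(2 * B + 2) / pi / c * \<omega> \<le> (2 * B + 2) / pi / c * (W * (real p ^ k * \<sigma> ^ p))"
      using \<omega>W B c by (intro mult_left_mono) auto
    then have "(2 * B + 2) / pi / c * \<omega> < e / 4" using p(1) by (simp add: mult.assoc)
    moreover have "(1 - c + (2 * B + 2) * \<omega> / pi) / c = (1 - c) / c + (2 * B + 2) / pi / c * \<omega>"
      unfolding add_divide_distrib[of "1 - c"] by simp
    ultimately show ?thesis using f(4) M(2) e unfolding c_def[symmetric] by linarith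
  qed
  have size: "real (card Z) * (2 * (2 * M * \<eta>)) < e"
  proof -
    have "real (card Z) * (2 * (2 * M * \<eta>)) \<le> (K * real p ^ \<nu>) * (2 * (2 * M * \<eta>))"
      using cardZ M \<eta> by (intro mult_right_mono) auto
    also have "\<dots> = 4 * M * K / real p" using p1 by (simp add: \<eta>_def field_simps)
    also have "\<dots> < e" using p(4) p1 e by (simp add: field_simps)
    finally show ?thesis .
  qed
  have "nearly_singular e (ket m)"
    by (rule nearly_singularI[OF norm_ket e f(1,2,5) Z(1) f(3) _ size int]) (use M \<eta> in auto)
  then have "symop.nearly_singular (hop neighbours v) (2 * real CARD('n) + (\<bar>a\<bar> + \<bar>b\<bar>) + 1) e (ket m)"
    by (simp add: B_def C_def \<nu>_def)
  moreover have "v n = v0 n" if "n \<in> S" for n using r that by (auto simp: v_def)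
  ultimately show ?thesis using that vc by blast
qed

section \<open>The residual set\<close>

lemma openin_config_finite:
  assumes "finite I" "\<And>i. i \<in> I \<Longrightarrow> continuous_map (config_space a b) euclideanreal (f i)"
  shows "openin (config_space a b) {v \<in> configs a b. \<forall>i\<in>I. f i v < c i}"
  using assms
proof (induction I)
  case empty
  have "openin (config_space a b) (topspace (config_space a b))" by (rule openin_topspace)
  then show ?case by (simp add: topspace_config)
next
  case (insert i I)
  have "{v \<in> configs a b. \<forall>i\<in>insert i I. f i v < c i} =
    {v \<in> configs a b. f i v < c i} \<inter> {v \<in> configs a b. \<forall>i\<in>I. f i v < c i}" by auto
  then show ?case using insert by (auto intro!: openin_Int openin_config_less)
qed

section \<open>Potentials nearly constant on a cube\<close>

text \<open>The level is parametrised by s in [0, 1] so that the rational \<open>s\<close> form a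
  countable family containing both end points, whatever \<open>a\<close> and \<open>b\<close>
  are.\<close>

definition wave_set :: "real \<Rightarrow> real \<Rightarrow> real \<Rightarrow> nat \<Rightarrow> (int ^ 'n \<Rightarrow> real) set" where
  "wave_set a b s k = {v \<in> configs a b. \<exists>x. \<forall>n\<in>cube x k. \<bar>v n - (a + s * (b - a))\<bar> < 1 / real (k + 1)}"

lemma openin_wave_set: "openin (config_space a b) (wave_set a b s k :: (int ^ 'n \<Rightarrow> real) set)"
proof -
  have "openin (config_space a b) {v \<in> configs a b. \<forall>n\<in>cube x k. \<bar>v n - (a + s * (b - a))\<bar> < 1 / real (k + 1)}" for x :: "int ^ 'n"
  proof (rule openin_config_finite[OF finite_cube])
    fix n :: "int ^ 'n"
    show "continuous_map (config_space a b) euclideanreal (\<lambda>v. \<bar>v n - (a + s * (b - a))\<bar>)"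
      using continuous_map_config_eval[of a b n]
      unfolding continuous_map_atin limitin_canonical_iff by (auto intro!: tendsto_intros)
  qed
  then have "openin (config_space a b) (\<Union>x :: int ^ 'n. {v \<in> configs a b. \<forall>n\<in>cube x k. \<bar>v n - (a + s * (b - a))\<bar> < 1 / real (k + 1)})"
    by (intro openin_Union) auto
  moreover have "wave_set a b s k = (\<Union>x :: int ^ 'n. {v \<in> configs a b. \<forall>n\<in>cube x k. \<bar>v n - (a + s * (b - a))\<bar> < 1 / real (k + 1)})"
    by (auto simp: wave_set_def)
  ultimately show ?thesis by simp
qed

lemma dense_wave_set:
  assumes "a < b" "0 \<le> s" "s \<le> 1"
  shows "config_space a b closure_of (wave_set a b s k :: (int ^ 'n \<Rightarrow> real) set) = topspace (config_space a b)"
proof (rule dense_configI)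
  fix v0 :: "int ^ 'n \<Rightarrow> real" and S :: "(int ^ 'n) set" assume v0: "v0 \<in> configs a b" and S: "finite S"
  obtain r where r: "S \<subseteq> cube 0 r" using finite_subset_cube[OF S] by blast
  obtain i0 :: 'n where True by blast
  \<comment> \<open>Shifted along one axis just far enough for the cube of radius \<open>k\<close>
    about \<open>x\<close> to miss the cube of radius \<open>r\<close> about 0.\<close>
  define x :: "int ^ 'n" where "x = axis i0 (int (r + k + 1))"
  have disj: "n \<notin> cube x k" if "n \<in> S" for n
  proof
    assume "n \<in> cube x k"
    then have "\<bar>n $ i0 - int (r + k + 1)\<bar> \<le> int k" by (auto simp: cube_def x_def axis_def dest!: spec[of _ i0])
    moreover have "\<bar>n $ i0\<bar> \<le> int r" using r \<open>n \<in> S\<close> by (auto simp: cube_def)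
    ultimately show False by simp
  qed
  define c where "c = a + s * (b - a)"
  define t where "t = s * (b - a)"
  have "0 \<le> t" using assms by (simp add: t_def)
  moreover have "t \<le> b - a" using mult_right_mono[of s 1 "b - a"] assms by (simp add: t_def)
  ultimately have c: "a \<le> c" "c \<le> b" unfolding c_def t_def[symmetric] by linarith+
  define v where "v n = (if n \<in> cube x k then c else v0 n)" for n
  have "v \<in> configs a b" using v0 c by (auto simp: v_def configs_def)
  moreover have "\<forall>n\<in>cube x k. \<bar>v n - (a + s * (b - a))\<bar> < 1 / real (k + 1)" by (simp add: v_def c_def)
  ultimately show "\<exists>v\<in>wave_set a b s k. v \<in> configs a b \<and> (\<forall>n\<in>S. v n = v0 n)"
    using disj by (intro bexI[of _ v]) (auto simp: wave_set_def v_def)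
qed

section \<open>Potentials with small atoms\<close>

text \<open>By q(E)^2 \<mu>({E}) <= integral of q^2, each inequality bounds the atom at
  \<open>E\<close> by 1 / (k + 1). Finiteness of \<open>Q\<close> and the common margin
  \<open>d\<close> make the condition stable under small changes of \<open>v\<close>, for all
  \<open>E\<close> at once.\<close>

definition atomless_set :: "real \<Rightarrow> real \<Rightarrow> int ^ 'n \<Rightarrow> nat \<Rightarrow> (int ^ 'n \<Rightarrow> real) set" where
  "atomless_set a b m k = {v \<in> configs a b. \<exists>Q d. finite Q \<and> 0 < d \<and>
     (\<forall>E. \<bar>E\<bar> \<le> 2 * real CARD('n) + (\<bar>a\<bar> + \<bar>b\<bar>) + 1 \<longrightarrow>
        (\<exists>q\<in>Q. inner (ket m) (opoly (hop neighbours v) (q\<^sup>2) (ket m)) + d < 1 / real (k + 1) * (poly q E)\<^sup>2))}"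

lemma openin_atomless_set: "openin (config_space a b) (atomless_set a b m k)"
proof (subst openin_subopen, intro ballI)
  fix v assume "v \<in> atomless_set a b m k"
  then obtain Q d where v: "v \<in> configs a b" "finite Q" "0 < d" and
    Q: "\<And>E. \<bar>E\<bar> \<le> 2 * real CARD('a) + (\<bar>a\<bar> + \<bar>b\<bar>) + 1 \<Longrightarrow>
        \<exists>q\<in>Q. inner (ket m) (opoly (hop neighbours v) (q\<^sup>2) (ket m)) + d < 1 / real (k + 1) * (poly q E)\<^sup>2"
    unfolding atomless_set_def by blast
  define g where "g q v = inner (ket m) (opoly (hop neighbours v) (q\<^sup>2) (ket m))" for q v
  let ?T = "{v' \<in> configs a b. \<forall>q\<in>Q. g q v' < g q v + d / 2}"
  have "openin (config_space a b) ?T"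
    by (rule openin_config_finite[OF v(2)]) (unfold g_def, rule continuous_map_inner_opoly)
  moreover have "v \<in> ?T" using v by simp
  moreover have "?T \<subseteq> atomless_set a b m k"
  proof
    fix v' assume v': "v' \<in> ?T"
    have "\<exists>q\<in>Q. g q v' + d / 2 < 1 / real (k + 1) * (poly q E)\<^sup>2"
      if "\<bar>E\<bar> \<le> 2 * real CARD('a) + (\<bar>a\<bar> + \<bar>b\<bar>) + 1" for E
    proof -
      note E = that
      obtain q where "q \<in> Q" "g q v + d < 1 / real (k + 1) * (poly q E)\<^sup>2" using Q[OF E] by (auto simp: g_def)
      moreover have "g q v' < g q v + d / 2" using v' \<open>q \<in> Q\<close> by blast
      ultimately show ?thesis by (intro bexI[of _ q]) auto
    qed
    then show "v' \<in> atomless_set a b m k"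
      unfolding atomless_set_def using v' v(2,3) by (auto simp: g_def intro!: exI[of _ Q] exI[of _ "d / 2"])
  qed
  ultimately show "\<exists>T. openin (config_space a b) T \<and> v \<in> T \<and> T \<subseteq> atomless_set a b m k" by blast
qed

lemma hop_config_csymop:
  fixes v :: "int ^ 'n \<Rightarrow> real"
  assumes "v \<in> configs a b"
  shows "csymop (hop neighbours v) (2 * real CARD('n) + (\<bar>a\<bar> + \<bar>b\<bar>) + 1)"
  using hop_csymop[where v = v and C = "\<bar>a\<bar> + \<bar>b\<bar>" and J = neighbours] configs_bound[OF assms]
  by (simp add: card_neighbours)

lemma dense_atomless_set:
  fixes m :: "int ^ 'n"
  shows "config_space a b closure_of (atomless_set a b m k) = topspace (config_space a b)"
proof (rule dense_configI)
  fix v0 :: "int ^ 'n \<Rightarrow> real" and S :: "(int ^ 'n) set" assume v0: "v0 \<in> configs a b" and S: "finite S"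
  obtain r where r: "S \<subseteq> cube 0 r" using finite_subset_cube[OF S] by blast
  define L where "L = 2 * r + 1"
  \<comment> \<open>The values of \<open>v0\<close> on the cube of side L = 2 r + 1 about 0,
    repeated periodically.\<close>
  define v where "v n = v0 (\<chi> i. (n $ i + int r) mod int L - int r)" for n
  have vc: "v \<in> configs a b" using v0 by (auto simp: v_def configs_def)
  have vS: "v n = v0 n" if "n \<in> S" for n
  proof -
    have "(n $ i + int r) mod int L = n $ i + int r" for i
    proof (rule mod_pos_pos_trivial)
      have "\<bar>n $ i\<bar> \<le> int r" using r that by (auto simp: cube_def)
      then show "0 \<le> n $ i + int r" "n $ i + int r < int L" by (auto simp: L_def)
    qed
    then have "(\<chi> i. (n $ i + int r) mod int L - int r) = n" by (simp add: vec_eq_iff)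
    then show ?thesis by (simp add: v_def)
  qed
  have per: "v (n + (\<chi> i. int L * e $ i)) = v n" for n e
  proof -
    have "(n $ i + int L * e $ i + int r) mod int L = (n $ i + int r) mod int L" for i
      using mod_mult_self2[of "n $ i + int r" "int L" "e $ i"] by (simp add: ac_simps)
    then show ?thesis by (simp add: v_def)
  qed
  define C where "C = \<bar>a\<bar> + \<bar>b\<bar>"
  have vb: "\<bar>v n\<bar> \<le> C" for n using configs_bound[OF vc] by (simp add: C_def)
  define B where "B = 2 * real CARD('n) + C + 1"
  interpret csymop "hop neighbours v" B
    unfolding B_def C_def by (rule hop_config_csymop[OF vc])
  define g where "g q = inner (ket m) (opoly (hop neighbours v) (q\<^sup>2) (ket m))" for q
  have g: "g q = (norm (opoly (hop neighbours v) q (ket m)))\<^sup>2" for q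
    by (simp add: g_def power2_norm_eq_inner power2_eq_square[of q] opoly_mult[OF lin] opoly_sym)
  define \<epsilon> where "\<epsilon> = 1 / real (k + 1)"
  have \<epsilon>: "0 < \<epsilon>" by (simp add: \<epsilon>_def)
  have "\<exists>q. g q < \<epsilon> * (poly q E)\<^sup>2" if "\<bar>E\<bar> \<le> B" for E
    unfolding g
    by (rule periodic_no_atoms[where v = v and C = C and L = L and e = \<epsilon> and E = E and m = m])
      (use vb per \<epsilon> that in \<open>auto simp: L_def B_def card_neighbours\<close>)
  then obtain q where q: "\<And>E. \<bar>E\<bar> \<le> B \<Longrightarrow> g (q E) < \<epsilon> * (poly (q E) E)\<^sup>2" by metis
  \<comment> \<open>Half the slack at \<open>E\<close>, so that the inequality with margin
    \<open>d E\<close> persists on an open set \<open>O' E\<close> around \<open>E\<close>; finitely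
    many of these cover [-B, B].\<close>
  define d where "d E = (\<epsilon> * (poly (q E) E)\<^sup>2 - g (q E)) / 2" for E
  define O' where "O' E = {E'. g (q E) + d E < \<epsilon> * (poly (q E) E')\<^sup>2}" for E
  have d: "0 < d E" "E \<in> O' E" if "\<bar>E\<bar> \<le> B" for E
    using q[OF that] by (auto simp: d_def O'_def field_simps)
  have open_O: "open (O' E)" for E
    unfolding O'_def by (intro open_Collect_less continuous_intros)
  have "{-B..B} \<subseteq> (\<Union>E\<in>{-B..B}. O' E)"
  proof
    fix E assume "E \<in> {-B..B}"
    moreover from this have "E \<in> O' E" by (intro d(2)) auto
    ultimately show "E \<in> (\<Union>E\<in>{-B..B}. O' E)" by blast
  qed
  then obtain I where I: "I \<subseteq> {-B..B}" "finite I" "{-B..B} \<subseteq> (\<Union>E\<in>I. O' E)"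
    by (rule compactE_image[OF compact_Icc open_O])
  define D where "D = Min (insert 1 (d ` I))"
  have D: "0 < D" "\<And>E. E \<in> I \<Longrightarrow> D \<le> d E"
  proof -
    have "0 < d E" if "E \<in> I" for E using subsetD[OF I(1) that] by (intro d(1)) (auto simp: abs_le_iff)
    then show "0 < D" using I(2) by (auto simp: D_def)
    show "D \<le> d E" if "E \<in> I" for E using I(2) that by (auto simp: D_def)
  qed
  have "v \<in> atomless_set a b m k"
    unfolding atomless_set_def
  proof (intro CollectI conjI vc exI[of _ "q ` I"] exI[of _ D] allI impI)
    show "finite (q ` I)" using I(2) by simp
    show "0 < D" by (rule D(1))
    fix E assume "\<bar>E\<bar> \<le> 2 * real CARD('n) + (\<bar>a\<bar> + \<bar>b\<bar>) + 1"
    then have "E \<in> {-B..B}" by (auto simp: B_def C_def abs_le_iff)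
    then obtain E' where E': "E' \<in> I" "E \<in> O' E'" using I(3) by blast
    then have "g (q E') + D < \<epsilon> * (poly (q E') E)\<^sup>2" using D(2)[OF E'(1)] by (auto simp: O'_def)
    then show "\<exists>q\<in>q ` I. inner (ket m) (opoly (hop neighbours v) (q\<^sup>2) (ket m)) + D < 1 / real (k + 1) * (poly q E)\<^sup>2"
      using E'(1) by (auto simp: g_def \<epsilon>_def)
  qed
  then show "\<exists>v\<in>atomless_set a b m k. v \<in> configs a b \<and> (\<forall>n\<in>S. v n = v0 n)" using vc vS by blast
qed

section \<open>Nearly singular potentials\<close>

definition singular_set :: "real \<Rightarrow> real \<Rightarrow> int ^ 'n \<Rightarrow> nat \<Rightarrow> (int ^ 'n \<Rightarrow> real) set" where
  "singular_set a b m k = {v \<in> configs a b.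
     symop.nearly_singular (hop neighbours v) (2 * real CARD('n) + (\<bar>a\<bar> + \<bar>b\<bar>) + 1) ((1 / 2) ^ k) (ket m)}"

lemma openin_singular_set: "openin (config_space a b) (singular_set a b m k)"
proof -
  let ?B = "2 * real CARD('a) + (\<bar>a\<bar> + \<bar>b\<bar>) + 1" and ?e = "(1 / 2) ^ k :: real"
  \<comment> \<open>These conditions on the polynomial do not involve \<open>v\<close>, so the set
    is a union over \<open>P\<close> of sets given by one continuous matrix element.\<close>
  define P where "P = {p. (\<forall>t\<in>{-?B..?B}. 0 \<le> poly p t) \<and> emeasure lborel {t \<in> {-?B..?B}. poly p t < 1} < ennreal ?e}"
  have "singular_set a b m k = (\<Union>p\<in>P. {v \<in> configs a b. inner (ket m) (opoly (hop neighbours v) p (ket m)) < ?e})"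
  proof -
    have "symop.nearly_singular (hop neighbours v) ?B ?e (ket m) \<longleftrightarrow>
      (\<exists>p\<in>P. inner (ket m) (opoly (hop neighbours v) p (ket m)) < ?e)" if "v \<in> configs a b" for v
    proof -
      interpret csymop "hop neighbours v" ?B by (rule hop_config_csymop[OF that])
      show ?thesis unfolding nearly_singular_def P_def by blast
    qed
    then show ?thesis by (auto simp: singular_set_def)
  qed
  then show ?thesis
    by (auto intro!: openin_Union openin_config_less continuous_map_inner_opoly)
qed

lemma dense_singular_set:
  fixes m :: "int ^ 'n"
  assumes "a < b"
  shows "config_space a b closure_of (singular_set a b m k) = topspace (config_space a b)"
proof (rule dense_configI)
  fix v0 :: "int ^ 'n \<Rightarrow> real" and S :: "(int ^ 'n) set" assume "v0 \<in> configs a b" "finite S"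
  then obtain v where "v \<in> configs a b" "\<And>n. n \<in> S \<Longrightarrow> v n = v0 n"
    "symop.nearly_singular (hop neighbours v) (2 * real CARD('n) + (\<bar>a\<bar> + \<bar>b\<bar>) + 1) ((1 / 2) ^ k) (ket m)"
    using nearly_singular_dense[OF assms, of v0 S "(1 / 2) ^ k" m] by auto
  then show "\<exists>v\<in>singular_set a b m k. v \<in> configs a b \<and> (\<forall>n\<in>S. v n = v0 n)"
    by (auto simp: singular_set_def)
qed

context symop
begin

text \<open>Borel-Cantelli on both sides: the upper limit \<open>N\<close> of the sets
  \<open>S k\<close> is Lebesgue null because their lengths are summable, and its complement is a
  countable union of intersections, each contained in sets of arbitrarily small spectral
  measure.\<close>

lemma nearly_singular_null:
  assumes "\<And>k. nearly_singular ((1 / 2) ^ k) x"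
  obtains N where "N \<in> null_sets lborel" "emeasure (SM x) (UNIV - N) = 0"
proof -
  define P where "P k p \<longleftrightarrow> (\<forall>t\<in>{-B..B}. 0 \<le> poly p t) \<and>
     emeasure lborel {t \<in> {-B..B}. poly p t < 1} < ennreal ((1 / 2) ^ k) \<and> inner x (opoly A p x) < (1 / 2) ^ k" for k :: nat and p
  have "\<forall>k. \<exists>p. P k p"
    using assms unfolding nearly_singular_def P_def by blast
  then obtain p where "\<forall>k. P k (p k)" using choice by blast
  then have p: "\<And>k t. t \<in> {-B..B} \<Longrightarrow> 0 \<le> poly (p k) t"
    "\<And>k. emeasure lborel {t \<in> {-B..B}. poly (p k) t < 1} < ennreal ((1 / 2) ^ k)"
    "\<And>k. inner x (opoly A (p k) x) < (1 / 2) ^ k" by (auto simp: P_def)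
  define S where "S k = {t \<in> {-B..B}. poly (p k) t < 1}" for k
  have [measurable]: "poly (p k) \<in> borel_measurable borel" for k
    by (intro borel_measurable_continuous_onI continuous_intros)
  have Sm [measurable]: "S k \<in> sets borel" for k unfolding S_def by measurable
  define N where "N = (\<Inter>k. \<Union>j\<in>{k..}. S j)"
  have Nm [measurable]: "N \<in> sets borel" unfolding N_def by measurable
  have "emeasure lborel N = 0"
  proof -
    have le: "emeasure lborel N \<le> ennreal (2 * (1 / 2) ^ k)" for k
    proof -
      have sums: "(\<lambda>j. (1 / 2) ^ (j + k) :: real) sums (2 * (1 / 2) ^ k)"
        using sums_mult2[OF geometric_sums[of "1 / 2 :: real"], of "(1 / 2) ^ k"] by (simp add: power_add)
      have "N \<subseteq> (\<Union>j. S (j + k))" unfolding N_def by (auto simp: le_iff_add add.commute dest!: spec[of _ k] INT_D)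
      then have "emeasure lborel N \<le> emeasure lborel (\<Union>j. S (j + k))" by (intro emeasure_mono) auto
      also have "\<dots> \<le> (\<Sum>j. emeasure lborel (S (j + k)))" by (intro emeasure_subadditive_countably) auto
      also have "\<dots> \<le> (\<Sum>j. ennreal ((1 / 2) ^ (j + k)))"
        using p(2) by (intro suminf_le) (auto simp: S_def less_imp_le)
      also have "\<dots> = ennreal (2 * (1 / 2) ^ k)"
        using sums by (intro suminf_ennreal_eq) auto
      finally show ?thesis .
    qed
    have "(\<lambda>k. ennreal (2 * (1 / 2) ^ k)) \<longlonglongrightarrow> ennreal (2 * 0)"
      by (intro tendsto_ennrealI tendsto_mult tendsto_const LIMSEQ_power_zero) simp
    then have "emeasure lborel N \<le> ennreal (2 * 0)"
      by (rule LIMSEQ_le_const) (use le in blast)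
    then show ?thesis by simp
  qed
  then have N: "N \<in> null_sets lborel" by (simp add: null_sets_def)
  \<comment> \<open>Markov's inequality: on [-B, B] outside \<open>S k\<close> the polynomial is at
    least 1.\<close>
  have big: "emeasure (SM x) (- S k) \<le> ennreal ((1 / 2) ^ k)" for k
  proof -
    have "emeasure (SM x) (- S k) = (\<integral>\<^sup>+t. indicator (- S k) t \<partial>SM x)" by simp
    also have "\<dots> \<le> (\<integral>\<^sup>+t. ennreal (poly (p k) t) \<partial>SM x)"
    proof (rule nn_integral_mono_AE)
      show "AE t in SM x. indicator (- S k) t \<le> ennreal (poly (p k) t)"
        using SM_bound[of x]
      proof eventually_elim
        fix t assume "\<bar>t\<bar> \<le> B"
        then have "t \<in> {-B..B}" by auto
        then show "indicator (- S k) t \<le> ennreal (poly (p k) t)"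
          by (auto simp: indicator_def S_def not_less)
      qed
    qed
    also have "\<dots> = ennreal (\<integral>t. poly (p k) t \<partial>SM x)"
    proof (rule nn_integral_eq_integral)
      show "AE t in SM x. 0 \<le> poly (p k) t"
        using SM_bound[of x] by eventually_elim (rule p(1), auto)
    qed simp
    also have "\<dots> \<le> ennreal ((1 / 2) ^ k)"
      using p(3)[of k] by (intro ennreal_leI) (simp add: SM_poly)
    finally show ?thesis .
  qed
  have "emeasure (SM x) (UNIV - N) = 0"
  proof -
    have "emeasure (SM x) (\<Inter>j\<in>{k..}. - S j) = 0" for k
    proof -
      have le: "emeasure (SM x) (\<Inter>j\<in>{k..}. - S j) \<le> ennreal ((1 / 2) ^ (j + k))" for j
        by (rule order_trans[OF emeasure_mono big]) (auto simp: sets_SM)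
      have "(\<lambda>j. ennreal ((1 / 2) ^ (j + k))) \<longlonglongrightarrow> ennreal 0"
        by (intro tendsto_ennrealI LIMSEQ_ignore_initial_segment LIMSEQ_power_zero) simp
      then have "emeasure (SM x) (\<Inter>j\<in>{k..}. - S j) \<le> ennreal 0"
        by (rule LIMSEQ_le_const) (use le in blast)
      then show ?thesis by simp
    qed
    then have "(\<Union>k. \<Inter>j\<in>{k..}. - S j) \<in> null_sets (SM x)"
      by (intro null_sets_UN) (auto simp: null_sets_def sets_SM)
    moreover have "UNIV - N = (\<Union>k. \<Inter>j\<in>{k..}. - S j)" by (auto simp: N_def)
    ultimately show ?thesis by (simp add: null_sets_def)
  qed
  with N show ?thesis using that by blast
qed

end

section \<open>The spectrum, and intersection of the three families\<close>

text \<open>One parameter \<open>s\<close> serves the level and the momentum: E = c + 2 \<nu> cos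
  \<theta> with c = a + s (b - a) and cos \<theta> = 2 s - 1 runs through [a - 2 \<nu>, b + 2 \<nu>]
  as \<open>s\<close> runs through [0, 1].\<close>

lemma wave_spectrum:
  fixes v :: "int ^ 'n \<Rightarrow> real"
  assumes ab: "a < b" and v: "v \<in> configs a b"
    and wave: "\<And>s k. s \<in> \<rat> \<Longrightarrow> 0 \<le> s \<Longrightarrow> s \<le> 1 \<Longrightarrow> v \<in> wave_set a b s k"
    and E: "a - 2 * real CARD('n) \<le> E" "E \<le> b + 2 * real CARD('n)" and e: "0 < e"
  shows "\<exists>u. u \<noteq> 0 \<and> norm (hop neighbours v u - E *\<^sub>R u) \<le> e * norm u"
proof -
  define \<nu> where "\<nu> = real CARD('n)"
  have nu: "1 \<le> \<nu>" by (simp add: \<nu>_def Suc_leI)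
  define s where "s = (E - (a - 2 * \<nu>)) / (b - a + 4 * \<nu>)"
  have den: "0 < b - a + 4 * \<nu>" using ab nu by linarith
  have s: "0 \<le> s" "s \<le> 1" using E den by (auto simp: s_def \<nu>_def field_simps)
  have Es: "E = a - 2 * \<nu> + s * (b - a + 4 * \<nu>)" using den by (simp add: s_def)
  define c where "c = a + s * (b - a)"
  define \<theta> where "\<theta> = arccos (2 * s - 1)"
  have E': "E = c + 2 * \<nu> * cos \<theta>" using s unfolding Es c_def \<theta>_def by (simp add: algebra_simps)
  define C where "C = \<bar>a\<bar> + \<bar>b\<bar>"
  define K where "K = 2 * \<nu> + C + \<bar>c + 2 * \<nu> * cos \<theta>\<bar>"
  define F where "F k = (2 / real (k + 1))\<^sup>2 + K\<^sup>2 * (4 * \<nu> * 3 ^ CARD('n) / (2 * real k + 1))" for k :: nat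
  have "F \<longlonglongrightarrow> 0"
    unfolding F_def by real_asymp
  then have "\<forall>\<^sub>F k in sequentially. F k < e\<^sup>2" by (rule order_tendstoD) (use e in simp)
  then have "\<forall>\<^sub>F k in sequentially. F k < e\<^sup>2 \<and> 0 < k" by (intro eventually_conj eventually_gt_at_top)
  then obtain k where k: "F k < e\<^sup>2" "0 < k" using eventually_happens'[OF sequentially_bot] by blast
  \<comment> \<open>A rational level near \<open>s\<close> that stays in [0, 1]: the end points are
    rational themselves, and any other \<open>s\<close> is approached from below.\<close>
  obtain s' where s': "s' \<in> \<rat>" "0 \<le> s'" "s' \<le> 1" "\<bar>s' - s\<bar> * (b - a) \<le> 1 / real (k + 1)"
  proof (cases "s = 0 \<or> s = 1")
    case True
    then show ?thesis using that[of s] by auto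
  next
    case False
    define l where "l = max 0 (s - 1 / (real (k + 1) * (b - a)))"
    have "l < s" using False s ab by (auto simp: l_def)
    then obtain s' where "s' \<in> \<rat>" "l < s'" "s' < s" using Rats_dense_in_real by blast
    moreover from this have "\<bar>s' - s\<bar> \<le> 1 / (real (k + 1) * (b - a))" by (auto simp: l_def)
    then have "\<bar>s' - s\<bar> * (b - a) \<le> 1 / (real (k + 1) * (b - a)) * (b - a)"
      using ab by (intro mult_right_mono) auto
    ultimately show ?thesis using that[of s'] s ab by (auto simp: l_def)
  qed
  obtain x where x: "\<And>n. n \<in> cube x k \<Longrightarrow> \<bar>v n - (a + s' * (b - a))\<bar> < 1 / real (k + 1)"
    using wave[OF s'(1-3), of k] unfolding wave_set_def by blast
  have near: "\<bar>v n - c\<bar> \<le> 2 / real (k + 1)" if "n \<in> cube x k" for n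
  proof -
    have "v n - c = (v n - (a + s' * (b - a))) + (s' - s) * (b - a)" by (simp add: c_def algebra_simps)
    also have "\<bar>\<dots>\<bar> \<le> \<bar>v n - (a + s' * (b - a))\<bar> + \<bar>s' - s\<bar> * (b - a)"
      using ab by (intro order_trans[OF abs_triangle_ineq]) (simp add: abs_mult)
    also have "\<dots> \<le> 1 / real (k + 1) + 1 / real (k + 1)" using x[OF that] s'(4) by linarith
    finally show ?thesis by simp
  qed
  have vb: "\<bar>v n\<bar> \<le> C" for n using configs_bound[OF v] by (simp add: C_def)
  obtain u where u: "u \<noteq> 0" "(norm (hop neighbours v u - (c + 2 * \<nu> * cos \<theta>) *\<^sub>R u))\<^sup>2 \<le> F k * (norm u)\<^sup>2"
    using plane_wave[of v C x k c "2 / real (k + 1)" \<theta>, OF vb near k(2)] unfolding F_def K_def \<nu>_def by blast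
  have "(norm (hop neighbours v u - E *\<^sub>R u))\<^sup>2 \<le> (e * norm u)\<^sup>2"
    using u(2) mult_right_mono[OF less_imp_le[OF k(1)], of "(norm u)\<^sup>2", OF zero_le_power2] unfolding E' power_mult_distrib by linarith
  then have "norm (hop neighbours v u - E *\<^sub>R u) \<le> e * norm u"
    by (rule power2_le_imp_le) (use e in simp)
  then show ?thesis using u(1) by blast
qed

lemma countable_lattice: "countable (UNIV :: (int ^ 'n) set)"
proof -
  have "(UNIV :: (int ^ 'n) set) = (\<Union>r. cube 0 r)"
  proof (intro equalityI subsetI)
    fix x :: "int ^ 'n"
    obtain r where "{x} \<subseteq> cube 0 r" using finite_subset_cube[of "{x}"] by auto
    then show "x \<in> (\<Union>r. cube 0 r)" by auto
  qed simp
  also have "countable \<dots>" by (rule countable_UN) (auto intro: countable_finite)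
  finally show ?thesis .
qed

theorem theorem2:
  fixes a b :: real
  assumes "a < b"
  shows "\<exists>G :: (int ^ 'n \<Rightarrow> real) set.
           gdelta_in (config_space a b) G \<and>
           config_space a b closure_of G = topspace (config_space a b) \<and>
           (\<forall>v\<in>G. spectrum (jacobi v) =
                     complex_of_real ` {a - 2 * real CARD('n) .. b + 2 * real CARD('n)} \<and>
                   purely_singular_continuous (jacobi v))"
proof -
  define \<G> :: "(int ^ 'n \<Rightarrow> real) set set" where
    "\<G> = (\<lambda>(s, k). wave_set a b s k) ` ((\<rat> \<inter> {0..1}) \<times> UNIV) \<union>
      (\<lambda>(m, k). atomless_set a b m k) ` UNIV \<union> (\<lambda>(m, k). singular_set a b m k) ` UNIV"
  have "countable (UNIV :: ((int ^ 'n) \<times> nat) set)"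
    unfolding UNIV_Times_UNIV[symmetric] by (intro countable_SIGMA countable_lattice) auto
  moreover have "countable ((\<rat> \<inter> {0..1 :: real}) \<times> (UNIV :: nat set))"
    by (intro countable_SIGMA countable_Int1 countable_rat) auto
  ultimately have count: "countable \<G>"
    unfolding \<G>_def by (intro countable_Un countable_image)
  have ne: "\<G> \<noteq> {}" unfolding \<G>_def by auto
  have op: "openin (config_space a b) U" if "U \<in> \<G>" for U
    using that unfolding \<G>_def by (auto intro: openin_wave_set openin_atomless_set openin_singular_set)
  have dense: "config_space a b closure_of U = topspace (config_space a b)" if "U \<in> \<G>" for U
    using that assms unfolding \<G>_def
    by (auto simp: dense_wave_set dense_atomless_set dense_singular_set)
  note G = config_Baire[OF count ne op dense]
  have "spectrum (jacobi v) = complex_of_real ` {a - 2 * real CARD('n) .. b + 2 * real CARD('n)} \<and>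
      purely_singular_continuous (jacobi v)" if v: "v \<in> \<Inter>\<G>" for v
  proof -
    define B where "B = 2 * real CARD('n) + (\<bar>a\<bar> + \<bar>b\<bar>) + 1"
    have wave: "v \<in> wave_set a b s k" if "s \<in> \<rat>" "0 \<le> s" "s \<le> 1" for s k
    proof -
      have "(s, k) \<in> (\<rat> \<inter> {0..1}) \<times> UNIV" using that by auto
      from imageI[OF this, of "\<lambda>(s, k). wave_set a b s k :: (int ^ 'n \<Rightarrow> real) set"] have "wave_set a b s k \<in> \<G>" unfolding \<G>_def by simp
      then show ?thesis using v by blast
    qed
    have atom: "v \<in> atomless_set a b m k" and sing: "v \<in> singular_set a b m k" for m k
    proof -
      have "atomless_set a b m k \<in> \<G>"
        using rangeI[of "\<lambda>(m, k). atomless_set a b m k" "(m, k)"] unfolding \<G>_def by simp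
      moreover have "singular_set a b m k \<in> \<G>"
        using rangeI[of "\<lambda>(m, k). singular_set a b m k" "(m, k)"] unfolding \<G>_def by simp
      ultimately show "v \<in> atomless_set a b m k" "v \<in> singular_set a b m k" using v by blast+
    qed
    have vc: "v \<in> configs a b" using atom by (auto simp: atomless_set_def)
    interpret csymop "hop neighbours v" B unfolding B_def by (rule hop_config_csymop[OF vc])
    have J: "jacobi v = hop neighbours v" by (rule jacobi_eq_hop) (rule configs_bound[OF vc])
    have nb: "real (card (neighbours :: (int ^ 'n) set)) = 2 * real CARD('n)" by (simp add: card_neighbours)
    have "spectrum (hop neighbours v) \<subseteq> complex_of_real ` {a - 2 * real CARD('n) .. b + 2 * real CARD('n)}"
    proof (rule spectrum_subset)
      fix u
      have v: "a \<le> v n" "v n \<le> b" for n using vc by (auto simp: configs_def)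
      show "(a - 2 * real CARD('n)) * (norm u)\<^sup>2 \<le> inner u (hop neighbours v u)"
        using inner_hop_bounds(1)[where a = a and v = v and b = b and J = neighbours and u = u, OF v] by (simp only: nb)
      show "inner u (hop neighbours v u) \<le> (b + 2 * real CARD('n)) * (norm u)\<^sup>2"
        using inner_hop_bounds(2)[where a = a and v = v and b = b and J = neighbours and u = u, OF v] by (simp only: nb)
    qed
    moreover have "complex_of_real E \<in> spectrum (hop neighbours v)"
      if "a - 2 * real CARD('n) \<le> E" "E \<le> b + 2 * real CARD('n)" for E
      by (rule spectrum_memI) (rule wave_spectrum[OF assms vc wave that])
    ultimately have spec: "spectrum (jacobi v) = complex_of_real ` {a - 2 * real CARD('n) .. b + 2 * real CARD('n)}"
      unfolding J by auto
    \<comment> \<open>Energies outside [-B, B] carry no mass. Inside, Chebyshev's inequality with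
      the polynomial \<open>q\<close> supplied by \<open>atomless_set\<close> bounds the atom by 1 /
      (k + 1) for every \<open>k\<close>.\<close>
    have at: "emeasure (SM (ket m)) {E} = 0" for m E
    proof (cases "\<bar>E\<bar> \<le> B")
      case False
      have "AE t in SM (ket m). t \<noteq> E" using SM_bound[of "ket m"] by eventually_elim (use False in auto)
      then show ?thesis by (subst (asm) AE_iff_measurable[where N = "{E}"]) (auto simp: sets_SM)
    next
      case True
      have "measure (SM (ket m)) {E} \<le> 1 / real (k + 1)" for k
      proof -
        obtain Q d where Q: "0 < d" "\<exists>q\<in>Q. inner (ket m) (opoly (hop neighbours v) (q\<^sup>2) (ket m)) + d < 1 / real (k + 1) * (poly q E)\<^sup>2"
          using atom[of m k] True unfolding atomless_set_def B_def by blast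
        then obtain q where "inner (ket m) (opoly (hop neighbours v) (q\<^sup>2) (ket m)) + d < 1 / real (k + 1) * (poly q E)\<^sup>2"
          by blast
        with Q(1) have q: "inner (ket m) (opoly (hop neighbours v) (q\<^sup>2) (ket m)) < 1 / real (k + 1) * (poly q E)\<^sup>2"
          by linarith
        have "measure (SM (ket m)) {E} * (poly q E)\<^sup>2 = (\<integral>t. (poly q E)\<^sup>2 * indicator {E} t \<partial>SM (ket m))"
          by (simp add: sets_SM)
        also have "\<dots> \<le> (\<integral>t. poly (q\<^sup>2) t \<partial>SM (ket m))"
        proof (rule integral_mono_AE)
          show "integrable (SM (ket m)) (\<lambda>t. (poly q E)\<^sup>2 * indicator {E} t)"
            by (intro integrable_mult_right integrable_real_indicator) (auto simp: sets_SM SM.emeasure_finite top.not_eq_extremum[symmetric])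
          show "AE t in SM (ket m). (poly q E)\<^sup>2 * indicator {E} t \<le> poly (q\<^sup>2) t"
            by (auto simp: indicator_def)
        qed (rule integrable_poly)
        also have "\<dots> < 1 / real (k + 1) * (poly q E)\<^sup>2" using q by (simp only: SM_poly)
        finally have "measure (SM (ket m)) {E} < 1 / real (k + 1)"
          by (rule mult_right_less_imp_less) (rule zero_le_power2)
        then show ?thesis by (rule less_imp_le)
      qed
      then have "measure (SM (ket m)) {E} \<le> 0"
        by (intro LIMSEQ_le_const[OF LIMSEQ_inverse_real_of_nat]) (auto simp: inverse_eq_divide add.commute)
      then show ?thesis by (simp add: SM.emeasure_eq_measure measure_le_0_iff)
    qed
    have ns: "nearly_singular ((1 / 2) ^ k) (ket m)" for m k
      using sing[of m k] unfolding singular_set_def B_def by blast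
    have "\<exists>N. N \<in> null_sets lborel \<and> emeasure (SM (ket m)) (UNIV - N) = 0" for m
      by (rule nearly_singular_null[OF ns[of _ m]]) blast
    then obtain N where N: "\<forall>m. N m \<in> null_sets lborel \<and> emeasure (SM (ket m)) (UNIV - N m) = 0"
      using choice[of "\<lambda>m N. N \<in> null_sets lborel \<and> emeasure (SM (ket m)) (UNIV - N) = 0"] by blast
    have "purely_singular_continuous (jacobi v)"
      unfolding J
    proof (rule purely_singular_continuousI[OF at _ _ countable_lattice])
      show "N m \<in> null_sets lborel" "emeasure (SM (ket m)) (UNIV - N m) = 0" for m using N by blast+
    qed
    with spec show ?thesis ..
  qed
  with G show ?thesis by blast
qed

end
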